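(* Suppose that: (i) the observed index set $\Omega\subseteq[n]$ is drawn by the Bernoulli model with probability $p$, i.e., each index $i\in[n]$ belongs to $\Omega$ independently with probability $p$; (ii) the rank-$r$ Hankel matrix $\mathcal{H}\mathbf{x}^\natural=\mathcal{G}\mathbf{z}^\natural\in\mathbb{C}^{n_1\times n_2}$ is $\mu$-incoherent, i.e., $\|\mathbf{U}^\natural\|_{2,\infty}\le\sqrt{\mu c_s r/n}$ and $\|\mathbf{V}^\natural\|_{2,\infty}\le\sqrt{\mu c_s r/n}$, where $\mathbf{U}^\natural\mathbf{\Sigma}^\natural\mathbf{V}^{\natural *}$ is its compact SVD and $c_s=\max\{n/n_1,n/n_2\}$; (iii) the observed outliers are $\alpha p$-sparse, i.e., $\|\Pi_\Omega\mathbf{s}^\natural\|_0=\|\Pi_\Omega\mathbf{w}^\natural\|_0\le\alpha p n$. Assume moreover $p\gtrsim\mathcal{O}((c_s^2\mu^2 r^2\log n)/n)$ and $\alpha\lesssim\mathcal{O}(1/(c_s\mu r\kappa^2))$. Choose the parameters $\lambda=1/16$, $\gamma_k\in[1+1/b_0,2]$ with some fixed $b_0\ge1$, and $\eta=\tilde c/\sigma_1^\natural$ with some sufficiently small constant $\tilde c$. If the initialization satisfies $d_0\lesssim\mathcal{O}(\sqrt{\sigma_r^\natural/\kappa})$, then with probability at least $1-6n^{-2}$, the iterations of HSGD satisfy $$d_{k+1}^2\le\Big(1-\frac{\eta\sigma_r^\natural}{64}\Big)^k d_0^2.$$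
   Context: Setting: $\mathcal{H}:\mathbb{C}^n\to\mathbb{C}^{n_1\times n_2}$ is the Hankel mapping $[\mathcal{H}\mathbf{x}]_{i,j}=x_{i+j-1}$, $n=n_1+n_2-1$. $\mathcal{D}:\mathbb{C}^n\to\mathbb{C}^n$ is $[\mathcal{D}\mathbf{x}]_i=\sqrt{\varsigma_i}x_i$ with $\varsigma_i$ the number of entries on the $i$-th antidiagonal of an $n_1\times n_2$ matrix, and $\mathcal{G}=\mathcal{H}\mathcal{D}^{-1}$. Data: $\mathbf{f}=\mathcal{D}\mathbf{y}=\mathbf{z}^\natural+\mathbf{s}^\natural$ with $\mathbf{z}^\natural=\mathcal{D}\mathbf{x}^\natural$ (low-rank Hankel part) and $\mathbf{s}^\natural=\mathcal{D}\mathbf{w}^\natural$ (sparse outliers); only $\Pi_\Omega\mathbf{f}$ is observed, where $[\Pi_\Omega\mathbf{v}]_i=v_i$ if $i\in\Omega$ and $0$ otherwise. $\sigma_i^\natural$ are the singular values of $\mathcal{H}\mathbf{x}^\natural$, $\kappa=\sigma_1^\natural/\sigma_r^\natural$. Loss: $\ell(\mathbf{L},\mathbf{R};\mathbf{s})=\frac{1}{2p}\|\Pi_\Omega(\mathcal{G}^*(\mathbf{L}\mathbf{R}^* )+\mathbf{s}-\mathbf{f})\|_2^2+\frac12\|(\mathcal{I}-\mathcal{G}\mathcal{G}^* )(\mathbf{L}\mathbf{R}^* )\|_F^2+\frac{\lambda}{4}\|\mathbf{L}^*\mathbf{L}-\mathbf{R}^*\mathbf{R}\|_F^2$. $\Gamma_{\tilde\alpha}(\mathbf{v})$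 keeps the $\tilde\alpha n$ largest-magnitude entries of $\mathbf{v}$ and zeros the rest. HSGD: initialization $\mathbf{s}^{(0)}=\mathcal{D}\Gamma_{\alpha p}(\mathcal{D}^{-1}\Pi_\Omega\mathbf{f})$; $\mathbf{U}^{(0)}\mathbf{\Sigma}^{(0)}\mathbf{V}^{(0)*}$ is the rank-$r$ truncated SVD of $p^{-1}\mathcal{G}(\Pi_\Omega\mathbf{f}-\mathbf{s}^{(0)})$; $\tilde{\mathbf{L}}^{(0)}=\mathbf{U}^{(0)}(\mathbf{\Sigma}^{(0)})^{1/2}$, $\tilde{\mathbf{R}}^{(0)}=\mathbf{V}^{(0)}(\mathbf{\Sigma}^{(0)})^{1/2}$; convex sets $\mathcal{L}=\{\mathbf{L}:\|\mathbf{L}\|_{2,\infty}^2\le\frac{2\mu r c_s}{n}\|\tilde{\mathbf{L}}^{(0)}\|_2^2\}$, $\mathcal{R}=\{\mathbf{R}:\|\mathbf{R}\|_{2,\infty}^2\le\frac{2\mu r c_s}{n}\|\tilde{\mathbf{R}}^{(0)}\|_2^2\}$; $\mathbf{L}^{(0)}=\Pi_{\mathcal{L}}\tilde{\mathbf{L}}^{(0)}$, $\mathbf{R}^{(0)}=\Pi_{\mathcal{R}}\tilde{\mathbf{R}}^{(0)}$. Iterations: $\mathbf{s}^{(k+1)}=\Gamma_{\gamma_k\alpha p}(\Pi_\Omega(\mathbf{f}-\mathcal{G}^*(\mathbf{L}^{(k)}\mathbf{R}^{(k)*})))$, $\mathbf{L}^{(k+1)}=\Pi_{\mathcal{L}}(\mathbf{L}^{(k)}-\eta\nabla_{\mathbf{L}}\ell(\mathbf{L}^{(k)},\mathbf{R}^{(k)};\mathbf{s}^{(k+1)}))$,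 $\mathbf{R}^{(k+1)}=\Pi_{\mathcal{R}}(\mathbf{R}^{(k)}-\eta\nabla_{\mathbf{R}}\ell(\mathbf{L}^{(k)},\mathbf{R}^{(k)};\mathbf{s}^{(k+1)}))$. Error: $d_k=\min_{\mathbf{Q}}\sqrt{\|\mathbf{L}^{(k)}-\mathbf{L}^\natural\mathbf{Q}\|_F^2+\|\mathbf{R}^{(k)}-\mathbf{R}^\natural\mathbf{Q}\|_F^2}$ over $r\times r$ rotation (unitary) matrices $\mathbf{Q}$, with $\mathbf{L}^\natural=\mathbf{U}^\natural\mathbf{\Sigma}^{\natural 1/2}$, $\mathbf{R}^\natural=\mathbf{V}^\natural\mathbf{\Sigma}^{\natural 1/2}$. *)

theory Defs
  imports "HOL-Probability.Probability"
begin

text \<open>Vectors in C^n are functions nat => complex (only indices 0..n-1 matter);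
  matrices are functions nat => nat => complex (only the indices inside the stated
  dimensions matter). Indices are 0-based: [H x]_{a,b} = x_{a+b}.\<close>

type_synonym cvec = "nat \<Rightarrow> complex"
type_synonym cmat = "nat \<Rightarrow> nat \<Rightarrow> complex"

definition hank :: "cvec \<Rightarrow> cmat" where
  "hank x = (\<lambda>a b. x (a + b))"

definition vsig :: "nat \<Rightarrow> nat \<Rightarrow> nat \<Rightarrow> nat" where
  "vsig n1 n2 i = card {(a, b). a < n1 \<and> b < n2 \<and> a + b = i}"

definition Dop :: "nat \<Rightarrow> nat \<Rightarrow> cvec \<Rightarrow> cvec" where
  "Dop n1 n2 x = (\<lambda>i. complex_of_real (sqrt (real (vsig n1 n2 i))) * x i)"

definition Dinv :: "nat \<Rightarrow> nat \<Rightarrow> cvec \<Rightarrow> cvec" where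
  "Dinv n1 n2 x = (\<lambda>i. x i / complex_of_real (sqrt (real (vsig n1 n2 i))))"

definition Gop :: "nat \<Rightarrow> nat \<Rightarrow> cvec \<Rightarrow> cmat" where
  "Gop n1 n2 z = hank (Dinv n1 n2 z)"

definition Gadj :: "nat \<Rightarrow> nat \<Rightarrow> cmat \<Rightarrow> cvec" where
  "Gadj n1 n2 M = (\<lambda>i. (\<Sum>(a, b)\<in>{(a, b). a < n1 \<and> b < n2 \<and> a + b = i}. M a b)
                        / complex_of_real (sqrt (real (vsig n1 n2 i))))"

definition projO :: "nat set \<Rightarrow> cvec \<Rightarrow> cvec" where
  "projO \<Omega> v = (\<lambda>i. if i \<in> \<Omega> then v i else 0)"

definition mmul :: "nat \<Rightarrow> cmat \<Rightarrow> cmat \<Rightarrow> cmat" where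
  "mmul k A B = (\<lambda>i j. \<Sum>l<k. A i l * B l j)"

definition ctr :: "cmat \<Rightarrow> cmat" where
  "ctr A = (\<lambda>i j. cnj (A j i))"

definition msub :: "cmat \<Rightarrow> cmat \<Rightarrow> cmat" where
  "msub A B = (\<lambda>i j. A i j - B i j)"

definition madd :: "cmat \<Rightarrow> cmat \<Rightarrow> cmat" where
  "madd A B = (\<lambda>i j. A i j + B i j)"

definition mscale :: "complex \<Rightarrow> cmat \<Rightarrow> cmat" where
  "mscale c A = (\<lambda>i j. c * A i j)"

definition idm :: cmat where
  "idm = (\<lambda>i j. if i = j then 1 else 0)"

definition diagm :: "(nat \<Rightarrow> real) \<Rightarrow> cmat" where
  "diagm \<sigma> = (\<lambda>i j. if i = j then complex_of_real (\<sigma> i) else 0)"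

definition mat_eq :: "nat \<Rightarrow> nat \<Rightarrow> cmat \<Rightarrow> cmat \<Rightarrow> bool" where
  "mat_eq m k A B \<longleftrightarrow> (\<forall>i<m. \<forall>j<k. A i j = B i j)"

definition fro2 :: "nat \<Rightarrow> nat \<Rightarrow> cmat \<Rightarrow> real" where
  "fro2 m k A = (\<Sum>i<m. \<Sum>j<k. (cmod (A i j))\<^sup>2)"

definition norm2inf :: "nat \<Rightarrow> nat \<Rightarrow> cmat \<Rightarrow> real" where
  "norm2inf m k A = Max ((\<lambda>i. sqrt (\<Sum>j<k. (cmod (A i j))\<^sup>2)) ` {..<m})"

definition opnorm :: "nat \<Rightarrow> nat \<Rightarrow> cmat \<Rightarrow> real" where
  "opnorm m k A = Sup {sqrt (\<Sum>i<m. (cmod (\<Sum>j<k. A i j * v j))\<^sup>2) | v.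
                         (\<Sum>j<k. (cmod (v j))\<^sup>2) \<le> 1}"

definition orthcols :: "nat \<Rightarrow> nat \<Rightarrow> cmat \<Rightarrow> bool" where
  "orthcols m q U \<longleftrightarrow> mat_eq q q (mmul m (ctr U) U) idm"

definition svd_form :: "nat \<Rightarrow> nat \<Rightarrow> nat \<Rightarrow> cmat \<Rightarrow> cmat \<Rightarrow> (nat \<Rightarrow> real) \<Rightarrow> cmat \<Rightarrow> bool" where
  "svd_form m k q M U \<sigma> V \<longleftrightarrow>
     orthcols m q U \<and> orthcols k q V \<and>
     (\<forall>i. i + 1 < q \<longrightarrow> \<sigma> (i + 1) \<le> \<sigma> i) \<and> (\<forall>i<q. 0 \<le> \<sigma> i) \<and>
     mat_eq m k M (mmul q (mmul q U (diagm \<sigma>)) (ctr V))"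

definition compact_svd :: "nat \<Rightarrow> nat \<Rightarrow> nat \<Rightarrow> cmat \<Rightarrow> cmat \<Rightarrow> (nat \<Rightarrow> real) \<Rightarrow> cmat \<Rightarrow> bool" where
  "compact_svd m k r M U \<sigma> V \<longleftrightarrow> svd_form m k r M U \<sigma> V \<and> (\<forall>i<r. 0 < \<sigma> i)"

definition trunc_svd :: "nat \<Rightarrow> nat \<Rightarrow> nat \<Rightarrow> cmat \<Rightarrow> cmat \<Rightarrow> (nat \<Rightarrow> real) \<Rightarrow> cmat \<Rightarrow> bool" where
  "trunc_svd m k r M U \<sigma> V \<longleftrightarrow> r \<le> min m k \<and>
     (\<exists>Uf \<sigma>f Vf. svd_form m k (min m k) M Uf \<sigma>f Vf \<and>
        (\<forall>i j. j < r \<longrightarrow> U i j = Uf i j) \<and> (\<forall>i j. j < r \<longrightarrow> V i j = Vf i j) \<and>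
        (\<forall>i<r. \<sigma> i = \<sigma>f i))"

text \<open>Hard thresholding Gamma: w keeps m (capped at n) largest-magnitude entries of v
  (any valid tie-breaking) and zeros the rest.\<close>
definition hard_thr :: "nat \<Rightarrow> nat \<Rightarrow> cvec \<Rightarrow> cvec \<Rightarrow> bool" where
  "hard_thr n m v w \<longleftrightarrow> (\<exists>S \<subseteq> {..<n}. card S = min m n \<and>
      (\<forall>i\<in>S. \<forall>j\<in>{..<n} - S. cmod (v j) \<le> cmod (v i)) \<and>
      (\<forall>i<n. w i = (if i \<in> S then v i else 0)))"

definition keep :: "real \<Rightarrow> nat \<Rightarrow> nat" where
  "keep a n = nat \<lfloor>a * real n\<rfloor>"

definition is_row_proj :: "nat \<Rightarrow> nat \<Rightarrow> real \<Rightarrow> cmat \<Rightarrow> cmat \<Rightarrow> bool" where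
  "is_row_proj m k B A P \<longleftrightarrow> (norm2inf m k P)\<^sup>2 \<le> B \<and>
     (\<forall>X. (norm2inf m k X)\<^sup>2 \<le> B \<longrightarrow> fro2 m k (msub A P) \<le> fro2 m k (msub A X))"

text \<open>Gradients of the loss l(L,R;s) (real gradients w.r.t. the real inner product
  Re tr(A^* B)), written out.\<close>
definition residual :: "nat \<Rightarrow> nat \<Rightarrow> nat \<Rightarrow> nat set \<Rightarrow> cvec \<Rightarrow> cvec \<Rightarrow> cmat \<Rightarrow> cmat \<Rightarrow> cmat" where
  "residual n1 n2 r \<Omega> f s L R =
     Gop n1 n2 (projO \<Omega> (\<lambda>i. Gadj n1 n2 (mmul r L (ctr R)) i + s i - f i))"

definition perpLR :: "nat \<Rightarrow> nat \<Rightarrow> nat \<Rightarrow> cmat \<Rightarrow> cmat \<Rightarrow> cmat" where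
  "perpLR n1 n2 r L R = msub (mmul r L (ctr R)) (Gop n1 n2 (Gadj n1 n2 (mmul r L (ctr R))))"

definition balE :: "nat \<Rightarrow> nat \<Rightarrow> cmat \<Rightarrow> cmat \<Rightarrow> cmat" where
  "balE n1 n2 L R = msub (mmul n1 (ctr L) L) (mmul n2 (ctr R) R)"

definition gradL :: "nat \<Rightarrow> nat \<Rightarrow> nat \<Rightarrow> real \<Rightarrow> real \<Rightarrow> nat set \<Rightarrow> cvec \<Rightarrow> cvec \<Rightarrow> cmat \<Rightarrow> cmat \<Rightarrow> cmat" where
  "gradL n1 n2 r p lam \<Omega> f s L R =
     madd (madd (mscale (complex_of_real (1 / p)) (mmul n2 (residual n1 n2 r \<Omega> f s L R) R))
                (mmul n2 (perpLR n1 n2 r L R) R))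
          (mscale (complex_of_real lam) (mmul r L (balE n1 n2 L R)))"

definition gradR :: "nat \<Rightarrow> nat \<Rightarrow> nat \<Rightarrow> real \<Rightarrow> real \<Rightarrow> nat set \<Rightarrow> cvec \<Rightarrow> cvec \<Rightarrow> cmat \<Rightarrow> cmat \<Rightarrow> cmat" where
  "gradR n1 n2 r p lam \<Omega> f s L R =
     msub (madd (mscale (complex_of_real (1 / p)) (mmul n1 (ctr (residual n1 n2 r \<Omega> f s L R)) L))
                (mmul n1 (ctr (perpLR n1 n2 r L R)) L))
          (mscale (complex_of_real lam) (mmul r R (balE n1 n2 L R)))"

definition cs_of :: "nat \<Rightarrow> nat \<Rightarrow> real" where
  "cs_of n1 n2 = max (real (n1 + n2 - 1) / real n1) (real (n1 + n2 - 1) / real n2)"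

text \<open>(L, R, s) is a run of HSGD (with any admissible choices of truncated SVD and
  of tie-breaking in the hard thresholding) on the data Pi_Omega f.\<close>
definition hsgd :: "nat \<Rightarrow> nat \<Rightarrow> nat \<Rightarrow> real \<Rightarrow> real \<Rightarrow> real \<Rightarrow> real \<Rightarrow> real \<Rightarrow> (nat \<Rightarrow> real)
     \<Rightarrow> nat set \<Rightarrow> cvec \<Rightarrow> (nat \<Rightarrow> cmat) \<Rightarrow> (nat \<Rightarrow> cmat) \<Rightarrow> (nat \<Rightarrow> cvec) \<Rightarrow> bool" where
  "hsgd n1 n2 r \<mu> \<alpha> p lam \<eta> \<gamma> \<Omega> f L R s \<longleftrightarrow>
    (let n = n1 + n2 - 1; cs = cs_of n1 n2 in
     (\<exists>v. hard_thr n (keep (\<alpha> * p) n) (Dinv n1 n2 (projO \<Omega> f)) v \<and>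
          (\<forall>i<n. s 0 i = Dop n1 n2 v i)) \<and>
     (\<exists>U0 \<sigma>0 V0.
        trunc_svd n1 n2 r (mscale (complex_of_real (1 / p))
                 (Gop n1 n2 (\<lambda>i. projO \<Omega> f i - s 0 i))) U0 \<sigma>0 V0 \<and>
        (let Lt = mmul r U0 (diagm (\<lambda>i. sqrt (\<sigma>0 i)));
             Rt = mmul r V0 (diagm (\<lambda>i. sqrt (\<sigma>0 i)));
             BL = 2 * \<mu> * real r * cs / real n * (opnorm n1 r Lt)\<^sup>2;
             BR = 2 * \<mu> * real r * cs / real n * (opnorm n2 r Rt)\<^sup>2 in
         is_row_proj n1 r BL Lt (L 0) \<and> is_row_proj n2 r BR Rt (R 0) \<and>
         (\<forall>k. (\<exists>v. hard_thr n (keep (\<gamma> k * \<alpha> * p) n)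
                      (projO \<Omega> (\<lambda>i. f i - Gadj n1 n2 (mmul r (L k) (ctr (R k))) i)) v \<and>
                   (\<forall>i<n. s (Suc k) i = v i)) \<and>
              is_row_proj n1 r BL
                (msub (L k) (mscale (complex_of_real \<eta>)
                   (gradL n1 n2 r p lam \<Omega> f (s (Suc k)) (L k) (R k)))) (L (Suc k)) \<and>
              is_row_proj n2 r BR
                (msub (R k) (mscale (complex_of_real \<eta>)
                   (gradR n1 n2 r p lam \<Omega> f (s (Suc k)) (L k) (R k)))) (R (Suc k))))))"

definition dist_fac :: "nat \<Rightarrow> nat \<Rightarrow> nat \<Rightarrow> cmat \<Rightarrow> cmat \<Rightarrow> cmat \<Rightarrow> cmat \<Rightarrow> real" where
  "dist_fac n1 n2 r Lnat Rnat L R =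
     Inf {sqrt (fro2 n1 r (msub L (mmul r Lnat Q)) + fro2 n2 r (msub R (mmul r Rnat Q))) | Q.
            orthcols r r Q}"

definition bern_model :: "nat \<Rightarrow> real \<Rightarrow> (nat \<Rightarrow> bool) pmf" where
  "bern_model n p = Pi_pmf {..<n} False (\<lambda>_. bernoulli_pmf p)"

end

theory Submission
  imports Defs
begin

text \<open>The sampling enters only through three events. Writing \<open>\<delta>\<close> for the indicator of the observed
  set and \<open>\<tau> = c\<^sub>s \<mu> r\<close>, the hypothesis \<open>p \<ge> C \<tau>\<^sup>2 log n / n\<close> gives, with probability at least
  \<open>1 - 6 n\<^sup>-\<^sup>2\<close>: the quadratic form \<open>\<Sum> (\<delta>/p - 1) |G\<^sup>*(U X\<^sup>* + Y V\<^sup>*)|\<^sup>2\<close> is small (a Bernstein inequality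
  in the Hilbert-Schmidt norm, which is affordable because of the square of \<open>\<tau>\<close>); the random Hankel
  matrix of \<open>(\<delta>/p - 1) x\<close> has small operator norm (its norm is at most the largest Fourier
  coefficient, so scalar concentration suffices); and long intervals contain the expected number of
  samples up to a factor 2. The second event keeps the row constraints of the algorithm comparable
  with the incoherence of the truth.

  On these events every step contracts. If \<open>\<Delta>\<^sub>L\<close>, \<open>\<Delta>\<^sub>R\<close> are the deviations of \<open>L\<close>, \<open>R\<close> from the
  optimally rotated true factors, the error of the product is \<open>T + D\<close> with \<open>T\<close> tangent and \<open>D = \<Delta>\<^sub>L \<Delta>\<^sub>R\<^sup>*\<close>. Away from the
  corners of the matrix the sampled energy of \<open>D\<close> is at most a constant times
  \<open>|\<Delta>\<^sub>L|\<^sup>2 |\<Delta>\<^sub>R|\<^sup>2\<close>, by splitting each antidiagonal according to which index is larger. At the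
  remaining corner samples, where no such bound independent of the condition number holds, the
  pointwise inequality \<open>t\<^sup>2 + 3 t d + 2 d\<^sup>2 \<ge> d\<^sup>2 - (5/4) t\<^sup>2\<close> shows that \<open>D\<close> helps, while \<open>T\<close> is small
  there by incoherence.\<close>

subsection \<open>Concentration for Bernoulli sampling\<close>

text \<open>The three events speak of the truth alone, never of an iterate. They are fixed once, and
  on them the whole run is deterministic: neither fresh samples per step nor a union bound over the
  steps enters. The price is that the iterates depend on the observed set, so the quadratic part
  \<open>D\<close> of the error, which lies outside the tangent space, has to be controlled for all
  matrices at once; this is what the counting event is for.

  The natural unit is \<nu> = \<tau>/n, which bounds the squared rows of the singular vectors. One
  antidiagonal, seen as a functional on the tangent space, has squared norm at most 2 \<nu>, so the
  Hilbert-Schmidt variance is about n \<nu>^2 / p = \<tau>^2 / (n p); deviations of constant size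
  with failure probability n^(-3) then cost one more logarithm.

  To keep the condition number out of the local estimates, errors are compared with
  \<open>T2\<close>, the deviation weighted by the singular values, and not with its plain square
  \<open>d2\<close>. The two are linked by \<open>T2\<close> \<ge> \<open>sr\<close>
  \<open>d2\<close>, which is where \<open>sr\<close> in the rate \<eta> \<open>sr\<close> / 64
  comes from.\<close>

definition nsq :: "'k set \<Rightarrow> ('k \<Rightarrow> complex) \<Rightarrow> real" where
  "nsq K x = (\<Sum>k\<in>K. (cmod (x k))\<^sup>2)"

definition cip :: "'k set \<Rightarrow> ('k \<Rightarrow> complex) \<Rightarrow> ('k \<Rightarrow> complex) \<Rightarrow> real" where
  "cip K x y = (\<Sum>k\<in>K. Re (cnj (x k) * y k))"

lemma nsq_nonneg [simp]: "0 \<le> nsq K x"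
  by (simp add: nsq_def sum_nonneg)

lemma cmod_add_sq: "(cmod (a + b))\<^sup>2 = (cmod a)\<^sup>2 + (cmod b)\<^sup>2 + 2 * Re (cnj a * b)"
  by (simp only: cmod_power2) (simp add: power2_eq_square algebra_simps)

lemma nsq_add: "nsq K (\<lambda>k. x k + y k) = nsq K x + nsq K y + 2 * cip K x y"
  by (simp add: nsq_def cip_def cmod_add_sq sum.distrib sum_distrib_left)

lemma nsq_scale: "nsq K (\<lambda>k. c * x k) = (cmod c)\<^sup>2 * nsq K x"
  by (simp add: nsq_def norm_mult power_mult_distrib sum_distrib_left)

lemma cip_scale_right: "cip K x (\<lambda>k. complex_of_real c * y k) = c * cip K x y"
  by (simp add: cip_def sum_distrib_left algebra_simps)

lemma cip_le: "\<bar>cip K x y\<bar> \<le> sqrt (nsq K x) * sqrt (nsq K y)"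
proof -
  have "\<bar>cip K x y\<bar> \<le> (\<Sum>k\<in>K. \<bar>Re (cnj (x k) * y k)\<bar>)"
    unfolding cip_def by (rule sum_abs)
  also have "\<dots> \<le> (\<Sum>k\<in>K. \<bar>cmod (x k)\<bar> * \<bar>cmod (y k)\<bar>)"
  proof (rule sum_mono)
    fix k show "\<bar>Re (cnj (x k) * y k)\<bar> \<le> \<bar>cmod (x k)\<bar> * \<bar>cmod (y k)\<bar>"
      using abs_Re_le_cmod[of "cnj (x k) * y k"] by (simp add: norm_mult)
  qed
  also have "\<dots> \<le> L2_set (\<lambda>k. cmod (x k)) K * L2_set (\<lambda>k. cmod (y k)) K"
    by (rule L2_set_mult_ineq)
  finally show ?thesis by (simp add: L2_set_def nsq_def)
qed

section \<open>A Bernstein inequality for vectors, by way of cosh of the norm\<close>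

text \<open>As a power series in x, \<open>cosh (sqrt x)\<close> has the coefficients 1/(2k)!, all
  nonnegative, so it is a nonnegative combination of the convex functions x^k on x \<ge> 0.\<close>

lemma cosh_sqrt_convex:
  fixes s u v c :: real
  assumes "0 \<le> u" "0 \<le> v" "0 \<le> c" "c \<le> 1"
  shows "cosh (sqrt (c * u + (1 - c) * v)) \<le> c * cosh (sqrt u) + (1 - c) * cosh (sqrt v)"
proof -
  have ser: "(\<lambda>n. if even n then sqrt x ^ n /\<^sub>R fact n else 0) sums cosh (sqrt x)" for x :: real
    by (rule cosh_converges)
  have pw: "sqrt x ^ n = x ^ (n div 2)" if "even n" "0 \<le> x" for n and x :: real
    using that by (metis dvd_mult_div_cancel power_mult real_sqrt_pow2)
  have cv: "(c * u + (1 - c) * v) ^ n \<le> c * u ^ n + (1 - c) * v ^ n" for n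
  proof -
    have "convex_on {0::real..} (\<lambda>x. x ^ n)"
      by (cases "even n") (auto intro: convex_on_subset[OF convex_power_even] convex_power_odd)
    from convex_onD[OF this, of "1 - c" u v] assms show ?thesis by simp
  qed
  have S: "(\<lambda>n. c * (if even n then sqrt u ^ n /\<^sub>R fact n else 0)
      + (1 - c) * (if even n then sqrt v ^ n /\<^sub>R fact n else 0))
      sums (c * cosh (sqrt u) + (1 - c) * cosh (sqrt v))"
    by (intro sums_add sums_mult ser)
  show ?thesis
  proof (rule sums_le[OF _ ser S])
    fix n :: nat
    show "(if even n then sqrt (c * u + (1 - c) * v) ^ n /\<^sub>R fact n else 0)
      \<le> c * (if even n then sqrt u ^ n /\<^sub>R fact n else 0)
        + (1 - c) * (if even n then sqrt v ^ n /\<^sub>R fact n else 0)"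
    proof (cases "even n")
      case True
      have "inverse (fact n) * (c * u + (1 - c) * v) ^ (n div 2)
          \<le> inverse (fact n) * (c * u ^ (n div 2) + (1 - c) * v ^ (n div 2))"
        by (rule mult_left_mono[OF cv]) simp
      moreover have "0 \<le> c * u + (1 - c) * v" using assms by simp
      ultimately show ?thesis
        using \<open>even n\<close> assms pw[OF True] by (simp add: distrib_left mult.left_commute)
    qed simp
  qed
qed

text \<open>The squared third side of a Euclidean triangle is the mean of (a + b)^2 and (a - b)^2
  with weights (1 + c)/2 and (1 - c)/2. Convexity in the squared length gives the right side, which
  is the hyperbolic law of cosines.\<close>

lemma cosh_law_of_cosines:
  fixes a b c :: real
  assumes "0 \<le> a" "0 \<le> b" "\<bar>c\<bar> \<le> 1"
  shows "cosh (sqrt (a\<^sup>2 + b\<^sup>2 + 2 * a * b * c)) \<le> cosh a * cosh b + c * (sinh a * sinh b)"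
proof -
  have e: "a\<^sup>2 + b\<^sup>2 + 2 * a * b * c
      = ((1 + c) / 2) * (a + b)\<^sup>2 + (1 - (1 + c) / 2) * (a - b)\<^sup>2"
    by (simp add: power2_eq_square field_simps)
  have "cosh (sqrt (a\<^sup>2 + b\<^sup>2 + 2 * a * b * c))
      \<le> ((1 + c) / 2) * cosh (sqrt ((a + b)\<^sup>2)) + (1 - (1 + c) / 2) * cosh (sqrt ((a - b)\<^sup>2))"
    unfolding e by (rule cosh_sqrt_convex) (use assms in auto)
  also have "\<dots> = cosh a * cosh b + c * (sinh a * sinh b)"
    by (simp add: cosh_add cosh_diff field_simps)
  finally show ?thesis .
qed

lemma sinh_ge_self: "0 \<le> x \<Longrightarrow> x \<le> sinh (x::real)"
proof -
  assume "0 \<le> x"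
  have "(\<lambda>t. sinh t - t) 0 \<le> (\<lambda>t. sinh t - t) x"
    by (rule DERIV_nonneg_imp_nondecreasing[OF \<open>0 \<le> x\<close>])
       (auto intro!: derivative_eq_intros exI simp: cosh_real_ge_1)
  then show ?thesis by simp
qed

lemma exp_le_quad: "0 \<le> x \<Longrightarrow> x \<le> 1 \<Longrightarrow> exp x - x \<le> 1 + x\<^sup>2" for x :: real
  using exp_bound[of x] by simp

text \<open>The term linear in the multiplier \<open>t\<close> is kept exact, so that it cancels when
  \<open>t\<close> is a centred random variable.\<close>

lemma cosh_add_vec:
  obtains m where "\<And>t::real. \<bar>t\<bar> * sqrt (nsq K x) \<le> 1 \<Longrightarrow>
     cosh (sqrt (nsq K (\<lambda>k. S k + complex_of_real t * x k)))
     \<le> cosh (sqrt (nsq K S)) * (1 + t\<^sup>2 * nsq K x) + t * m"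
proof -
  define a where "a = sqrt (nsq K S)"
  define \<beta> where "\<beta> = sqrt (nsq K x)"
  define c where "c = (if a * \<beta> = 0 then 0 else cip K S x / (a * \<beta>))"
  have a0: "0 \<le> a" and b0: "0 \<le> \<beta>" by (auto simp: a_def \<beta>_def)
  have le: "\<bar>cip K S x\<bar> \<le> a * \<beta>" using cip_le[of K S x] by (simp add: a_def \<beta>_def)
  have c1: "\<bar>c\<bar> \<le> 1" using le a0 b0 by (auto simp: c_def abs_mult divide_le_eq)
  have ip: "cip K S x = a * \<beta> * c" using le by (auto simp: c_def)
  show thesis
  proof (rule that[of "\<beta> * c * sinh a"])
    fix t :: real assume t1: "\<bar>t\<bar> * sqrt (nsq K x) \<le> 1"
    define b where "b = \<bar>t\<bar> * \<beta>"
    \<comment> \<open>The sign of t moves into the cosine, so that b is a length.\<close>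
    define c' where "c' = sgn t * c"
    have b: "0 \<le> b" "b \<le> 1" using t1 b0 by (auto simp: b_def \<beta>_def)
    have bc: "b * c' = t * (\<beta> * c)" by (simp add: b_def c'_def abs_if sgn_if)
    have c': "\<bar>c'\<bar> \<le> 1" using c1 by (auto simp: c'_def abs_mult sgn_if)
    have "nsq K (\<lambda>k. S k + complex_of_real t * x k) = a\<^sup>2 + t\<^sup>2 * \<beta>\<^sup>2 + 2 * (t * (a * \<beta> * c))"
      by (simp add: nsq_add nsq_scale cip_scale_right ip) (simp add: a_def \<beta>_def)
    also have "\<dots> = a\<^sup>2 + b\<^sup>2 + 2 * a * b * c'"
      using arg_cong[OF bc, of "\<lambda>z. 2 * a * z"] by (auto simp: b_def power_mult_distrib ac_simps)
    finally have "cosh (sqrt (nsq K (\<lambda>k. S k + complex_of_real t * x k)))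
        \<le> cosh a * cosh b + c' * (sinh a * sinh b)"
      using cosh_law_of_cosines[OF a0 b(1) c'] by simp
    \<comment> \<open>Writing sinh b = b + (sinh b - b) isolates the part linear in t. The
      nonnegative rest is absorbed by cosh a \<ge> sinh a, and cosh b + sinh b - b = exp b - b \<le>
      1 + b^2.\<close>
    also have "c' * (sinh a * sinh b) = c' * sinh a * b + c' * (sinh a * (sinh b - b))"
      by (simp add: algebra_simps)
    also have "c' * (sinh a * (sinh b - b)) \<le> 1 * (cosh a * (sinh b - b))"
    proof (rule order_trans)
      show "c' * (sinh a * (sinh b - b)) \<le> 1 * (sinh a * (sinh b - b))"
        using c' a0 sinh_ge_self[OF b(1)] by (intro mult_right_mono) auto
      show "1 * (sinh a * (sinh b - b)) \<le> 1 * (cosh a * (sinh b - b))"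
        using sinh_ge_self[OF b(1)] sinh_le_cosh_real[of a] by (simp add: mult_right_mono)
    qed
    also have "cosh a * cosh b + (c' * sinh a * b + 1 * (cosh a * (sinh b - b)))
        = cosh a * (exp b - b) + c' * sinh a * b"
      by (simp add: cosh_plus_sinh[symmetric] algebra_simps)
    also have "c' * sinh a * b = t * (\<beta> * c * sinh a)"
      using arg_cong[OF bc, of "\<lambda>z. z * sinh a"] by (simp add: ac_simps)
    also have "cosh a * (exp b - b) \<le> cosh a * (1 + b\<^sup>2)"
      by (intro mult_left_mono exp_le_quad b) simp
    also have "b\<^sup>2 = t\<^sup>2 * nsq K x" by (simp add: b_def \<beta>_def power_mult_distrib)
    finally show "cosh (sqrt (nsq K (\<lambda>k. S k + complex_of_real t * x k)))
        \<le> cosh (sqrt (nsq K S)) * (1 + t\<^sup>2 * nsq K x) + t * (\<beta> * c * sinh a)"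
      by (simp add: a_def)
  qed
qed

text \<open>The centred sampling weight \<delta>/p - 1: under the Bernoulli law it has mean zero,
  variance (1 - p)/p and absolute value at most 1/p.\<close>

definition xi :: "real \<Rightarrow> bool \<Rightarrow> real" where
  "xi p b = (if b then 1 / p else 0) - 1"

text \<open>Averaging over one Bernoulli variable kills the linear term, and the variance is at most
  1/p. Norm at most p for the vector gives the smallness condition of \<open>cosh_add_vec\<close>,
  because the multipliers are at most 1/p in size.\<close>

lemma bernoulli_cosh_step:
  assumes K: "finite K" and p: "0 < p" "p \<le> 1" and x: "sqrt (nsq K x) \<le> p"
  shows "p * cosh (sqrt (nsq K (\<lambda>k. S k + complex_of_real (xi p True) * x k)))
     + (1 - p) * cosh (sqrt (nsq K (\<lambda>k. S k + complex_of_real (xi p False) * x k)))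
    \<le> exp (nsq K x / p) * cosh (sqrt (nsq K S))"
proof -
  have 1: "\<bar>xi p True\<bar> * sqrt (nsq K x) \<le> 1" "\<bar>xi p False\<bar> * sqrt (nsq K x) \<le> 1"
  proof -
    have "\<bar>xi p True\<bar> * sqrt (nsq K x) \<le> (1/p) * p"
      using p x by (intro mult_mono) (auto simp: xi_def field_simps)
    then show "\<bar>xi p True\<bar> * sqrt (nsq K x) \<le> 1" using p by simp
    have "sqrt (nsq K x) \<le> 1" using p x by linarith
    then show "\<bar>xi p False\<bar> * sqrt (nsq K x) \<le> 1" by (simp add: xi_def)
  qed
  obtain m where m: "\<And>t::real. \<bar>t\<bar> * sqrt (nsq K x) \<le> 1 \<Longrightarrow>
     cosh (sqrt (nsq K (\<lambda>k. S k + complex_of_real t * x k)))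
     \<le> cosh (sqrt (nsq K S)) * (1 + t\<^sup>2 * nsq K x) + t * m"
    using cosh_add_vec[of K x S] by blast
  let ?C = "cosh (sqrt (nsq K S))"
  have "p * cosh (sqrt (nsq K (\<lambda>k. S k + complex_of_real (xi p True) * x k)))
     + (1 - p) * cosh (sqrt (nsq K (\<lambda>k. S k + complex_of_real (xi p False) * x k)))
     \<le> p * (?C * (1 + (xi p True)\<^sup>2 * nsq K x) + xi p True * m)
      + (1 - p) * (?C * (1 + (xi p False)\<^sup>2 * nsq K x) + xi p False * m)"
    by (intro add_mono mult_left_mono m 1) (use p in auto)
  also have "\<dots> = ?C * (1 + (1 - p) / p * nsq K x)"
    using p by (simp add: xi_def field_simps power2_eq_square)
  also have "\<dots> \<le> ?C * exp (nsq K x / p)"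
  proof (rule mult_left_mono)
    have "1 + (1 - p) / p * nsq K x \<le> 1 + nsq K x / p"
      using p by (simp add: field_simps)
    also have "\<dots> \<le> exp (nsq K x / p)" by (rule exp_ge_add_one_self)
    finally show "1 + (1 - p) / p * nsq K x \<le> exp (nsq K x / p)" .
  qed simp
  finally show ?thesis by (simp add: mult.commute)
qed

text \<open>By independence the coordinates are integrated one at a time, and each multiplies the
  mean of cosh of the norm by at most the factor of \<open>bernoulli_cosh_step\<close>.\<close>

lemma bernoulli_cosh_sum:
  assumes K: "finite K" and p: "0 < p" "p \<le> 1" and A: "finite A"
    and x: "\<And>i. i \<in> A \<Longrightarrow> sqrt (nsq K (x i)) \<le> p"
  shows "(\<integral>\<^sup>+\<omega>. ennreal (cosh (sqrt (nsq K (\<lambda>k. \<Sum>i\<in>A. complex_of_real (xi p (\<omega> i)) * x i k))))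
      \<partial>Pi_pmf A False (\<lambda>_. bernoulli_pmf p)) \<le> ennreal (exp ((\<Sum>i\<in>A. nsq K (x i)) / p))"
  using A x
proof (induction A rule: finite_induct)
  case empty
  then show ?case by (simp add: nsq_def)
next
  case (insert j A)
  let ?M = "Pi_pmf A False (\<lambda>_. bernoulli_pmf p)"
  let ?S = "\<lambda>\<omega> k. \<Sum>i\<in>A. complex_of_real (xi p (\<omega> i)) * x i k"
  let ?F = "\<lambda>b \<omega>. cosh (sqrt (nsq K (\<lambda>k. ?S \<omega> k + complex_of_real (xi p b) * x j k)))"
  have upd: "(\<Sum>i\<in>insert j A. complex_of_real (xi p ((fun_upd \<omega> j b) i)) * x i k)
      = ?S \<omega> k + complex_of_real (xi p b) * x j k" for \<omega> b k
  proof -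
    have "(\<Sum>i\<in>A. complex_of_real (xi p ((fun_upd \<omega> j b) i)) * x i k) = ?S \<omega> k"
      using insert.hyps by (intro sum.cong) auto
    then show ?thesis using insert.hyps by simp
  qed
  have "(\<integral>\<^sup>+\<omega>. ennreal (cosh (sqrt (nsq K (\<lambda>k. \<Sum>i\<in>insert j A. complex_of_real (xi p (\<omega> i)) * x i k))))
      \<partial>Pi_pmf (insert j A) False (\<lambda>_. bernoulli_pmf p))
     = (\<integral>\<^sup>+b. \<integral>\<^sup>+\<omega>. ennreal (?F b \<omega>) \<partial>?M \<partial>bernoulli_pmf p)"
    by (simp only: Pi_pmf_insert[OF insert.hyps] nn_integral_map_pmf case_prod_unfold
        nn_integral_pair_pmf' upd fst_conv snd_conv)
  also have "\<dots> = (\<integral>\<^sup>+\<omega>. ennreal (?F True \<omega>) \<partial>?M) * p + (\<integral>\<^sup>+\<omega>. ennreal (?F False \<omega>) \<partial>?M) * (1 - p)"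
    using p by (intro nn_integral_bernoulli_pmf) auto
  also have "\<dots> = (\<integral>\<^sup>+\<omega>. ennreal (?F True \<omega>) * p + ennreal (?F False \<omega>) * (1 - p) \<partial>?M)"
    by (simp add: nn_integral_add nn_integral_multc)
  also have "\<dots> = (\<integral>\<^sup>+\<omega>. ennreal (p * ?F True \<omega> + (1 - p) * ?F False \<omega>) \<partial>?M)"
  proof (rule nn_integral_cong)
    fix \<omega>
    have e: "ennreal a * ennreal p + ennreal b * ennreal (1 - p) = ennreal (p * a + (1 - p) * b)"
      if "0 \<le> a" "0 \<le> b" for a b :: real
      using p that
      by (simp only: ennreal_mult[symmetric] ennreal_plus[symmetric] mult_nonneg_nonneg
          mult.commute[of _ p] mult.commute[of _ "1 - p"] diff_ge_0_iff_ge less_imp_le)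
    show "ennreal (?F True \<omega>) * p + ennreal (?F False \<omega>) * (1 - p)
        = ennreal (p * ?F True \<omega> + (1 - p) * ?F False \<omega>)"
      by (rule e) simp_all
  qed
  also have "\<dots> \<le> (\<integral>\<^sup>+\<omega>. ennreal (exp (nsq K (x j) / p)) * ennreal (cosh (sqrt (nsq K (?S \<omega>)))) \<partial>?M)"
    using bernoulli_cosh_step[OF K p insert.prems[of j]]
    by (intro nn_integral_mono) (auto simp flip: ennreal_mult)
  also have "\<dots> = ennreal (exp (nsq K (x j) / p)) * (\<integral>\<^sup>+\<omega>. ennreal (cosh (sqrt (nsq K (?S \<omega>)))) \<partial>?M)"
    by (simp add: nn_integral_cmult)
  also have "\<dots> \<le> ennreal (exp (nsq K (x j) / p)) * ennreal (exp ((\<Sum>i\<in>A. nsq K (x i)) / p))"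
    by (intro mult_left_mono insert.IH insert.prems) auto
  also have "\<dots> = ennreal (exp ((\<Sum>i\<in>insert j A. nsq K (x i)) / p))"
    using insert.hyps by (simp add: add_divide_distrib exp_add flip: ennreal_mult)
  finally show ?case .
qed

text \<open>Markov's inequality for cosh of the norm scaled by \<open>l\<close>, together with exp y
  \<le> 2 cosh y. The bound does not depend on the dimension of \<open>K\<close>; \<open>l\<close>
  stays free because the three applications work at different scales.\<close>

lemma bernoulli_vector_bernstein:
  assumes K: "finite K" and p: "0 < p" "p \<le> 1" and A: "finite A" and l: "0 \<le> l"
    and x: "\<And>i. i \<in> A \<Longrightarrow> l * sqrt (nsq K (x i)) \<le> p"
  shows "measure_pmf.prob (Pi_pmf A False (\<lambda>_. bernoulli_pmf p))
      {\<omega>. t \<le> sqrt (nsq K (\<lambda>k. \<Sum>i\<in>A. complex_of_real (xi p (\<omega> i)) * x i k))}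
    \<le> 2 * exp (- l * t + l\<^sup>2 * (\<Sum>i\<in>A. nsq K (x i)) / p)"
    (is "measure_pmf.prob ?M ?A \<le> _")
proof -
  define y where "y i k = complex_of_real l * x i k" for i k
  have ny: "nsq K (y i) = l\<^sup>2 * nsq K (x i)" for i
    using nsq_scale[of K "complex_of_real l" "x i"] l by (simp add: y_def[abs_def])
  let ?N = "\<lambda>\<omega>. sqrt (nsq K (\<lambda>k. \<Sum>i\<in>A. complex_of_real (xi p (\<omega> i)) * x i k))"
  let ?Ny = "\<lambda>\<omega>. sqrt (nsq K (\<lambda>k. \<Sum>i\<in>A. complex_of_real (xi p (\<omega> i)) * y i k))"
  have N: "?Ny \<omega> = l * ?N \<omega>" for \<omega>
  proof -
    have "(\<lambda>k. \<Sum>i\<in>A. complex_of_real (xi p (\<omega> i)) * y i k)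
        = (\<lambda>k. complex_of_real l * (\<Sum>i\<in>A. complex_of_real (xi p (\<omega> i)) * x i k))"
      by (simp add: y_def sum_distrib_left algebra_simps)
    then show ?thesis using l by (simp add: nsq_scale real_sqrt_mult)
  qed
  have I: "(\<integral>\<^sup>+\<omega>. ennreal (cosh (?Ny \<omega>)) \<partial>?M) \<le> ennreal (exp ((\<Sum>i\<in>A. nsq K (y i)) / p))"
    by (rule bernoulli_cosh_sum[OF K p A]) (use x l in \<open>simp add: ny real_sqrt_mult\<close>)
  have sub: "{\<omega>. t \<le> ?N \<omega>} \<subseteq> {\<omega>\<in>UNIV. 1 \<le> ennreal (2 * exp (- l * t)) * ennreal (cosh (?Ny \<omega>))}"
  proof safe
    fix \<omega> assume "t \<le> ?N \<omega>"
    then have "l * t \<le> ?Ny \<omega>" unfolding N using l by (rule mult_left_mono)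
    then have "exp (l * t) \<le> 2 * cosh (?Ny \<omega>)"
      by (simp add: cosh_field_def add_increasing2)
    then have "exp (- (l * t)) * exp (l * t) \<le> exp (- (l * t)) * (2 * cosh (?Ny \<omega>))"
      by (rule mult_left_mono) simp
    then have "1 \<le> 2 * exp (- l * t) * cosh (?Ny \<omega>)"
      by (simp add: mult_exp_exp algebra_simps)
    then show "1 \<le> ennreal (2 * exp (- l * t)) * ennreal (cosh (?Ny \<omega>))"
      by (simp flip: ennreal_mult)
  qed simp
  have "emeasure ?M {\<omega>. t \<le> ?N \<omega>}
      \<le> emeasure ?M {\<omega>\<in>UNIV. 1 \<le> ennreal (2 * exp (- l * t)) * ennreal (cosh (?Ny \<omega>))}"
    by (rule emeasure_mono[OF sub]) simp
  also have "\<dots> \<le> ennreal (2 * exp (- l * t)) * (\<integral>\<^sup>+\<omega>. ennreal (cosh (?Ny \<omega>)) * indicator UNIV \<omega> \<partial>?M)"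
    by (rule nn_integral_Markov_inequality) simp_all
  also have "\<dots> \<le> ennreal (2 * exp (- l * t)) * ennreal (exp ((\<Sum>i\<in>A. nsq K (y i)) / p))"
    using I by (intro mult_left_mono) auto
  also have "\<dots> = ennreal (2 * exp (- l * t + l\<^sup>2 * (\<Sum>i\<in>A. nsq K (x i)) / p))"
    by (simp add: ny mult_exp_exp sum_distrib_left[symmetric] flip: ennreal_mult)
  finally show ?thesis
    by (simp add: measure_pmf.emeasure_eq_measure)
qed

section \<open>Random quadratic forms\<close>

lemma nsq_tensor:
  "nsq (K \<times> K') (\<lambda>(k, k'). x k * y k') = nsq K x * nsq K' y"
  by (simp add: nsq_def sum_product sum.cartesian_product norm_mult power_mult_distrib case_prod_unfold)

lemma nsq_cnj [simp]: "nsq K (\<lambda>k. cnj (x k)) = nsq K x"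
  by (simp add: nsq_def)

text \<open>Each |<\<phi>, \<theta>>|^2 is linear in the tensor square of \<theta>. Cauchy-Schwarz
  on \<open>K \<times> K\<close> separates the weighted sum of the tensor squares of the \<phi>'s
  from that of \<theta>, whose norm is |\<theta>|^2.\<close>

lemma quadratic_form_le_HS:
  fixes w :: "'i \<Rightarrow> real"
  assumes "finite K"
  shows "\<bar>\<Sum>i\<in>A. w i * (cmod (\<Sum>k\<in>K. \<phi> i k * \<theta> k))\<^sup>2\<bar>
    \<le> sqrt (nsq (K \<times> K) (\<lambda>z. \<Sum>i\<in>A. complex_of_real (w i) * (\<lambda>(k, k'). \<phi> i k * cnj (\<phi> i k')) z)) * nsq K \<theta>"
proof -
  let ?Z = "\<lambda>z. \<Sum>i\<in>A. complex_of_real (w i) * (\<lambda>(k, k'). \<phi> i k * cnj (\<phi> i k')) z"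
  let ?T = "\<lambda>(k, k'). cnj (\<theta> k) * \<theta> k'"
  have sq: "(cmod (\<Sum>k\<in>K. \<phi> i k * \<theta> k))\<^sup>2
     = (\<Sum>z\<in>K\<times>K. Re (cnj (?T z) * (\<lambda>(k, k'). \<phi> i k * cnj (\<phi> i k')) z))" for i
  proof -
    have "complex_of_real ((cmod (\<Sum>k\<in>K. \<phi> i k * \<theta> k))\<^sup>2)
       = (\<Sum>k\<in>K. \<phi> i k * \<theta> k) * (\<Sum>k\<in>K. cnj (\<phi> i k) * cnj (\<theta> k))"
      by (simp only: complex_norm_square cnj_sum complex_cnj_mult)
    also have "\<dots> = (\<Sum>z\<in>K\<times>K. cnj (?T z) * (\<lambda>(k, k'). \<phi> i k * cnj (\<phi> i k')) z)"
      by (simp add: sum_product sum.cartesian_product case_prod_unfold ac_simps)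
    finally have "Re (complex_of_real ((cmod (\<Sum>k\<in>K. \<phi> i k * \<theta> k))\<^sup>2))
       = Re (\<Sum>z\<in>K\<times>K. cnj (?T z) * (\<lambda>(k, k'). \<phi> i k * cnj (\<phi> i k')) z)" by (rule arg_cong)
    then show ?thesis by (simp only: Re_complex_of_real Re_sum)
  qed
  have "(\<Sum>i\<in>A. w i * (cmod (\<Sum>k\<in>K. \<phi> i k * \<theta> k))\<^sup>2)
      = (\<Sum>i\<in>A. \<Sum>z\<in>K\<times>K. Re (cnj (?T z) * (complex_of_real (w i) * (\<lambda>(k, k'). \<phi> i k * cnj (\<phi> i k')) z)))"
    unfolding sq sum_distrib_left by (intro sum.cong refl) (simp add: algebra_simps)
  also have "\<dots> = cip (K \<times> K) ?T ?Z"
    unfolding cip_def by (subst sum.swap) (simp only: sum_distrib_left Re_sum)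
  finally have e: "(\<Sum>i\<in>A. w i * (cmod (\<Sum>k\<in>K. \<phi> i k * \<theta> k))\<^sup>2) = cip (K \<times> K) ?T ?Z" .
  have "nsq (K \<times> K) ?T = (nsq K \<theta>)\<^sup>2"
    by (simp add: nsq_tensor[of K K "\<lambda>k. cnj (\<theta> k)" \<theta>] power2_eq_square)
  then show ?thesis
    unfolding e using cip_le[of "K \<times> K" ?T ?Z] by (simp add: mult.commute)
qed

text \<open>The Hilbert-Schmidt norm dominates the form at all \<theta> simultaneously, so the
  quantifier over \<theta> inside the event costs nothing. The vectors fed to Bernstein are the
  tensor squares, of norm at most \<beta>.\<close>

lemma bernoulli_quadratic_form:
  fixes l \<beta> t p :: real
  assumes K: "finite K" and p: "0 < p" "p \<le> 1" and A: "finite A" and l: "0 \<le> l"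
    and \<phi>: "\<And>i. i \<in> A \<Longrightarrow> nsq K (\<phi> i) \<le> \<beta>" and lb: "l * \<beta> \<le> p"
  shows "measure_pmf.prob (Pi_pmf A False (\<lambda>_. bernoulli_pmf p))
      {\<omega>. \<exists>\<theta>. t * nsq K \<theta> < \<bar>\<Sum>i\<in>A. xi p (\<omega> i) * (cmod (\<Sum>k\<in>K. \<phi> i k * \<theta> k))\<^sup>2\<bar>}
    \<le> 2 * exp (- l * t + l\<^sup>2 * (card A * \<beta>\<^sup>2) / p)"
    (is "measure_pmf.prob ?M ?A \<le> _")
proof -
  let ?x = "\<lambda>i. (\<lambda>(k, k'). \<phi> i k * cnj (\<phi> i k'))"
  let ?N = "\<lambda>\<omega>. sqrt (nsq (K \<times> K) (\<lambda>z. \<Sum>i\<in>A. complex_of_real (xi p (\<omega> i)) * ?x i z))"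
  have nx: "nsq (K \<times> K) (?x i) = (nsq K (\<phi> i))\<^sup>2" for i
    using nsq_tensor[of K K "\<phi> i" "\<lambda>k. cnj (\<phi> i k)"] by (simp add: power2_eq_square)
  have sub: "?A \<subseteq> {\<omega>. t \<le> ?N \<omega>}"
  proof safe
    fix \<omega> \<theta> assume *: "t * nsq K \<theta> < \<bar>\<Sum>i\<in>A. xi p (\<omega> i) * (cmod (\<Sum>k\<in>K. \<phi> i k * \<theta> k))\<^sup>2\<bar>"
    have "t * nsq K \<theta> < ?N \<omega> * nsq K \<theta>"
      by (rule less_le_trans[OF * quadratic_form_le_HS[OF K]])
    then show "t \<le> ?N \<omega>"
      by (meson leD le_less_linear less_imp_le mult_right_mono nsq_nonneg)
  qed
  have "measure_pmf.prob ?M ?A \<le> measure_pmf.prob ?M {\<omega>. t \<le> ?N \<omega>}"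
    by (rule measure_pmf.finite_measure_mono[OF sub]) simp
  also have "\<dots> \<le> 2 * exp (- l * t + l\<^sup>2 * (\<Sum>i\<in>A. nsq (K \<times> K) (?x i)) / p)"
  proof (rule bernoulli_vector_bernstein)
    fix i assume i: "i \<in> A"
    have "l * nsq K (\<phi> i) \<le> l * \<beta>" using \<phi>[OF i] l by (rule mult_left_mono)
    then show "l * sqrt (nsq (K \<times> K) (?x i)) \<le> p" using lb by (simp add: nx)
  qed (use K p A l in simp_all)
  also have "\<dots> \<le> 2 * exp (- l * t + l\<^sup>2 * (card A * \<beta>\<^sup>2) / p)"
  proof -
    have "(\<Sum>i\<in>A. nsq (K \<times> K) (?x i)) \<le> (\<Sum>i\<in>A. \<beta>\<^sup>2)"
      unfolding nx by (intro sum_mono power_mono \<phi>) auto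
    then have "l\<^sup>2 * (\<Sum>i\<in>A. nsq (K \<times> K) (?x i)) / p \<le> l\<^sup>2 * (card A * \<beta>\<^sup>2) / p"
      using p by (intro divide_right_mono mult_left_mono) auto
    then show ?thesis by simp
  qed
  finally show ?thesis .
qed

section \<open>Fourier analysis of Hankel forms\<close>

definition rou :: "nat \<Rightarrow> nat \<Rightarrow> complex" where
  "rou n j = cis (2 * pi * real j / real n)"

lemma cmod_rou [simp]: "cmod (rou n j) = 1"
  by (simp add: rou_def)

lemma rou_add: "rou n (i + j) = rou n i * rou n j"
  by (simp add: rou_def cis_mult add_divide_distrib distrib_left)

lemma rou_mult: "rou n (k * i) = rou n i ^ k"
  unfolding rou_def Complex.DeMoivre by (simp add: ac_simps)

text \<open>A geometric series in the ratio of two roots of unity; the ratio differs from 1 because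
  the n-th roots are distinct.\<close>

lemma rou_orthogonal:
  assumes "i < n" "j < n"
  shows "(\<Sum>k<n. rou n (k * i) * cnj (rou n (k * j))) = (if i = j then of_nat n else 0)"
proof (cases "i = j")
  case True
  have "rou n (k * i) * cnj (rou n (k * i)) = 1" for k
    using complex_norm_square[of "rou n (k * i)"] by simp
  with True show ?thesis by simp
next
  case False
  let ?w = "rou n i * cnj (rou n j)"
  have n: "0 < n" using assms by simp
  have pn: "rou n i ^ n = 1" for i
    using n cis_multiple_2pi[of "real i"] by (simp add: rou_def Complex.DeMoivre)
  have c1: "rou n j * cnj (rou n j) = 1" using complex_norm_square[of "rou n j"] by simp
  have ne: "?w \<noteq> 1"
  proof
    assume "?w = 1"
    then have "rou n i * (rou n j * cnj (rou n j)) = rou n j" by (simp add: ac_simps)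
    then have "rou n i = rou n j" by (simp only: c1 mult_1_right)
    moreover have "inj_on (\<lambda>k. cis (2 * pi * real k / real n)) {..<n}"
      using Complex.bij_betw_roots_unity[OF n] by (auto simp: bij_betw_def)
    ultimately show False using False assms by (auto simp: rou_def inj_on_def)
  qed
  have "(\<Sum>k<n. rou n (k * i) * cnj (rou n (k * j))) = (\<Sum>k<n. ?w ^ k)"
    by (simp add: rou_mult power_mult_distrib)
  also have "\<dots> = (?w ^ n - 1) / (?w - 1)" by (rule geometric_sum[OF ne])
  also have "?w ^ n = 1" by (simp add: power_mult_distrib pn flip: complex_cnj_power)
  finally show ?thesis using False by simp
qed

text \<open>A vector of length m counts as padded with zeros to the length n of the transform, which
  is how vectors indexed by rows or by columns are embedded.\<close>

lemma dft_parseval: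
  assumes "m \<le> n"
  shows "(\<Sum>k<n. (cmod (\<Sum>a<m. c a * rou n (k * a)))\<^sup>2) = real n * nsq {..<m} c"
proof -
  have "complex_of_real (\<Sum>k<n. (cmod (\<Sum>a<m. c a * rou n (k * a)))\<^sup>2)
     = (\<Sum>k<n. (\<Sum>a<m. c a * rou n (k * a)) * (\<Sum>b<m. cnj (c b) * cnj (rou n (k * b))))"
    by (simp only: of_real_sum complex_norm_square cnj_sum complex_cnj_mult)
  also have "\<dots> = (\<Sum>k<n. \<Sum>a<m. \<Sum>b<m. c a * cnj (c b) * (rou n (k * a) * cnj (rou n (k * b))))"
    by (simp add: sum_product ac_simps)
  also have "\<dots> = (\<Sum>a<m. \<Sum>b<m. \<Sum>k<n. c a * cnj (c b) * (rou n (k * a) * cnj (rou n (k * b))))"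
    by (rule trans[OF sum.swap]) (intro sum.cong refl sum.swap)
  also have "\<dots> = (\<Sum>a<m. \<Sum>b<m. c a * cnj (c b) * (if a = b then of_nat n else 0))"
    using assms by (intro sum.cong refl) (simp add: rou_orthogonal flip: sum_distrib_left)
  also have "\<dots> = (\<Sum>a<m. of_nat n * (c a * cnj (c a)))"
    by (intro sum.cong refl) (simp add: if_distrib cong: if_cong)
  also have "\<dots> = complex_of_real (real n * nsq {..<m} c)"
    by (simp only: nsq_def of_real_mult of_real_sum complex_norm_square sum_distrib_left of_real_of_nat_eq)
  finally show ?thesis by (simp only: of_real_eq_iff)
qed

lemma dft_inversion:
  assumes "i < n"
  shows "of_nat n * y i = (\<Sum>k<n. (\<Sum>j<n. y j * rou n (k * j)) * cnj (rou n (k * i)))"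
proof -
  have "(\<Sum>k<n. (\<Sum>j<n. y j * rou n (k * j)) * cnj (rou n (k * i)))
      = (\<Sum>k<n. \<Sum>j<n. y j * (rou n (k * j) * cnj (rou n (k * i))))"
    by (simp add: sum_distrib_right mult.assoc)
  also have "\<dots> = (\<Sum>j<n. \<Sum>k<n. y j * (rou n (k * j) * cnj (rou n (k * i))))"
    by (rule sum.swap)
  also have "(\<Sum>j<n. \<Sum>k<n. y j * (rou n (k * j) * cnj (rou n (k * i))))
     = (\<Sum>j<n. y j * (if j = i then of_nat n else 0))"
    using assms by (intro sum.cong refl) (simp add: rou_orthogonal flip: sum_distrib_left)
  also have "\<dots> = of_nat n * y i"
    using assms by (simp add: if_distrib cong: if_cong)
  finally show ?thesis by simp
qed

text \<open>A Hankel matrix embeds into a circulant one, whose norm is the largest Fourier coefficient.\<close>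

lemma hankel_form_le_dft:
  assumes n: "n1 + n2 \<le> Suc n" "0 < n" "n1 \<le> n" "n2 \<le> n"
    and B: "\<And>k. k < n \<Longrightarrow> cmod (\<Sum>j<n. y j * rou n (k * j)) \<le> B"
  shows "cmod (\<Sum>a<n1. \<Sum>b<n2. cnj (u a) * y (a + b) * v b)
    \<le> B * (sqrt (nsq {..<n1} u) * sqrt (nsq {..<n2} v))"
proof -
  define Y where "Y k = (\<Sum>j<n. y j * rou n (k * j))" for k
  define P where "P k = (\<Sum>a<n1. u a * rou n (k * a))" for k
  define R where "R k = (\<Sum>b<n2. cnj (v b) * rou n (k * b))" for k
  have "of_nat n * (\<Sum>a<n1. \<Sum>b<n2. cnj (u a) * y (a + b) * v b)
     = (\<Sum>a<n1. \<Sum>b<n2. cnj (u a) * (of_nat n * y (a + b)) * v b)"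
    by (simp add: sum_distrib_left ac_simps)
  \<comment> \<open>Fourier inversion of y at a + b. The character at a + b factors, so the double
    sum decouples into the transforms of u and v at each frequency.\<close>
  also have "\<dots> = (\<Sum>a<n1. \<Sum>b<n2. \<Sum>k<n. Y k * (cnj (u a * rou n (k * a)) * cnj (cnj (v b) * rou n (k * b))))"
  proof (intro sum.cong refl)
    fix a b assume "a \<in> {..<n1}" "b \<in> {..<n2}"
    then have "a + b < n" using n by auto
    then show "cnj (u a) * (of_nat n * y (a + b)) * v b
       = (\<Sum>k<n. Y k * (cnj (u a * rou n (k * a)) * cnj (cnj (v b) * rou n (k * b))))"
      by (simp add: dft_inversion Y_def[symmetric] distrib_left rou_add sum_distrib_left sum_distrib_right ac_simps)
  qed
  also have "\<dots> = (\<Sum>a<n1. \<Sum>k<n. \<Sum>b<n2. Y k * (cnj (u a * rou n (k * a)) * cnj (cnj (v b) * rou n (k * b))))"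
    by (intro sum.cong refl sum.swap)
  also have "\<dots> = (\<Sum>k<n. \<Sum>a<n1. \<Sum>b<n2. Y k * (cnj (u a * rou n (k * a)) * cnj (cnj (v b) * rou n (k * b))))"
    by (rule sum.swap)
  also have "\<dots> = (\<Sum>k<n. Y k * (cnj (P k) * cnj (R k)))"
    unfolding P_def R_def cnj_sum sum_product by (simp only: sum_distrib_left)
  finally have e: "of_nat n * (\<Sum>a<n1. \<Sum>b<n2. cnj (u a) * y (a + b) * v b)
     = (\<Sum>k<n. Y k * (cnj (P k) * cnj (R k)))" .
  have B0: "0 \<le> B" using B[of 0] n by (auto intro: order_trans[OF norm_ge_zero])
  have "real n * cmod (\<Sum>a<n1. \<Sum>b<n2. cnj (u a) * y (a + b) * v b)
     = cmod (\<Sum>k<n. Y k * (cnj (P k) * cnj (R k)))"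
    by (simp only: e[symmetric] norm_mult norm_of_nat)
  also have "\<dots> \<le> (\<Sum>k<n. B * (\<bar>cmod (P k)\<bar> * \<bar>cmod (R k)\<bar>))"
    by (rule sum_norm_le) (use B in \<open>auto simp: norm_mult Y_def intro!: mult_right_mono\<close>)
  also have "\<dots> = B * (\<Sum>k<n. \<bar>cmod (P k)\<bar> * \<bar>cmod (R k)\<bar>)" by (simp add: sum_distrib_left)
  also have "\<dots> \<le> B * (L2_set (\<lambda>k. cmod (P k)) {..<n} * L2_set (\<lambda>k. cmod (R k)) {..<n})"
    by (intro mult_left_mono L2_set_mult_ineq B0)
  also have "\<dots> = B * (sqrt (real n * nsq {..<n1} u) * sqrt (real n * nsq {..<n2} v))"
    using dft_parseval[OF n(3), of u] dft_parseval[OF n(4), of "\<lambda>b. cnj (v b)"]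
    by (simp add: L2_set_def P_def R_def)
  also have "\<dots> = real n * (B * (sqrt (nsq {..<n1} u) * sqrt (nsq {..<n2} v)))"
    by (simp add: real_sqrt_mult)
  finally show ?thesis using n by simp
qed

text \<open>A scalar Bernstein bound at each of the n frequencies and a union bound, which is the
  factor n in front. Characters have modulus 1, so the bound \<beta> on the entries survives the
  transform.\<close>

lemma bernoulli_hankel_norm:
  fixes l \<beta> t p :: real
  assumes p: "0 < p" "p \<le> 1" and n: "n1 + n2 \<le> Suc n" "0 < n" "n1 \<le> n" "n2 \<le> n" and l: "0 \<le> l"
    and z: "\<And>i. i < n \<Longrightarrow> cmod (z i) \<le> \<beta>" and lb: "l * \<beta> \<le> p"
  shows "measure_pmf.prob (bern_model n p)
      {\<omega>. \<exists>u v. t * (sqrt (nsq {..<n1} u) * sqrt (nsq {..<n2} v))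
         < cmod (\<Sum>a<n1. \<Sum>b<n2. cnj (u a) * (complex_of_real (xi p (\<omega> (a + b))) * z (a + b)) * v b)}
    \<le> real n * (2 * exp (- l * t + l\<^sup>2 * (n * \<beta>\<^sup>2) / p))"
    (is "measure_pmf.prob ?M ?A \<le> _")
proof -
  let ?K = "{()}"
  define x where "x k i = (\<lambda>_::unit. z i * rou n (k * i))" for k i
  let ?E = "\<lambda>k. {\<omega>. t \<le> sqrt (nsq ?K (\<lambda>u. \<Sum>i<n. complex_of_real (xi p (\<omega> i)) * x k i u))}"
  have nx: "sqrt (nsq ?K (x k i)) = cmod (z i)" for k i
    by (simp add: nsq_def x_def norm_mult)
  have sub: "?A \<subseteq> (\<Union>k<n. ?E k)"
  proof (rule subsetI, rule ccontr)
    fix \<omega> assume "\<omega> \<in> ?A"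
    then obtain u v where lt: "t * (sqrt (nsq {..<n1} u) * sqrt (nsq {..<n2} v))
         < cmod (\<Sum>a<n1. \<Sum>b<n2. cnj (u a) * (complex_of_real (xi p (\<omega> (a + b))) * z (a + b)) * v b)"
      by blast
    assume "\<omega> \<notin> (\<Union>k<n. ?E k)"
    then have "cmod (\<Sum>j<n. complex_of_real (xi p (\<omega> j)) * z j * rou n (k * j)) \<le> t" if "k < n" for k
      using that by (auto simp: nsq_def x_def mult.assoc not_le intro: less_imp_le)
    from hankel_form_le_dft[OF n, of "\<lambda>i. complex_of_real (xi p (\<omega> i)) * z i" t u v, OF this] lt
    show False by simp
  qed
  have "measure_pmf.prob ?M ?A \<le> measure_pmf.prob ?M (\<Union>k<n. ?E k)"
    by (rule measure_pmf.finite_measure_mono[OF sub]) simp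
  also have "\<dots> \<le> (\<Sum>k<n. measure_pmf.prob ?M (?E k))"
    by (rule measure_pmf.finite_measure_subadditive_finite) auto
  also have "\<dots> \<le> (\<Sum>k<n. 2 * exp (- l * t + l\<^sup>2 * (n * \<beta>\<^sup>2) / p))"
  proof (rule sum_mono)
    fix k
    have "measure_pmf.prob ?M (?E k) \<le> 2 * exp (- l * t + l\<^sup>2 * (\<Sum>i<n. nsq ?K (x k i)) / p)"
      unfolding bern_model_def
    proof (rule bernoulli_vector_bernstein)
      fix i assume i: "i \<in> {..<n}"
      have "l * cmod (z i) \<le> l * \<beta>" using z i l by (intro mult_left_mono) auto
      then show "l * sqrt (nsq ?K (x k i)) \<le> p" using lb by (simp add: nx)
    qed (use p l in simp_all)
    also have "\<dots> \<le> 2 * exp (- l * t + l\<^sup>2 * (n * \<beta>\<^sup>2) / p)"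
    proof -
      have "(\<Sum>i<n. nsq ?K (x k i)) \<le> (\<Sum>i<n. \<beta>\<^sup>2)"
        using z by (intro sum_mono) (auto simp: nsq_def x_def norm_mult intro!: power_mono)
      then have "l\<^sup>2 * (\<Sum>i<n. nsq ?K (x k i)) / p \<le> l\<^sup>2 * (n * \<beta>\<^sup>2) / p"
        using p by (intro divide_right_mono mult_left_mono) auto
      then show ?thesis by simp
    qed
    finally show "measure_pmf.prob ?M (?E k) \<le> 2 * exp (- l * t + l\<^sup>2 * (n * \<beta>\<^sup>2) / p)" .
  qed
  also have "\<dots> = real n * (2 * exp (- l * t + l\<^sup>2 * (n * \<beta>\<^sup>2) / p))" by simp
  finally show ?thesis .
qed

text \<open>A count above 2 p l forces the centred sum over the interval above l, also when the
  interval is cut off at n. There are at most n^2 intervals.\<close>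

lemma bernoulli_interval_counts:
  fixes p l0 :: real
  assumes p: "0 < p" "p \<le> 1" and l0: "0 < l0"
  shows "measure_pmf.prob (bern_model n p)
      {\<omega>. \<exists>j<n. \<exists>l\<le>n. l0 \<le> real l \<and> 2 * p * real l < real (card ({i. i < n \<and> \<omega> i} \<inter> {j..<j+l}))}
    \<le> real n * real n * (2 * exp (- (p * l0) / 4))"
    (is "measure_pmf.prob ?M ?A \<le> _")
proof -
  let ?K = "{()}"
  define x where "x J i = (\<lambda>_::unit. if i \<in> J then 1 else 0 :: complex)" for J :: "nat set" and i
  let ?I = "{(j, l). j < n \<and> l \<in> {1..n} \<and> l0 \<le> real l}"
  let ?E = "\<lambda>(j, l). {\<omega>. real l \<le> sqrt (nsq ?K (\<lambda>u. \<Sum>i<n. complex_of_real (xi p (\<omega> i)) * x {j..<j+l} i u))}"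
  have fin: "finite ?I" by (rule finite_subset[of _ "{..<n} \<times> {1..n}"]) auto
  have cI: "card ?I \<le> n * n"
  proof -
    have "card ?I \<le> card ({..<n} \<times> {1..n})" by (rule card_mono) auto
    then show ?thesis by simp
  qed
  have ev: "real l \<le> sqrt (nsq ?K (\<lambda>u. \<Sum>i<n. complex_of_real (xi p (\<omega> i)) * x {j..<j+l} i u))"
    if "2 * p * real l < real (card ({i. i < n \<and> \<omega> i} \<inter> {j..<j+l}))" for \<omega> j l
  proof -
    let ?J = "{..<n} \<inter> {j..<j+l}"
    have "(\<Sum>i<n. complex_of_real (xi p (\<omega> i)) * x {j..<j+l} i u) = complex_of_real (\<Sum>i\<in>?J. xi p (\<omega> i))" for u
      by (simp add: x_def if_distrib sum.inter_restrict cong: if_cong)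
    then have e: "sqrt (nsq ?K (\<lambda>u. \<Sum>i<n. complex_of_real (xi p (\<omega> i)) * x {j..<j+l} i u)) = \<bar>\<Sum>i\<in>?J. xi p (\<omega> i)\<bar>"
      by (simp add: nsq_def del: of_real_sum)
    have "(\<Sum>i\<in>?J. xi p (\<omega> i)) = (\<Sum>i\<in>?J. if \<omega> i then 1 / p else 0) - card ?J"
      by (simp add: xi_def sum_subtractf)
    also have "(\<Sum>i\<in>?J. if \<omega> i then 1 / p else 0) = (\<Sum>i\<in>{i\<in>?J. \<omega> i}. 1 / p)"
      by (rule sum.inter_filter[symmetric]) simp
    also have "{i\<in>?J. \<omega> i} = {i. i < n \<and> \<omega> i} \<inter> {j..<j+l}" by auto
    finally have s: "(\<Sum>i\<in>?J. xi p (\<omega> i)) = real (card ({i. i < n \<and> \<omega> i} \<inter> {j..<j+l})) / p - card ?J"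
      by simp
    have "card ?J \<le> l" using card_mono[of "{j..<j+l}" ?J] by simp
    moreover have "2 * real l < real (card ({i. i < n \<and> \<omega> i} \<inter> {j..<j+l})) / p"
      using that p by (simp add: field_simps)
    ultimately show ?thesis unfolding e s by linarith
  qed
  have sub: "?A \<subseteq> (\<Union>jl\<in>?I. ?E jl)"
  proof
    fix \<omega> assume "\<omega> \<in> ?A"
    then obtain j l where jl: "j < n" "l \<le> n" "l0 \<le> real l"
      "2 * p * real l < real (card ({i. i < n \<and> \<omega> i} \<inter> {j..<j+l}))" by blast
    have "0 < l" using l0 jl(3) by simp
    then have "(j, l) \<in> ?I" using jl by simp
    moreover have "\<omega> \<in> ?E (j, l)" using ev[OF jl(4)] by simp
    ultimately show "\<omega> \<in> (\<Union>jl\<in>?I. ?E jl)" by (rule UN_I)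
  qed
  have "measure_pmf.prob ?M ?A \<le> measure_pmf.prob ?M (\<Union>jl\<in>?I. ?E jl)"
    by (rule measure_pmf.finite_measure_mono[OF sub]) simp
  also have "\<dots> \<le> (\<Sum>jl\<in>?I. measure_pmf.prob ?M (?E jl))"
    by (rule measure_pmf.finite_measure_subadditive_finite[OF fin]) auto
  also have "\<dots> \<le> (\<Sum>jl\<in>?I. 2 * exp (- (p * l0) / 4))"
  proof (rule sum_mono)
    fix jl assume "jl \<in> ?I"
    then obtain j l where jl: "jl = (j, l)" "j < n" "l \<in> {1..n}" "l0 \<le> real l" by auto
    have nx: "nsq ?K (x J i) = (if i \<in> J then 1 else 0)" for J i by (simp add: nsq_def x_def)
    \<comment> \<open>With parameter p/2 the exponent is -p l / 2 + p l / 4.\<close>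
    have "measure_pmf.prob ?M (?E (j, l))
        \<le> 2 * exp (- (p / 2) * real l + (p / 2)\<^sup>2 * (\<Sum>i<n. nsq ?K (x {j..<j+l} i)) / p)"
      unfolding bern_model_def prod.case
      by (rule bernoulli_vector_bernstein) (use p in \<open>auto simp: nx\<close>)
    also have "\<dots> \<le> 2 * exp (- (p * l0) / 4)"
    proof -
      have "(\<Sum>i<n. nsq ?K (x {j..<j+l} i)) = real (card ({..<n} \<inter> {j..<j+l}))"
        unfolding nx by (subst sum.inter_restrict[symmetric]) simp_all
      also have "\<dots> \<le> real l" using card_mono[of "{j..<j+l}" "{..<n} \<inter> {j..<j+l}"] by simp
      finally have "(p / 2)\<^sup>2 * (\<Sum>i<n. nsq ?K (x {j..<j+l} i)) / p \<le> (p / 2)\<^sup>2 * real l / p"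
        using p by (intro divide_right_mono mult_left_mono) auto
      also have "\<dots> = p * real l / 4" using p by (simp add: power2_eq_square)
      finally have "- (p / 2) * real l + (p / 2)\<^sup>2 * (\<Sum>i<n. nsq ?K (x {j..<j+l} i)) / p \<le> - (p * real l) / 4"
        by linarith
      also have "\<dots> \<le> - (p * l0) / 4" using jl p by simp
      finally show ?thesis by simp
    qed
    finally show "measure_pmf.prob ?M (?E jl) \<le> 2 * exp (- (p * l0) / 4)" by (simp add: jl)
  qed
  also have "\<dots> = real (card ?I) * (2 * exp (- (p * l0) / 4))" by simp
  also have "\<dots> \<le> real (n * n) * (2 * exp (- (p * l0) / 4))"
    using cI by (intro mult_right_mono of_nat_mono) auto
  finally show ?thesis by simp
qed

subsection \<open>Matrix algebra\<close>

definition ip :: "nat \<Rightarrow> nat \<Rightarrow> cmat \<Rightarrow> cmat \<Rightarrow> real" where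
  "ip m k A B = (\<Sum>i<m. \<Sum>j<k. Re (cnj (A i j) * B i j))"

definition rowsq :: "nat \<Rightarrow> cmat \<Rightarrow> nat \<Rightarrow> real" where
  "rowsq k A i = (\<Sum>j<k. (cmod (A i j))\<^sup>2)"

lemma rowsq_nonneg [simp]: "0 \<le> rowsq k A i"
  by (simp add: rowsq_def sum_nonneg)

lemma fro2_rowsq: "fro2 m k A = (\<Sum>i<m. rowsq k A i)"
  by (simp add: fro2_def rowsq_def)

lemma fro2_nonneg [simp]: "0 \<le> fro2 m k A"
  by (simp add: fro2_rowsq sum_nonneg)

lemma ip_self: "ip m k A A = fro2 m k A"
proof -
  have e: "Re (cnj z * z) = (cmod z)\<^sup>2" for z
    by (simp only: cmod_power2) (simp add: power2_eq_square)
  show ?thesis unfolding ip_def fro2_def by (simp only: e)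
qed

lemma ip_commute: "ip m k A B = ip m k B A"
  by (simp add: ip_def algebra_simps)

lemma ip_madd_left: "ip m k (madd A B) C = ip m k A C + ip m k B C"
  by (simp add: ip_def madd_def sum.distrib algebra_simps)

lemma ip_madd_right: "ip m k C (madd A B) = ip m k C A + ip m k C B"
  by (simp add: ip_def madd_def sum.distrib algebra_simps)

lemma ip_msub_left: "ip m k (msub A B) C = ip m k A C - ip m k B C"
  by (simp add: ip_def msub_def sum.distrib sum_subtractf algebra_simps)

lemma ip_msub_right: "ip m k C (msub A B) = ip m k C A - ip m k C B"
  by (simp add: ip_def msub_def sum.distrib sum_subtractf algebra_simps)

lemma ip_mscale_left: "ip m k (mscale (complex_of_real c) A) B = c * ip m k A B"
  by (simp add: ip_def mscale_def sum_distrib_left algebra_simps)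

lemma ip_mscale_right: "ip m k A (mscale (complex_of_real c) B) = c * ip m k A B"
  by (simp add: ip_def mscale_def sum_distrib_left algebra_simps)

lemmas ip_simps = ip_madd_left ip_madd_right ip_msub_left ip_msub_right ip_mscale_left ip_mscale_right

lemma fro2_madd: "fro2 m k (madd A B) = fro2 m k A + fro2 m k B + 2 * ip m k A B"
  by (simp add: ip_self[symmetric] ip_simps ip_commute[of m k B A])

lemma fro2_msub: "fro2 m k (msub A B) = fro2 m k A + fro2 m k B - 2 * ip m k A B"
  by (simp add: ip_self[symmetric] ip_simps ip_commute[of m k B A])

lemma fro2_madd_le: "fro2 m k (madd A B) \<le> 2 * fro2 m k A + 2 * fro2 m k B"
  using fro2_nonneg[of m k "msub A B"] by (simp add: fro2_madd fro2_msub del: fro2_nonneg)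

lemma fro2_msub_le: "fro2 m k (msub A B) \<le> 2 * fro2 m k A + 2 * fro2 m k B"
  using fro2_nonneg[of m k "madd A B"] by (simp add: fro2_madd fro2_msub del: fro2_nonneg)

lemma fro2_ctr: "fro2 m k (ctr A) = fro2 k m A"
  unfolding fro2_def ctr_def by (subst sum.swap) simp

lemma ip_ctr: "ip m k (ctr A) (ctr B) = ip k m A B"
  unfolding ip_def ctr_def by (subst sum.swap) simp

lemma mmul_assoc: "mmul k A (mmul l B C) = mmul l (mmul k A B) C"
proof (intro ext)
  fix i j
  have "mmul k A (mmul l B C) i j = (\<Sum>a<k. \<Sum>b<l. A i a * B a b * C b j)"
    by (simp add: mmul_def sum_distrib_left mult.assoc)
  also have "\<dots> = (\<Sum>b<l. \<Sum>a<k. A i a * B a b * C b j)" by (rule sum.swap)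
  also have "\<dots> = mmul l (mmul k A B) C i j" by (simp add: mmul_def sum_distrib_right)
  finally show "mmul k A (mmul l B C) i j = mmul l (mmul k A B) C i j" .
qed

lemma ctr_mmul: "ctr (mmul k A B) = mmul k (ctr B) (ctr A)"
  by (simp add: ctr_def mmul_def mult.commute)

lemma ctr_ctr [simp]: "ctr (ctr A) = A"
  by (simp add: ctr_def)

lemma ctr_madd: "ctr (madd A B) = madd (ctr A) (ctr B)"
  by (simp add: ctr_def madd_def)

lemma ctr_msub: "ctr (msub A B) = msub (ctr A) (ctr B)"
  by (simp add: ctr_def msub_def)

lemma mmul_madd_left: "mmul k (madd A B) C = madd (mmul k A C) (mmul k B C)"
  by (simp add: mmul_def madd_def sum.distrib algebra_simps)

lemma mmul_madd_right: "mmul k C (madd A B) = madd (mmul k C A) (mmul k C B)"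
  by (simp add: mmul_def madd_def sum.distrib algebra_simps)

lemma ip_mmul_left: "ip m k (mmul q A B) C = ip q k B (mmul m (ctr A) C)"
proof -
  have "ip m k (mmul q A B) C = (\<Sum>i<m. \<Sum>j<k. \<Sum>l<q. Re (cnj (A i l * B l j) * C i j))"
    by (simp only: ip_def mmul_def cnj_sum sum_distrib_right Re_sum)
  also have "\<dots> = (\<Sum>l<q. \<Sum>j<k. \<Sum>i<m. Re (cnj (A i l * B l j) * C i j))"
    by (subst sum.swap[of _ "{..<q}" "{..<k}"], subst sum.swap[of _ "{..<q}" "{..<m}"], subst sum.swap[of _ "{..<m}" "{..<k}"]) simp
  also have "\<dots> = ip q k B (mmul m (ctr A) C)"
    unfolding ip_def mmul_def ctr_def sum_distrib_left Re_sum
    by (intro sum.cong refl arg_cong[of _ _ Re]) (simp add: ac_simps)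
  finally show ?thesis .
qed

lemma ip_mmul_right: "ip m k (mmul q A B) C = ip m q A (mmul k C (ctr B))"
proof -
  have "ip m k (mmul q A B) C = ip k m (mmul q (ctr B) (ctr A)) (ctr C)"
    by (simp only: ctr_mmul[symmetric] ip_ctr)
  also have "\<dots> = ip q m (ctr A) (mmul k (ctr (ctr B)) (ctr C))" by (rule ip_mmul_left)
  also have "mmul k (ctr (ctr B)) (ctr C) = ctr (mmul k C (ctr B))"
    by (simp only: ctr_mmul)
  finally show ?thesis by (simp only: ip_ctr)
qed

lemma mmul_entry_le: "(cmod (mmul k A (ctr B) i j))\<^sup>2 \<le> rowsq k A i * rowsq k B j"
proof -
  have "cmod (mmul k A (ctr B) i j) \<le> (\<Sum>l<k. \<bar>cmod (A i l)\<bar> * \<bar>cmod (B j l)\<bar>)"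
    unfolding mmul_def ctr_def by (rule sum_norm_le) (simp add: norm_mult)
  also have "\<dots> \<le> L2_set (\<lambda>l. cmod (A i l)) {..<k} * L2_set (\<lambda>l. cmod (B j l)) {..<k}"
    by (rule L2_set_mult_ineq)
  also have "\<dots> = sqrt (rowsq k A i * rowsq k B j)"
    by (simp add: L2_set_def rowsq_def real_sqrt_mult)
  finally have "(cmod (mmul k A (ctr B) i j))\<^sup>2 \<le> (sqrt (rowsq k A i * rowsq k B j))\<^sup>2"
    by (rule power_mono) simp
  then show ?thesis by simp
qed

lemma fro2_mmul_ctr_le: "fro2 m k (mmul q A (ctr B)) \<le> fro2 m q A * fro2 k q B"
proof -
  have "fro2 m k (mmul q A (ctr B)) \<le> (\<Sum>i<m. \<Sum>j<k. rowsq q A i * rowsq q B j)"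
    unfolding fro2_def by (intro sum_mono mmul_entry_le)
  also have "\<dots> = fro2 m q A * fro2 k q B" by (simp add: fro2_rowsq sum_product)
  finally show ?thesis .
qed

lemma fro2_ctr_mmul_le: "fro2 q k (mmul m (ctr A) B) \<le> fro2 m q A * fro2 m k B"
  using fro2_mmul_ctr_le[of q k m "ctr A" "ctr B"] by (simp add: fro2_ctr)

lemma rowsq_msub_le: "rowsq k (msub A B) i \<le> 2 * rowsq k A i + 2 * rowsq k B i"
  using fro2_msub_le[of 1 k "\<lambda>_ j. A i j" "\<lambda>_ j. B i j"] by (simp add: fro2_def rowsq_def msub_def)

subsection \<open>The Hankel operators\<close>

definition adiag :: "nat \<Rightarrow> nat \<Rightarrow> nat \<Rightarrow> (nat \<times> nat) set" where
  "adiag n1 n2 i = {(a, b). a < n1 \<and> b < n2 \<and> a + b = i}"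

lemma finite_adiag [simp]: "finite (adiag n1 n2 i)"
  by (rule finite_subset[of _ "{..<n1} \<times> {..<n2}"]) (auto simp: adiag_def)

lemma vsig_adiag: "vsig n1 n2 i = card (adiag n1 n2 i)"
  by (simp add: vsig_def adiag_def)

lemma Gadj_adiag: "Gadj n1 n2 M i = (\<Sum>(a, b)\<in>adiag n1 n2 i. M a b) / complex_of_real (sqrt (real (vsig n1 n2 i)))"
  by (simp add: Gadj_def adiag_def)

lemma adiag_swap: "adiag n2 n1 i = prod.swap ` adiag n1 n2 i"
  by (auto simp: adiag_def image_def)

lemma vsig_swap: "vsig n2 n1 i = vsig n1 n2 i"
  unfolding vsig_adiag adiag_swap[of n2 n1] by (rule card_image) (auto simp: inj_on_def)

lemma sum_adiag_swap: "(\<Sum>(b, a)\<in>adiag n2 n1 i. f a b) = (\<Sum>(a, b)\<in>adiag n1 n2 i. f a b)"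
  unfolding adiag_swap[of n2 n1] by (subst sum.reindex) (auto simp: inj_on_def case_prod_unfold)

lemma Gadj_ctr: "Gadj n2 n1 (ctr M) i = cnj (Gadj n1 n2 M i)"
proof -
  have "(\<Sum>(b, a)\<in>adiag n2 n1 i. cnj (M a b)) = (\<Sum>(a, b)\<in>adiag n1 n2 i. cnj (M a b))"
    by (rule sum_adiag_swap)
  then show ?thesis by (simp add: Gadj_adiag vsig_swap ctr_def case_prod_unfold)
qed

text \<open>The length of an antidiagonal is the minimum of n1, n2, i + 1 and n1 + n2 - 1 - i; each
  hypothesis is one of these four bounds.\<close>

lemma vsig_ge:
  assumes "c \<le> n1" "c \<le> n2" "c \<le> i + 1" "c + i + 1 \<le> n1 + n2"
  shows "c \<le> vsig n1 n2 i"
proof -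
  \<comment> \<open>Truncated subtraction makes \<open>i + 1 - n2\<close> the smallest row index
    that occurs on the antidiagonal.\<close>
  let ?f = "\<lambda>t. ((i + 1 - n2) + t, i - ((i + 1 - n2) + t))"
  have "card (?f ` {..<c}) = c" by (subst card_image) (auto simp: inj_on_def)
  moreover have "?f ` {..<c} \<subseteq> adiag n1 n2 i" using assms by (auto simp: adiag_def)
  ultimately show ?thesis unfolding vsig_adiag by (metis card_mono finite_adiag)
qed

lemma vsig_pos: "1 \<le> n1 \<Longrightarrow> 1 \<le> n2 \<Longrightarrow> i < n1 + n2 - 1 \<Longrightarrow> 1 \<le> vsig n1 n2 i"
  by (rule vsig_ge) auto

lemma Gadj_madd: "Gadj n1 n2 (madd A B) i = Gadj n1 n2 A i + Gadj n1 n2 B i"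
  by (simp add: Gadj_adiag madd_def case_prod_unfold sum.distrib add_divide_distrib)

lemma Gadj_msub: "Gadj n1 n2 (msub A B) i = Gadj n1 n2 A i - Gadj n1 n2 B i"
  by (simp add: Gadj_adiag msub_def case_prod_unfold sum_subtractf diff_divide_distrib)

lemma Gadj_cong: "mat_eq n1 n2 A B \<Longrightarrow> Gadj n1 n2 A i = Gadj n1 n2 B i"
  unfolding Gadj_adiag mat_eq_def
  by (intro arg_cong2[of _ _ _ _ "(/)"] refl sum.cong) (auto simp: adiag_def)

lemma sum_over_adiag:
  "(\<Sum>i<n1 + n2 - 1. \<Sum>(a, b)\<in>adiag n1 n2 i. f a b) = (\<Sum>a<n1. \<Sum>b<n2. f a b)"
proof -
  have "(\<Sum>i<n1 + n2 - 1. \<Sum>(a, b)\<in>adiag n1 n2 i. f a b)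
      = (\<Sum>z\<in>(\<Union>i<n1+n2-1. adiag n1 n2 i). case z of (a, b) \<Rightarrow> f a b)"
    by (rule sum.UNION_disjoint[symmetric]) (auto, auto simp: adiag_def)
  also have "(\<Union>i<n1+n2-1. adiag n1 n2 i) = {..<n1} \<times> {..<n2}"
    by (auto simp: adiag_def)
  finally show ?thesis by (simp add: sum.cartesian_product)
qed

text \<open>Cauchy-Schwarz along the antidiagonal: its length cancels against the squared weight,
  which is why the adjoint is a contraction.\<close>

lemma Gadj_sq_le: "(cmod (Gadj n1 n2 X i))\<^sup>2 \<le> (\<Sum>(a, b)\<in>adiag n1 n2 i. (cmod (X a b))\<^sup>2)"
proof (cases "vsig n1 n2 i = 0")
  case True
  then show ?thesis by (simp add: Gadj_adiag sum_nonneg case_prod_unfold)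
next
  case False
  have "(cmod (\<Sum>(a, b)\<in>adiag n1 n2 i. X a b))\<^sup>2 \<le> (\<Sum>z\<in>adiag n1 n2 i. cmod (case z of (a, b) \<Rightarrow> X a b))\<^sup>2"
    by (intro power_mono norm_sum) simp
  also have "\<dots> \<le> (\<Sum>z\<in>adiag n1 n2 i. (cmod (case z of (a, b) \<Rightarrow> X a b))\<^sup>2) * (\<Sum>z\<in>adiag n1 n2 i. 1\<^sup>2)"
    using Cauchy_Schwarz_ineq_sum[of "\<lambda>z. cmod (case z of (a, b) \<Rightarrow> X a b)" "\<lambda>_. 1" "adiag n1 n2 i"] by simp
  also have "\<dots> = (\<Sum>(a, b)\<in>adiag n1 n2 i. (cmod (X a b))\<^sup>2) * real (vsig n1 n2 i)"
    by (simp add: vsig_adiag case_prod_unfold)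
  finally show ?thesis using False
    by (simp add: Gadj_adiag norm_divide power_divide divide_le_eq)
qed

lemma Gadj_norm_le: "(\<Sum>i<n1+n2-1. (cmod (Gadj n1 n2 X i))\<^sup>2) \<le> fro2 n1 n2 X"
proof -
  have "(\<Sum>i<n1+n2-1. (cmod (Gadj n1 n2 X i))\<^sup>2)
      \<le> (\<Sum>i<n1+n2-1. \<Sum>(a, b)\<in>adiag n1 n2 i. (cmod (X a b))\<^sup>2)"
    by (intro sum_mono Gadj_sq_le)
  also have "\<dots> = fro2 n1 n2 X" by (simp only: sum_over_adiag fro2_def)
  finally show ?thesis .
qed

lemma Gop_adjoint:
  "ip n1 n2 (Gop n1 n2 z) X = (\<Sum>i<n1+n2-1. Re (cnj (z i) * Gadj n1 n2 X i))"
proof -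
  have "ip n1 n2 (Gop n1 n2 z) X
     = (\<Sum>i<n1+n2-1. \<Sum>(a, b)\<in>adiag n1 n2 i. Re (cnj (z (a + b) / complex_of_real (sqrt (real (vsig n1 n2 (a + b))))) * X a b))"
    by (simp only: sum_over_adiag ip_def Gop_def hank_def Dinv_def)
  also have "\<dots> = (\<Sum>i<n1+n2-1. Re (cnj (z i) * Gadj n1 n2 X i))"
  proof (intro sum.cong refl)
    fix i
    have "(\<Sum>(a, b)\<in>adiag n1 n2 i. Re (cnj (z (a + b) / complex_of_real (sqrt (real (vsig n1 n2 (a + b))))) * X a b))
      = (\<Sum>(a, b)\<in>adiag n1 n2 i. Re (cnj (z i) * (X a b / complex_of_real (sqrt (real (vsig n1 n2 i))))))"
      by (intro sum.cong refl) (auto simp: adiag_def)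
    also have "\<dots> = Re (cnj (z i) * Gadj n1 n2 X i)"
      unfolding Gadj_adiag sum_divide_distrib sum_distrib_left Re_sum case_prod_unfold ..
    finally show "(\<Sum>(a, b)\<in>adiag n1 n2 i. Re (cnj (z (a + b) / complex_of_real (sqrt (real (vsig n1 n2 (a + b))))) * X a b))
      = Re (cnj (z i) * Gadj n1 n2 X i)" .
  qed
  finally show ?thesis .
qed

lemma Gadj_hank: "Gadj n1 n2 (hank x) i = Dop n1 n2 x i"
proof -
  have "(\<Sum>(a, b)\<in>adiag n1 n2 i. hank x a b) = (\<Sum>z\<in>adiag n1 n2 i. x i)"
    by (intro sum.cong) (auto simp: adiag_def hank_def)
  then have "Gadj n1 n2 (hank x) i = complex_of_real (real (vsig n1 n2 i) / sqrt (real (vsig n1 n2 i))) * x i"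
    by (simp add: Gadj_adiag vsig_adiag)
  then show ?thesis by (simp add: Dop_def real_div_sqrt)
qed

definition perp :: "nat \<Rightarrow> nat \<Rightarrow> cmat \<Rightarrow> cmat" where
  "perp n1 n2 X = msub X (Gop n1 n2 (Gadj n1 n2 X))"

lemma ip_perp:
  "ip n1 n2 (perp n1 n2 X) Y
     = ip n1 n2 X Y - (\<Sum>i<n1+n2-1. Re (cnj (Gadj n1 n2 X i) * Gadj n1 n2 Y i))"
  by (simp add: perp_def ip_simps Gop_adjoint)

section \<open>Energy of low-rank products on sampled antidiagonals\<close>

text \<open>An antidiagonal meets each row of A at most once, so with incoherent B a single index
  carries at most \<beta> |A|^2. This is efficient only for few indices: the corner samples and the
  outliers.\<close>

lemma Gadj_sparse_le:
  assumes S: "finite S" and B: "\<And>b. b < n2 \<Longrightarrow> rowsq r B b \<le> \<beta>" and \<beta>: "0 \<le> \<beta>"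
  shows "(\<Sum>i\<in>S. (cmod (Gadj n1 n2 (mmul r A (ctr B)) i))\<^sup>2) \<le> real (card S) * \<beta> * fro2 n1 r A"
proof -
  have "(cmod (Gadj n1 n2 (mmul r A (ctr B)) i))\<^sup>2 \<le> \<beta> * fro2 n1 r A" for i
  proof -
    have "(cmod (Gadj n1 n2 (mmul r A (ctr B)) i))\<^sup>2
        \<le> (\<Sum>z\<in>adiag n1 n2 i. (cmod (mmul r A (ctr B) (fst z) (snd z)))\<^sup>2)"
      using Gadj_sq_le[of n1 n2 "mmul r A (ctr B)" i] by (simp add: case_prod_unfold)
    also have "\<dots> \<le> (\<Sum>z\<in>adiag n1 n2 i. \<beta> * rowsq r A (fst z))"
    proof (rule sum_mono)
      fix z assume "z \<in> adiag n1 n2 i"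
      then have "snd z < n2" by (auto simp: adiag_def)
      then have "rowsq r A (fst z) * rowsq r B (snd z) \<le> rowsq r A (fst z) * \<beta>"
        by (intro mult_left_mono B) auto
      then show "(cmod (mmul r A (ctr B) (fst z) (snd z)))\<^sup>2 \<le> \<beta> * rowsq r A (fst z)"
        using mmul_entry_le[of r A B "fst z" "snd z"] by (simp add: mult.commute)
    qed
    also have "\<dots> = (\<Sum>a\<in>fst ` adiag n1 n2 i. \<beta> * rowsq r A a)"
      by (subst sum.reindex) (auto simp: inj_on_def adiag_def)
    also have "\<dots> \<le> (\<Sum>a<n1. \<beta> * rowsq r A a)"
      by (rule sum_mono2) (auto simp: adiag_def \<beta>)
    finally show ?thesis by (simp add: fro2_rowsq sum_distrib_left)
  qed
  then have "(\<Sum>i\<in>S. (cmod (Gadj n1 n2 (mmul r A (ctr B)) i))\<^sup>2) \<le> (\<Sum>i\<in>S. \<beta> * fro2 n1 r A)"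
    by (intro sum_mono)
  then show ?thesis by simp
qed

lemma Gadj_mmul_swap:
  "cmod (Gadj n1 n2 (mmul r A (ctr B)) i) = cmod (Gadj n2 n1 (mmul r B (ctr A)) i)"
  using Gadj_ctr[of n2 n1 "mmul r A (ctr B)" i] by (simp add: ctr_mmul)

lemma Gadj_sparse_le':
  assumes "finite S" "\<And>a. a < n1 \<Longrightarrow> rowsq r A a \<le> \<beta>" "0 \<le> \<beta>"
  shows "(\<Sum>i\<in>S. (cmod (Gadj n1 n2 (mmul r A (ctr B)) i))\<^sup>2) \<le> real (card S) * \<beta> * fro2 n2 r B"
  unfolding Gadj_mmul_swap[of n1 n2] by (rule Gadj_sparse_le[OF assms])

text \<open>A Schur-type test on the part b \<le> a of the shorter antidiagonals. After
  Cauchy-Schwarz it remains to sum 1/length over the samples a + b belonging to one fixed a: they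
  fill a window of some length l, all their antidiagonals have length at least l, and the window
  holds at most 2 p l samples. The two factors l cancel.\<close>

lemma antidiagonal_half_type:
  fixes f g :: "nat \<Rightarrow> real"
  assumes n: "n = n1 + n2 - 1" and l0: "1 \<le> l0" "l0 \<le> n1" "l0 \<le> n2" and p: "0 < p"
    and cnt: "\<And>j l. l0 \<le> l \<Longrightarrow> l \<le> n \<Longrightarrow> real (card (\<Omega> \<inter> {j..<j+l})) \<le> 2 * p * real l"
    and S: "S = {i\<in>\<Omega>. l0 \<le> i \<and> 2 * i + 1 \<le> n}"
  shows "(\<Sum>i\<in>S. (\<Sum>(a, b)\<in>{(a, b)\<in>adiag n1 n2 i. b \<le> a}. f a * g b)\<^sup>2 / real (vsig n1 n2 i))
     \<le> 2 * p * ((\<Sum>a<n1. (f a)\<^sup>2) * (\<Sum>b<n2. (g b)\<^sup>2))"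
proof -
  let ?F = "\<Sum>a<n1. (f a)\<^sup>2" and ?G = "\<Sum>b<n2. (g b)\<^sup>2"
  let ?T = "\<lambda>i. {(a, b)\<in>adiag n1 n2 i. b \<le> a}"
  let ?R = "\<lambda>a b. a + b \<in> S \<and> b \<le> a"
  have finS: "finite S" unfolding S by (rule finite_subset[of _ "{..n}"]) auto
  have finT: "finite (?T i)" for i by (rule finite_subset[OF _ finite_adiag[of n1 n2 i]]) auto
  have inner: "(\<Sum>z\<in>?T i. f (fst z) * g (snd z))\<^sup>2 \<le> (\<Sum>z\<in>?T i. (f (fst z))\<^sup>2) * ?G" for i
  proof -
    have "(\<Sum>z\<in>?T i. f (fst z) * g (snd z))\<^sup>2 \<le> (\<Sum>z\<in>?T i. (f (fst z))\<^sup>2) * (\<Sum>z\<in>?T i. (g (snd z))\<^sup>2)"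
      by (rule Cauchy_Schwarz_ineq_sum)
    also have "(\<Sum>z\<in>?T i. (g (snd z))\<^sup>2) = (\<Sum>b\<in>snd ` ?T i. (g b)\<^sup>2)"
      by (subst sum.reindex) (auto simp: inj_on_def adiag_def)
    also have "(\<Sum>z\<in>?T i. (f (fst z))\<^sup>2) * (\<Sum>b\<in>snd ` ?T i. (g b)\<^sup>2) \<le> (\<Sum>z\<in>?T i. (f (fst z))\<^sup>2) * ?G"
      by (intro mult_left_mono sum_mono2 sum_nonneg) (auto simp: adiag_def)
    finally show ?thesis .
  qed
  have col: "(\<Sum>b\<in>{b\<in>{..<n2}. ?R a b}. 1 / real (vsig n1 n2 (a + b))) \<le> 2 * p" if a: "a < n1" for a
  proof -
    \<comment> \<open>b \<le> a and b < n2 leave at most min (a + 1) n2 positions after a. The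
      maximum with \<open>l0\<close> is the shortest length at which counts are controlled; since
      only i \<ge> \<open>l0\<close> is sampled, the antidiagonals still reach this length.\<close>
    define l where "l = max (min (a + 1) n2) l0"
    have l: "l0 \<le> l" "l \<le> n1" "l \<le> n2" "1 \<le> l" using a l0 by (auto simp: l_def)
    let ?B = "{b\<in>{..<n2}. ?R a b}"
    have v: "1 / real (vsig n1 n2 (a + b)) \<le> 1 / real l" if "b \<in> ?B" for b
    proof -
      have "l \<le> a + b + 1" "2 * (a + b) + 1 \<le> n" using that by (auto simp: l_def S)
      then have "l \<le> vsig n1 n2 (a + b)" using l n a by (intro vsig_ge) auto
      then show ?thesis using l by (intro divide_left_mono) auto
    qed
    have "(\<lambda>b. a + b) ` ?B \<subseteq> \<Omega> \<inter> {max a l0..<max a l0 + l}"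
      by (auto simp: S l_def)
    then have "card ((\<lambda>b. a + b) ` ?B) \<le> card (\<Omega> \<inter> {max a l0..<max a l0 + l})"
      by (intro card_mono) auto
    then have cB: "card ?B \<le> card (\<Omega> \<inter> {max a l0..<max a l0 + l})"
      by (subst (asm) card_image) (auto simp: inj_on_def)
    have "(\<Sum>b\<in>?B. 1 / real (vsig n1 n2 (a + b))) \<le> (\<Sum>b\<in>?B. 1 / real l)"
      by (rule sum_mono[OF v])
    also have "\<dots> = real (card ?B) / real l" by simp
    also have "\<dots> \<le> (2 * p * real l) / real l"
    proof -
      have "l \<le> n" using l n by linarith
      then have "real (card ?B) \<le> 2 * p * real l"
        using cB cnt[OF l(1), of "max a l0"] by linarith
      then show ?thesis by (rule divide_right_mono) simp
    qed
    also have "\<dots> = 2 * p" using l by simp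
    finally show ?thesis .
  qed
  have "(\<Sum>i\<in>S. (\<Sum>(a, b)\<in>?T i. f a * g b)\<^sup>2 / real (vsig n1 n2 i))
     \<le> (\<Sum>i\<in>S. (\<Sum>z\<in>?T i. (f (fst z))\<^sup>2) * ?G / real (vsig n1 n2 i))"
  proof (intro sum_mono divide_right_mono)
    fix i
    have "(\<Sum>(a, b)\<in>?T i. f a * g b) = (\<Sum>z\<in>?T i. f (fst z) * g (snd z))"
      by (intro sum.cong) auto
    then show "(\<Sum>(a, b)\<in>?T i. f a * g b)\<^sup>2 \<le> (\<Sum>z\<in>?T i. (f (fst z))\<^sup>2) * ?G"
      using inner[of i] by simp
  qed simp
  also have "\<dots> = ?G * (\<Sum>i\<in>S. \<Sum>z\<in>?T i. (f (fst z))\<^sup>2 / real (vsig n1 n2 i))"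
    by (simp add: sum_distrib_left sum_divide_distrib mult.commute)
  also have "(\<Sum>i\<in>S. \<Sum>z\<in>?T i. (f (fst z))\<^sup>2 / real (vsig n1 n2 i))
      = (\<Sum>i\<in>S. \<Sum>z\<in>?T i. (f (fst z))\<^sup>2 / real (vsig n1 n2 (fst z + snd z)))"
    by (intro sum.cong refl) (auto simp: adiag_def)
  also have "\<dots> = (\<Sum>z\<in>(\<Union>i\<in>S. ?T i). (f (fst z))\<^sup>2 / real (vsig n1 n2 (fst z + snd z)))"
    by (rule sum.UNION_disjoint[symmetric]) (use finS finT in auto, auto simp: adiag_def)
  also have "(\<Union>i\<in>S. ?T i) = (SIGMA a:{..<n1}. {b\<in>{..<n2}. ?R a b})"
    by (auto simp: adiag_def)
  also have "(\<Sum>z\<in>(SIGMA a:{..<n1}. {b\<in>{..<n2}. ?R a b}). (f (fst z))\<^sup>2 / real (vsig n1 n2 (fst z + snd z)))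
      = (\<Sum>a<n1. \<Sum>b\<in>{b\<in>{..<n2}. ?R a b}. (f a)\<^sup>2 / real (vsig n1 n2 (a + b)))"
    by (subst sum.Sigma) (auto simp: case_prod_unfold)
  also have "\<dots> = (\<Sum>a<n1. (f a)\<^sup>2 * (\<Sum>b\<in>{b\<in>{..<n2}. ?R a b}. 1 / real (vsig n1 n2 (a + b))))"
    by (simp add: sum_distrib_left)
  also have "?G * \<dots> \<le> ?G * (\<Sum>a<n1. (f a)\<^sup>2 * (2 * p))"
    by (intro mult_left_mono sum_mono col sum_nonneg) auto
  also have "\<dots> = 2 * p * (?F * ?G)"
    by (simp add: sum_distrib_right[symmetric])
  finally show ?thesis .
qed

text \<open>The part a \<le> b is the previous lemma for the transposed matrix. The position a = b
  is counted twice, harmlessly as all terms are nonnegative. The constant is 2 (2p) + 2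
  (2p).\<close>

lemma antidiagonal_half:
  fixes f g :: "nat \<Rightarrow> real"
  assumes n: "n = n1 + n2 - 1" and l0: "1 \<le> l0" "l0 \<le> n1" "l0 \<le> n2" and p: "0 < p"
    and cnt: "\<And>j l. l0 \<le> l \<Longrightarrow> l \<le> n \<Longrightarrow> real (card (\<Omega> \<inter> {j..<j+l})) \<le> 2 * p * real l"
    and S: "S = {i\<in>\<Omega>. l0 \<le> i \<and> 2 * i + 1 \<le> n}" and fg: "\<And>a. 0 \<le> f a" "\<And>b. 0 \<le> g b"
  shows "(\<Sum>i\<in>S. (\<Sum>(a, b)\<in>adiag n1 n2 i. f a * g b)\<^sup>2 / real (vsig n1 n2 i))
     \<le> 8 * p * ((\<Sum>a<n1. (f a)\<^sup>2) * (\<Sum>b<n2. (g b)\<^sup>2))"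
proof -
  let ?X = "\<lambda>i. \<Sum>(a, b)\<in>{(a, b)\<in>adiag n1 n2 i. b \<le> a}. f a * g b"
  let ?Y = "\<lambda>i. \<Sum>(b, a)\<in>{(b, a)\<in>adiag n2 n1 i. a \<le> b}. g b * f a"
  have le: "(\<Sum>(a, b)\<in>adiag n1 n2 i. f a * g b)\<^sup>2 \<le> 2 * (?X i)\<^sup>2 + 2 * (?Y i)\<^sup>2" for i
  proof -
    let ?T = "{(a, b)\<in>adiag n1 n2 i. b \<le> a}" and ?T' = "{(a, b)\<in>adiag n1 n2 i. a \<le> b}"
    have sw: "{(b, a)\<in>adiag n2 n1 i. a \<le> b} = prod.swap ` ?T'"
      by (auto simp: adiag_def image_def)
    have Y: "?Y i = (\<Sum>(a, b)\<in>?T'. f a * g b)"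
      unfolding sw by (subst sum.reindex) (auto simp: inj_on_def case_prod_unfold mult.commute)
    have fin: "finite ?T" "finite ?T'" by (rule finite_subset[OF _ finite_adiag[of n1 n2 i]], auto)+
    have "adiag n1 n2 i = ?T \<union> ?T'" by auto
    then have "(\<Sum>(a, b)\<in>adiag n1 n2 i. f a * g b) = (\<Sum>(a, b)\<in>?T \<union> ?T'. f a * g b)" by simp
    also have "\<dots> \<le> ?X i + ?Y i"
    proof -
      have "0 \<le> (\<Sum>(a, b)\<in>?T \<inter> ?T'. f a * g b)" using fg by (intro sum_nonneg) auto
      then show ?thesis unfolding Y using sum.union_inter[OF fin, of "\<lambda>(a, b). f a * g b"] by linarith
    qed
    finally have le: "(\<Sum>(a, b)\<in>adiag n1 n2 i. f a * g b) \<le> ?X i + ?Y i" .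
    have "0 \<le> (\<Sum>(a, b)\<in>adiag n1 n2 i. f a * g b)"
      using fg by (intro sum_nonneg) auto
    then have "(\<Sum>(a, b)\<in>adiag n1 n2 i. f a * g b)\<^sup>2 \<le> (?X i + ?Y i)\<^sup>2"
      by (rule power_mono[OF le])
    also have "\<dots> \<le> 2 * (?X i)\<^sup>2 + 2 * (?Y i)\<^sup>2"
      using zero_le_power2[of "?X i - ?Y i"] by (simp add: power2_eq_square algebra_simps)
    finally show ?thesis .
  qed
  have X: "(\<Sum>i\<in>S. (?X i)\<^sup>2 / real (vsig n1 n2 i)) \<le> 2 * p * ((\<Sum>a<n1. (f a)\<^sup>2) * (\<Sum>b<n2. (g b)\<^sup>2))"
    by (rule antidiagonal_half_type[OF n l0 p cnt S])
  have n': "n = n2 + n1 - 1" using n by simp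
  have Y: "(\<Sum>i\<in>S. (?Y i)\<^sup>2 / real (vsig n2 n1 i)) \<le> 2 * p * ((\<Sum>b<n2. (g b)\<^sup>2) * (\<Sum>a<n1. (f a)\<^sup>2))"
    by (rule antidiagonal_half_type[OF n' l0(1) l0(3,2) p cnt S])
  have "(\<Sum>i\<in>S. (\<Sum>(a, b)\<in>adiag n1 n2 i. f a * g b)\<^sup>2 / real (vsig n1 n2 i))
     \<le> (\<Sum>i\<in>S. (2 * (?X i)\<^sup>2 + 2 * (?Y i)\<^sup>2) / real (vsig n1 n2 i))"
    by (intro sum_mono divide_right_mono le) simp
  also have "\<dots> = 2 * (\<Sum>i\<in>S. (?X i)\<^sup>2 / real (vsig n1 n2 i)) + 2 * (\<Sum>i\<in>S. (?Y i)\<^sup>2 / real (vsig n2 n1 i))"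
    by (simp add: vsig_swap[of n2 n1] add_divide_distrib sum.distrib sum_distrib_left)
  also have "\<dots> \<le> 8 * p * ((\<Sum>a<n1. (f a)\<^sup>2) * (\<Sum>b<n2. (g b)\<^sup>2))"
    using X Y by (simp add: mult.commute mult.left_commute)
  finally show ?thesis .
qed

lemma adiag_reflect:
  assumes "i + 1 \<le> n1 + n2 - 1"
  shows "adiag n1 n2 (n1 + n2 - 2 - i) = (\<lambda>(a, b). (n1 - 1 - a, n2 - 1 - b)) ` adiag n1 n2 i"
proof (intro equalityI subsetI)
  fix z assume "z \<in> adiag n1 n2 (n1 + n2 - 2 - i)"
  then obtain a b where z: "z = (a, b)" "a < n1" "b < n2" "a + b = n1 + n2 - 2 - i"
    by (auto simp: adiag_def)
  then have "(n1 - 1 - a, n2 - 1 - b) \<in> adiag n1 n2 i" "z = (n1 - 1 - (n1 - 1 - a), n2 - 1 - (n2 - 1 - b))"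
    using assms by (auto simp: adiag_def)
  then show "z \<in> (\<lambda>(a, b). (n1 - 1 - a, n2 - 1 - b)) ` adiag n1 n2 i"
    by (intro image_eqI[of _ _ "(n1 - 1 - a, n2 - 1 - b)"]) auto
qed (auto simp: adiag_def)

lemma adiag_reflect_inj: "inj_on (\<lambda>(a, b). (n1 - 1 - a, n2 - 1 - b)) (adiag n1 n2 i)"
  by (auto simp: inj_on_def adiag_def)

text \<open>Rotating the matrix by half a turn sends antidiagonal i to n - 1 - i and exchanges the
  two halves, so the constant doubles to 16 p. Interval counts are invariant under this
  reflection.\<close>

lemma antidiagonal_full:
  fixes f g :: "nat \<Rightarrow> real"
  assumes n: "n = n1 + n2 - 1" and l0: "1 \<le> l0" "l0 \<le> n1" "l0 \<le> n2" and p: "0 < p"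
    and \<Omega>: "\<Omega> \<subseteq> {..<n}"
    and cnt: "\<And>j l. l0 \<le> l \<Longrightarrow> l \<le> n \<Longrightarrow> real (card (\<Omega> \<inter> {j..<j+l})) \<le> 2 * p * real l"
    and fg: "\<And>a. 0 \<le> f a" "\<And>b. 0 \<le> g b"
  shows "(\<Sum>i\<in>{i\<in>\<Omega>. l0 \<le> i \<and> i + l0 < n}. (\<Sum>(a, b)\<in>adiag n1 n2 i. f a * g b)\<^sup>2 / real (vsig n1 n2 i))
     \<le> 16 * p * ((\<Sum>a<n1. (f a)\<^sup>2) * (\<Sum>b<n2. (g b)\<^sup>2))"
proof -
  let ?h = "\<lambda>f g i. (\<Sum>(a, b)\<in>adiag n1 n2 i. f a * g b)\<^sup>2 / real (vsig n1 n2 i)"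
  let ?rho = "\<lambda>i. n - 1 - i"
  define \<Omega>' where "\<Omega>' = ?rho ` \<Omega>"
  define f' where "f' a = f (n1 - 1 - a)" for a
  define g' where "g' b = g (n2 - 1 - b)" for b
  let ?S = "{i\<in>\<Omega>. l0 \<le> i \<and> 2 * i + 1 \<le> n}" and ?S' = "{i\<in>\<Omega>'. l0 \<le> i \<and> 2 * i + 1 \<le> n}"
  have fin: "finite \<Omega>" using \<Omega> finite_subset by blast
  have cnt': "real (card (\<Omega>' \<inter> {j..<j+l})) \<le> 2 * p * real l" if l: "l0 \<le> l" "l \<le> n" for j l
  proof -
    have sub: "\<Omega>' \<inter> {j..<j+l} \<subseteq> ?rho ` (\<Omega> \<inter> {n - j - l..<n - j - l + l})"
    proof
      fix x assume "x \<in> \<Omega>' \<inter> {j..<j+l}"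
      then obtain i where i: "i \<in> \<Omega>" "x = n - 1 - i" "j \<le> x" "x < j + l" by (auto simp: \<Omega>'_def)
      then show "x \<in> ?rho ` (\<Omega> \<inter> {n - j - l..<n - j - l + l})"
        using \<Omega> l by (intro image_eqI[of _ _ i]) auto
    qed
    have "card (\<Omega>' \<inter> {j..<j+l}) \<le> card (?rho ` (\<Omega> \<inter> {n - j - l..<n - j - l + l}))"
      by (rule card_mono[OF _ sub]) (simp add: fin)
    also have "\<dots> \<le> card (\<Omega> \<inter> {n - j - l..<n - j - l + l})"
      by (rule card_image_le) (simp add: fin)
    finally show ?thesis using cnt[OF l, of "n - j - l"] by linarith
  qed
  have 1: "(\<Sum>i\<in>?S. ?h f g i) \<le> 8 * p * ((\<Sum>a<n1. (f a)\<^sup>2) * (\<Sum>b<n2. (g b)\<^sup>2))"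
    by (rule antidiagonal_half[OF n l0 p cnt refl fg])
  have 2: "(\<Sum>i\<in>?S'. ?h f' g' i) \<le> 8 * p * ((\<Sum>a<n1. (f' a)\<^sup>2) * (\<Sum>b<n2. (g' b)\<^sup>2))"
    by (rule antidiagonal_half[OF n l0 p cnt' refl]) (auto simp: f'_def g'_def fg)
  have refl_sum: "(\<Sum>a<m. (h (m - 1 - a))\<^sup>2) = (\<Sum>a<m. (h a)\<^sup>2)" for h :: "nat \<Rightarrow> real" and m
    using sum.nat_diff_reindex[of "\<lambda>a. (h a)\<^sup>2" m] by simp
  have F: "(\<Sum>a<n1. (f' a)\<^sup>2) = (\<Sum>a<n1. (f a)\<^sup>2)" "(\<Sum>b<n2. (g' b)\<^sup>2) = (\<Sum>b<n2. (g b)\<^sup>2)"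
    by (simp_all only: f'_def g'_def refl_sum)
  have h: "?h f' g' (?rho i) = ?h f g i" if "i < n" for i
  proof -
    have e: "adiag n1 n2 (?rho i) = (\<lambda>(a, b). (n1 - 1 - a, n2 - 1 - b)) ` adiag n1 n2 i"
      using adiag_reflect[of i n1 n2] that n by (simp add: numeral_2_eq_2)
    have "vsig n1 n2 (?rho i) = vsig n1 n2 i"
      unfolding vsig_adiag e by (rule card_image[OF adiag_reflect_inj])
    moreover have "(\<Sum>(a, b)\<in>adiag n1 n2 (?rho i). f' a * g' b) = (\<Sum>(a, b)\<in>adiag n1 n2 i. f a * g b)"
      unfolding e by (subst sum.reindex[OF adiag_reflect_inj])
        (auto simp: case_prod_unfold f'_def g'_def adiag_def intro!: sum.cong)
    ultimately show ?thesis by simp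
  qed
  have sub: "{i\<in>\<Omega>. l0 \<le> i \<and> i + l0 < n} \<subseteq> ?S \<union> ?rho ` ?S'"
  proof
    fix i assume i: "i \<in> {i\<in>\<Omega>. l0 \<le> i \<and> i + l0 < n}"
    show "i \<in> ?S \<union> ?rho ` ?S'"
    proof (cases "2 * i + 1 \<le> n")
      case False
      then have "?rho i \<in> ?S'" using i by (auto simp: \<Omega>'_def)
      moreover have "i = ?rho (?rho i)" using i by auto
      ultimately show ?thesis by blast
    qed (use i in auto)
  qed
  have fin': "finite \<Omega>'" by (simp add: \<Omega>'_def fin)
  have lt': "i < n" if "i \<in> \<Omega>'" for i using that \<Omega> by (auto simp: \<Omega>'_def)
  have "(\<Sum>i\<in>{i\<in>\<Omega>. l0 \<le> i \<and> i + l0 < n}. ?h f g i) \<le> (\<Sum>i\<in>?S \<union> ?rho ` ?S'. ?h f g i)"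
    by (rule sum_mono2[OF _ sub]) (auto simp: fin fin')
  also have "\<dots> \<le> (\<Sum>i\<in>?S. ?h f g i) + (\<Sum>i\<in>?rho ` ?S'. ?h f g i)"
    using fin fin' sum.union_inter[of ?S "?rho ` ?S'" "?h f g"] sum_nonneg[of "?S \<inter> ?rho ` ?S'" "?h f g"]
    by simp
  also have "(\<Sum>i\<in>?rho ` ?S'. ?h f g i) = (\<Sum>i\<in>?S'. ?h f g (?rho i))"
    by (subst sum.reindex) (auto simp: inj_on_def o_def dest!: lt')
  also have "\<dots> = (\<Sum>i\<in>?S'. ?h f' g' i)"
  proof (intro sum.cong refl)
    fix i assume "i \<in> ?S'"
    then have "i < n" using lt' by auto
    then show "?h f g (?rho i) = ?h f' g' i" using h[of "?rho i"] by simp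
  qed
  also have "(\<Sum>i\<in>?S. ?h f g i) + (\<Sum>i\<in>?S'. ?h f' g' i) \<le> 16 * p * ((\<Sum>a<n1. (f a)\<^sup>2) * (\<Sum>b<n2. (g b)\<^sup>2))"
    using 1 2 unfolding F by simp
  finally show ?thesis .
qed

text \<open>The row norms of A and B play the parts of f and g. The bound involves Frobenius norms
  alone and so holds for factors that depend on the sample.\<close>

lemma Gadj_sampled_le:
  assumes n: "n = n1 + n2 - 1" and l0: "1 \<le> l0" "l0 \<le> n1" "l0 \<le> n2" and p: "0 < p"
    and \<Omega>: "\<Omega> \<subseteq> {..<n}"
    and cnt: "\<And>j l. l0 \<le> l \<Longrightarrow> l \<le> n \<Longrightarrow> real (card (\<Omega> \<inter> {j..<j+l})) \<le> 2 * p * real l"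
  shows "(\<Sum>i\<in>{i\<in>\<Omega>. l0 \<le> i \<and> i + l0 < n}. (cmod (Gadj n1 n2 (mmul r A (ctr B)) i))\<^sup>2)
     \<le> 16 * p * (fro2 n1 r A * fro2 n2 r B)"
proof -
  let ?f = "\<lambda>a. sqrt (rowsq r A a)" and ?g = "\<lambda>b. sqrt (rowsq r B b)"
  have "(cmod (Gadj n1 n2 (mmul r A (ctr B)) i))\<^sup>2
      \<le> (\<Sum>(a, b)\<in>adiag n1 n2 i. ?f a * ?g b)\<^sup>2 / real (vsig n1 n2 i)" for i
  proof -
    have ent: "cmod (mmul r A (ctr B) a b) \<le> ?f a * ?g b" for a b
      using real_sqrt_le_mono[OF mmul_entry_le[of r A B a b]] by (simp add: real_sqrt_mult)
    have "cmod (\<Sum>(a, b)\<in>adiag n1 n2 i. mmul r A (ctr B) a b) \<le> (\<Sum>(a, b)\<in>adiag n1 n2 i. ?f a * ?g b)"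
      by (rule sum_norm_le) (use ent in auto)
    then have "(cmod (\<Sum>(a, b)\<in>adiag n1 n2 i. mmul r A (ctr B) a b))\<^sup>2 \<le> (\<Sum>(a, b)\<in>adiag n1 n2 i. ?f a * ?g b)\<^sup>2"
      by (rule power_mono) simp
    then show ?thesis
      by (simp add: Gadj_adiag norm_divide power_divide divide_right_mono)
  qed
  then have "(\<Sum>i\<in>{i\<in>\<Omega>. l0 \<le> i \<and> i + l0 < n}. (cmod (Gadj n1 n2 (mmul r A (ctr B)) i))\<^sup>2)
     \<le> (\<Sum>i\<in>{i\<in>\<Omega>. l0 \<le> i \<and> i + l0 < n}. (\<Sum>(a, b)\<in>adiag n1 n2 i. ?f a * ?g b)\<^sup>2 / real (vsig n1 n2 i))"
    by (intro sum_mono)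
  also have "\<dots> \<le> 16 * p * ((\<Sum>a<n1. (?f a)\<^sup>2) * (\<Sum>b<n2. (?g b)\<^sup>2))"
    by (rule antidiagonal_full[OF n l0 p \<Omega> cnt]) auto
  finally show ?thesis by (simp add: fro2_rowsq)
qed

subsection \<open>The Procrustes problem\<close>

lemma orthcols_iff:
  "orthcols m q Q \<longleftrightarrow> (\<forall>i<q. \<forall>j<q. (\<Sum>l<m. cnj (Q l i) * Q l j) = (if i = j then 1 else 0))"
  by (simp add: orthcols_def mat_eq_def mmul_def ctr_def idm_def)

lemma mmul_idm_right:
  assumes "mat_eq r r M idm" "j < r"
  shows "mmul r X M a j = X a j"
proof -
  have "mmul r X M a j = (\<Sum>l<r. if l = j then X a l else 0)"
    unfolding mmul_def by (intro sum.cong refl) (use assms in \<open>auto simp: mat_eq_def idm_def\<close>)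
  then show ?thesis using assms(2) by simp
qed

lemma mmul_idm_left:
  assumes "mat_eq r r M idm" "i < r"
  shows "mmul r M X i b = X i b"
proof -
  have "mmul r M X i b = (\<Sum>l<r. if l = i then X l b else 0)"
    unfolding mmul_def by (intro sum.cong refl) (use assms in \<open>auto simp: mat_eq_def idm_def\<close>)
  then show ?thesis using assms(2) by simp
qed

lemma ip_cong: "(\<And>i j. i < m \<Longrightarrow> j < k \<Longrightarrow> A i j = A' i j) \<Longrightarrow> (\<And>i j. i < m \<Longrightarrow> j < k \<Longrightarrow> B i j = B' i j)
   \<Longrightarrow> ip m k A B = ip m k A' B'"
  by (simp add: ip_def)

lemma fro2_mmul_orth_right:
  assumes "orthcols q r (ctr P)"
  shows "fro2 m q (mmul r X P) = fro2 m r X"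
proof -
  have "fro2 m q (mmul r X P) = ip m r X (mmul q (mmul r X P) (ctr P))"
    by (simp only: ip_self[symmetric] ip_mmul_right)
  also have "\<dots> = ip m r X (mmul r X (mmul q P (ctr P)))" by (simp only: mmul_assoc)
  also have "\<dots> = ip m r X X"
    using assms by (intro ip_cong refl mmul_idm_right) (auto simp: orthcols_def)
  finally show ?thesis by (simp add: ip_self)
qed

lemma fro2_mmul_orth_left:
  assumes "orthcols m q U"
  shows "fro2 m k (mmul q U X) = fro2 q k X"
  using fro2_mmul_orth_right[of m q "ctr U" k "ctr X"] assms
  by (simp add: fro2_ctr flip: ctr_mmul)

text \<open>X is compared with its orthogonal projection onto the columns of U: their inner product
  is the squared norm of the projection, and the difference has a nonnegative square.\<close>

lemma fro2_mmul_orth_le: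
  assumes "orthcols m q U"
  shows "fro2 k q (mmul m X U) \<le> fro2 k m X"
proof -
  let ?Y = "mmul m X U"
  have "ip k m X (mmul q ?Y (ctr U)) = fro2 k q ?Y"
    using ip_mmul_right[of k q m X U ?Y] by (simp add: ip_self)
  moreover have "fro2 k m (mmul q ?Y (ctr U)) = fro2 k q ?Y"
    by (rule fro2_mmul_orth_right) (simp add: assms)
  ultimately show ?thesis
    using fro2_nonneg[of k m "msub X (mmul q ?Y (ctr U))"] unfolding fro2_msub by linarith
qed

section \<open>Existence of the optimal rotation\<close>

text \<open>Bolzano-Weierstrass, one coordinate at a time along nested subsequences; a matrix is a
  function on all indices, of which only finitely many are made to converge.\<close>

lemma bounded_pointwise_subseq:
  fixes F :: "nat \<Rightarrow> 'k \<Rightarrow> complex"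
  assumes "finite I" "\<And>n k. k \<in> I \<Longrightarrow> cmod (F n k) \<le> B"
  shows "\<exists>s l. strict_mono s \<and> (\<forall>k\<in>I. (\<lambda>n. F (s n) k) \<longlonglongrightarrow> l k)"
  using assms
proof (induction I rule: finite_induct)
  case empty
  then show ?case by (auto intro: exI[of _ id] strict_mono_id)
next
  case (insert j I)
  have "\<exists>s l. strict_mono s \<and> (\<forall>k\<in>I. (\<lambda>n. F (s n) k) \<longlonglongrightarrow> l k)"
    by (rule insert.IH) (simp add: insert.prems)
  then obtain s l where s: "strict_mono s" "\<And>k. k \<in> I \<Longrightarrow> (\<lambda>n. F (s n) k) \<longlonglongrightarrow> l k"
    by blast
  have "\<And>n. F (s n) j \<in> cball 0 B" using insert.prems by simp
  then obtain z t where t: "strict_mono t" "((\<lambda>n. F (s n) j) \<circ> t) \<longlonglongrightarrow> z"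
    using compact_imp_seq_compact[OF compact_cball[of "0::complex" B]] unfolding seq_compact_def by metis
  have "(\<lambda>n. F ((s \<circ> t) n) k) \<longlonglongrightarrow> (l(j := z)) k" if "k \<in> insert j I" for k
  proof (cases "k = j")
    case True
    then show ?thesis using t by (simp add: o_def)
  next
    case False
    then have "(\<lambda>n. F (s n) k) \<longlonglongrightarrow> l k" using that s by simp
    from LIMSEQ_subseq_LIMSEQ[OF this t(1)] show ?thesis using False by (simp add: o_def)
  qed
  then show ?case using strict_mono_o[OF s(1) t(1)] by blast
qed

definition procr :: "nat \<Rightarrow> nat \<Rightarrow> nat \<Rightarrow> cmat \<Rightarrow> cmat \<Rightarrow> cmat \<Rightarrow> cmat \<Rightarrow> cmat \<Rightarrow> real" where
  "procr n1 n2 r L0 R0 L R Q = fro2 n1 r (msub L (mmul r L0 Q)) + fro2 n2 r (msub R (mmul r R0 Q))"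

lemma procr_nonneg [simp]: "0 \<le> procr n1 n2 r L0 R0 L R Q"
  by (simp add: procr_def)

lemma orthcols_idm: "orthcols r r idm"
  unfolding orthcols_iff
proof (intro allI impI)
  fix i j assume ij: "i < r" "j < r"
  have "(\<Sum>l<r. cnj (idm l i) * idm l j) = (\<Sum>l<r. if l = i then (if i = j then 1 else 0) else 0)"
    by (intro sum.cong refl) (auto simp: idm_def)
  then show "(\<Sum>l<r. cnj (idm l i) * idm l j) = (if i = j then 1 else 0)" using ij by simp
qed

lemma orthcols_entry_le:
  assumes "orthcols m r Q" "i < m" "j < r"
  shows "cmod (Q i j) \<le> 1"
proof -
  have "(\<Sum>l<m. cnj (Q l j) * Q l j) = 1" using assms by (simp add: orthcols_iff)
  then have "complex_of_real (\<Sum>l<m. (cmod (Q l j))\<^sup>2) = 1"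
    by (simp only: of_real_sum complex_norm_square mult.commute)
  then have s: "(\<Sum>l<m. (cmod (Q l j))\<^sup>2) = 1" using of_real_eq_1_iff by blast
  have "(cmod (Q i j))\<^sup>2 \<le> (\<Sum>l<m. (cmod (Q l j))\<^sup>2)"
    using assms by (intro member_le_sum) auto
  then show ?thesis unfolding s by (simp add: power2_le_imp_le abs_square_le_1)
qed

text \<open>The unitary matrices are compact and the objective is continuous. Attainment matters
  because the alignment property used later is the first-order condition at a minimum.\<close>

lemma procr_minimizer:
  "\<exists>Q. orthcols r r Q \<and> (\<forall>P. orthcols r r P \<longrightarrow> procr n1 n2 r L0 R0 L R Q \<le> procr n1 n2 r L0 R0 L R P)"
proof -
  let ?o = "procr n1 n2 r L0 R0 L R"
  define m where "m = Inf (?o ` Collect (orthcols r r))"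
  have bdd: "bdd_below (?o ` Collect (orthcols r r))" by (rule bdd_belowI2[of _ 0]) simp
  have m: "m \<le> ?o P" if "orthcols r r P" for P
    unfolding m_def using that by (intro cInf_lower bdd) auto
  have "\<exists>Q. orthcols r r Q \<and> ?o Q < m + 1 / real (Suc k)" for k
  proof -
    have "m < m + 1 / real (Suc k)" by simp
    then show ?thesis
      unfolding m_def using cInf_lessD[of "?o ` Collect (orthcols r r)"] orthcols_idm by blast
  qed
  then obtain F where F: "\<And>k. orthcols r r (F k)" "\<And>k. ?o (F k) < m + 1 / real (Suc k)" by metis
  have "\<exists>s l. strict_mono s \<and> (\<forall>z\<in>{..<r} \<times> {..<r}. (\<lambda>k. F (s k) (fst z) (snd z)) \<longlonglongrightarrow> l z)"
    by (rule bounded_pointwise_subseq[of _ _ 1]) (use orthcols_entry_le[OF F(1)] in auto)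
  then obtain s l where s: "strict_mono s"
    and lim: "\<And>z. z \<in> {..<r} \<times> {..<r} \<Longrightarrow> (\<lambda>k. F (s k) (fst z) (snd z)) \<longlonglongrightarrow> l z"
    by blast
  define Q where "Q i j = l (i, j)" for i j
  have lim: "(\<lambda>k. F (s k) i j) \<longlonglongrightarrow> Q i j" if "i < r" "j < r" for i j
    using lim[of "(i, j)"] that by (simp add: Q_def)
  have oQ: "orthcols r r Q"
    unfolding orthcols_iff
  proof (intro allI impI)
    fix i j assume ij: "i < r" "j < r"
    have "(\<lambda>k. \<Sum>l<r. cnj (F (s k) l i) * F (s k) l j) \<longlonglongrightarrow> (\<Sum>l<r. cnj (Q l i) * Q l j)"
      by (intro tendsto_intros lim) (use ij in auto)
    moreover have "(\<Sum>l<r. cnj (F (s k) l i) * F (s k) l j) = (if i = j then 1 else 0)" for k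
      using F(1) ij unfolding orthcols_iff by blast
    ultimately have "(\<lambda>_::nat. if i = j then 1 else 0) \<longlonglongrightarrow> (\<Sum>l<r. cnj (Q l i) * Q l j)" by simp
    then show "(\<Sum>l<r. cnj (Q l i) * Q l j) = (if i = j then 1 else 0)"
      by (simp only: LIMSEQ_const_iff)
  qed
  have "(\<lambda>k. ?o (F (s k))) \<longlonglongrightarrow> ?o Q"
    unfolding procr_def fro2_def msub_def mmul_def
    by (intro tendsto_intros lim) auto
  moreover have "(\<lambda>k. m + 1 / real (Suc (s k))) \<longlonglongrightarrow> m + 0"
    by (intro tendsto_intros LIMSEQ_subseq_LIMSEQ[OF _ s, of "\<lambda>k. 1 / real (Suc k)", unfolded o_def])
       (rule LIMSEQ_Suc[OF lim_1_over_n])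
  ultimately have "?o Q \<le> m + 0"
    by (rule LIMSEQ_le) (use F(2) in \<open>auto intro!: exI[of _ 0] less_imp_le\<close>)
  then show ?thesis using oQ m by force
qed

lemma dist_fac_attained:
  obtains Q where "orthcols r r Q" "(dist_fac n1 n2 r L0 R0 L R)\<^sup>2 = procr n1 n2 r L0 R0 L R Q"
    "\<And>P. orthcols r r P \<Longrightarrow> procr n1 n2 r L0 R0 L R Q \<le> procr n1 n2 r L0 R0 L R P"
proof -
  obtain Q where Q: "orthcols r r Q" "\<And>P. orthcols r r P \<Longrightarrow> procr n1 n2 r L0 R0 L R Q \<le> procr n1 n2 r L0 R0 L R P"
    using procr_minimizer by blast
  have "dist_fac n1 n2 r L0 R0 L R = sqrt (procr n1 n2 r L0 R0 L R Q)"
    unfolding dist_fac_def procr_def[symmetric]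
    by (rule cInf_eq_minimum) (use Q in \<open>auto intro!: real_sqrt_le_mono\<close>)
  with Q that show thesis by simp
qed

lemma dist_fac_nonneg: "0 \<le> dist_fac n1 n2 r L0 R0 L R"
  unfolding dist_fac_def by (rule cInf_greatest) (use orthcols_idm in auto)

lemma dist_fac_le:
  assumes "orthcols r r Q"
  shows "(dist_fac n1 n2 r L0 R0 L R)\<^sup>2 \<le> procr n1 n2 r L0 R0 L R Q"
proof -
  obtain Q' where "orthcols r r Q'" "(dist_fac n1 n2 r L0 R0 L R)\<^sup>2 = procr n1 n2 r L0 R0 L R Q'"
    "\<And>P. orthcols r r P \<Longrightarrow> procr n1 n2 r L0 R0 L R Q' \<le> procr n1 n2 r L0 R0 L R P"
    using dist_fac_attained by blast
  with assms show ?thesis by simp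
qed

lemma orthcols_mmul:
  assumes "orthcols r r Q" "orthcols r r P"
  shows "orthcols r r (mmul r Q P)"
proof -
  have "mmul r (ctr (mmul r Q P)) (mmul r Q P) = mmul r (ctr P) (mmul r (mmul r (ctr Q) Q) P)"
    by (simp only: ctr_mmul mmul_assoc)
  moreover have "mmul r (ctr P) (mmul r (mmul r (ctr Q) Q) P) i j = mmul r (ctr P) P i j" for i j
    using mmul_idm_left[of r "mmul r (ctr Q) Q" _ P j] assms(1)
    unfolding mmul_def[of r "ctr P"] orthcols_def by (intro sum.cong refl) simp
  ultimately show ?thesis using assms(2) by (simp add: orthcols_def mat_eq_def)
qed

section \<open>First-order condition of the optimal rotation\<close>

text \<open>The identity plus c times v and its adjoint: it multiplies v by 1 + c |v|^2 and fixes
  the complement. For v \<noteq> 0 the equation in \<open>rank1u_orthcols\<close> says that this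
  factor lies on the unit circle, which makes the matrix unitary.\<close>

definition rank1u :: "complex \<Rightarrow> (nat \<Rightarrow> complex) \<Rightarrow> cmat" where
  "rank1u c v = (\<lambda>i j. (if i = j then 1 else 0) + c * v i * cnj (v j))"

lemma rank1u_orthcols:
  assumes "(\<Sum>l<r. (cmod (v l))\<^sup>2) = N" "c + cnj c + c * cnj c * complex_of_real N = 0"
  shows "orthcols r r (rank1u c v)"
  unfolding orthcols_iff
proof (intro allI impI)
  fix i j assume ij: "i < r" "j < r"
  have N: "(\<Sum>l<r. cnj (v l) * v l) = complex_of_real N"
    by (simp only: assms(1)[symmetric] of_real_sum complex_norm_square mult.commute)
  have "(\<Sum>l<r. cnj (rank1u c v l i) * rank1u c v l j)
     = (\<Sum>l<r. (if l = i then (if i = j then 1 else 0) else 0) + (if l = i then c * v i * cnj (v j) else 0)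
         + (if l = j then cnj c * cnj (v j) * v i else 0) + c * cnj c * (v i * cnj (v j)) * (cnj (v l) * v l))"
    by (intro sum.cong refl) (auto simp: rank1u_def algebra_simps)
  also have "\<dots> = (if i = j then 1 else 0) + (c + cnj c + c * cnj c * complex_of_real N) * (v i * cnj (v j))"
    using ij by (simp add: sum.distrib N flip: sum_distrib_left) (simp add: algebra_simps)
  finally show "(\<Sum>l<r. cnj (rank1u c v l i) * rank1u c v l j) = (if i = j then 1 else 0)"
    by (simp add: assms(2))
qed

lemma ctr_rank1u: "ctr (rank1u c v) = rank1u (cnj c) v"
  by (auto simp: ctr_def rank1u_def fun_eq_iff)

lemma ip_mmul_rank1u:
  "ip m r L (mmul r X (rank1u c v)) = ip m r L X
     + Re (c * (\<Sum>k<r. \<Sum>l<r. v k * cnj (v l) * (\<Sum>a<m. cnj (L a l) * X a k)))"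
proof -
  have e: "mmul r X (rank1u c v) a l = X a l + c * (\<Sum>k<r. X a k * v k * cnj (v l))" if "l < r" for a l
  proof -
    have "mmul r X (rank1u c v) a l = (\<Sum>k<r. (if k = l then X a k else 0) + c * (X a k * v k * cnj (v l)))"
      unfolding mmul_def by (intro sum.cong refl) (simp add: rank1u_def algebra_simps)
    then show ?thesis using that by (simp add: sum.distrib sum_distrib_left)
  qed
  have "ip m r L (mmul r X (rank1u c v)) = (\<Sum>a<m. \<Sum>l<r. Re (cnj (L a l) * X a l)
      + Re (c * (\<Sum>k<r. v k * cnj (v l) * (cnj (L a l) * X a k))))"
    unfolding ip_def by (intro sum.cong refl) (simp add: e distrib_left sum_distrib_left ac_simps)
  also have "\<dots> = ip m r L X + Re (c * (\<Sum>a<m. \<Sum>l<r. \<Sum>k<r. v k * cnj (v l) * (cnj (L a l) * X a k)))"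
    by (simp add: ip_def sum.distrib sum_distrib_left Re_sum)
  also have "(\<Sum>a<m. \<Sum>l<r. \<Sum>k<r. v k * cnj (v l) * (cnj (L a l) * X a k))
     = (\<Sum>k<r. \<Sum>l<r. \<Sum>a<m. v k * cnj (v l) * (cnj (L a l) * X a k))"
    by (subst sum.swap, subst (2) sum.swap, subst sum.swap) (rule refl)
  finally show ?thesis by (simp add: sum_distrib_left)
qed

text \<open>Differentiation at z = 1 along the circle, done with its rational parametrisation:
  dividing by t leaves |Im b| \<le> t Re b for every t > 0.\<close>

lemma rotation_first_order:
  fixes b :: complex
  assumes "\<And>z. cmod z = 1 \<Longrightarrow> Re ((z - 1) * b) \<le> 0"
  shows "Im b = 0"
proof -
  have bd: "\<bar>Im b\<bar> \<le> t * Re b" if "0 < t" for t :: real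
  proof -
    have "t * s * Im b \<le> t * (t * Re b)" if s: "s \<in> {1, -1}" for s :: real
    proof -
      let ?d = "1 + t\<^sup>2"
      have d: "0 < ?d" using zero_le_power2[of t] by linarith
      let ?z = "Complex ((1 - t\<^sup>2) / ?d) (- 2 * (s * t) / ?d)"
      have s2: "s * s = 1" using s by auto
      have "(1 - t\<^sup>2)\<^sup>2 + (- 2 * (s * t))\<^sup>2 = ?d\<^sup>2"
        using s2 by (simp add: power2_eq_square algebra_simps)
      then have "cmod ?z = 1"
        using d by (simp add: cmod_def power_divide flip: add_divide_distrib)
      from assms[OF this] have "((1 - t\<^sup>2) / ?d - 1) * Re b + 2 * (s * t) / ?d * Im b \<le> 0" by simp
      then have "?d * (((1 - t\<^sup>2) / ?d - 1) * Re b + 2 * (s * t) / ?d * Im b) \<le> 0"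
        using d by (simp add: mult_le_0_iff)
      also have "(1 - t\<^sup>2) / ?d - 1 = - (2 * t\<^sup>2) / ?d" using d by (simp add: field_simps)
      also have "?d * (- (2 * t\<^sup>2) / ?d * Re b + 2 * (s * t) / ?d * Im b)
          = - (2 * t\<^sup>2) * Re b + 2 * (s * t) * Im b"
      proof -
        have "e * (x / e * y + z / e * w) = x * y + z * w" if "0 < e" for e x y z w :: real
          using that by (simp add: field_simps)
        from this[OF d] show ?thesis .
      qed
      also have "\<dots> = 2 * (t * s * Im b - t * (t * Re b))"
        by (simp add: power2_eq_square algebra_simps)
      finally show ?thesis by simp
    qed
    from this[of 1] this[of "-1"] have "t * Im b \<le> t * (t * Re b)" "t * (- Im b) \<le> t * (t * Re b)" by simp_all
    then have "Im b \<le> t * Re b" "- Im b \<le> t * Re b"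
      using that by (blast intro: mult_left_le_imp_le)+
    then show ?thesis by (simp add: abs_le_iff)
  qed
  show ?thesis
  proof (rule ccontr)
    assume "Im b \<noteq> 0"
    then have pos: "0 < \<bar>Im b\<bar>" by simp
    have R: "0 < Re b" using bd[of 1] pos by simp
    have "\<bar>Im b\<bar> \<le> \<bar>Im b\<bar> / (2 * Re b) * Re b" by (rule bd) (use R pos in simp)
    then show False using R pos by simp
  qed
qed

text \<open>A minimiser cannot be improved by rotating one further direction v. Hence the quadratic
  form of \<open>C\<close> at v is real for every v, and a matrix with real quadratic form is
  Hermitian. Up to transposition \<open>C\<close> is the sum of the Gram matrices of L with X and of
  R with Y.\<close>

lemma procr_gauge:
  assumes Q: "orthcols r r Q"
    and min: "\<And>P. orthcols r r P \<Longrightarrow> procr n1 n2 r L0 R0 L R Q \<le> procr n1 n2 r L0 R0 L R P"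
    and ij: "i < r" "j < r"
  defines "X \<equiv> mmul r L0 Q" and "Y \<equiv> mmul r R0 Q"
  defines "C \<equiv> (\<lambda>k l. (\<Sum>a<n1. cnj (L a l) * X a k) + (\<Sum>b<n2. cnj (R b l) * Y b k))"
  shows "C i j = cnj (C j i)"
proof -
  define q where "q v = (\<Sum>k<r. \<Sum>l<r. v k * cnj (v l) * C k l)" for v
  have real_q: "Im (q v) = 0" if N: "(\<Sum>l<r. (cmod (v l))\<^sup>2) = N" "0 < N" for v N
  proof (rule rotation_first_order)
    fix z :: complex assume z: "cmod z = 1"
    \<comment> \<open>Makes 1 + c |v|^2 equal to z, a rotation of the direction v by z.\<close>
    define c where "c = (z - 1) / complex_of_real N"
    have zz: "z * cnj z = 1" using complex_norm_square[of z] z by simp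
    have "c + cnj c + c * cnj c * complex_of_real N = ((z - 1) + (cnj z - 1) + (z - 1) * (cnj z - 1)) / complex_of_real N"
      using N(2) by (simp add: c_def field_simps)
    also have "\<dots> = 0" by (simp add: algebra_simps zz)
    finally have c0: "c + cnj c + c * cnj c * complex_of_real N = 0" .
    then have c0': "cnj c + cnj (cnj c) + cnj c * cnj (cnj c) * complex_of_real N = 0"
      by (simp add: ac_simps)
    have oP: "orthcols r r (rank1u c v)" by (rule rank1u_orthcols[OF N(1) c0])
    have oP': "orthcols r r (ctr (rank1u c v))" unfolding ctr_rank1u by (rule rank1u_orthcols[OF N(1) c0'])
    have "procr n1 n2 r L0 R0 L R Q \<le> procr n1 n2 r L0 R0 L R (mmul r Q (rank1u c v))"
      by (rule min[OF orthcols_mmul[OF Q oP]])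
    then have "ip n1 r L (mmul r X (rank1u c v)) + ip n2 r R (mmul r Y (rank1u c v)) \<le> ip n1 r L X + ip n2 r R Y"
      unfolding procr_def mmul_assoc X_def[symmetric] Y_def[symmetric] fro2_msub
        fro2_mmul_orth_right[OF oP'] by simp
    moreover have "ip n1 r L (mmul r X (rank1u c v)) + ip n2 r R (mmul r Y (rank1u c v))
        = ip n1 r L X + ip n2 r R Y + Re (c * q v)"
      by (simp add: ip_mmul_rank1u q_def C_def distrib_left sum.distrib)
    ultimately have "Re (c * q v) \<le> 0" by simp
    moreover have "c * q v = (z - 1) * q v / complex_of_real N" by (simp add: c_def)
    ultimately have "Re ((z - 1) * q v) / N \<le> 0" by (simp only: Re_divide_of_real)
    then show "Re ((z - 1) * q v) \<le> 0" using N(2) by (simp add: divide_le_0_iff)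
  qed
  have diag: "Im (C k k) = 0" if "k < r" for k
  proof -
    let ?v = "\<lambda>l. if l = k then 1 else 0 :: complex"
    have "q ?v = (\<Sum>k'<r. \<Sum>l<r. if l = k then (if k' = k then C k' l else 0) else 0)"
      unfolding q_def by (intro sum.cong refl) auto
    then have "q ?v = C k k" using that by simp
    moreover have "(\<Sum>l<r. (cmod (?v l))\<^sup>2) = (\<Sum>l<r. if l = k then 1 else 0)"
      by (intro sum.cong refl) auto
    then have "(\<Sum>l<r. (cmod (?v l))\<^sup>2) = 1" using that by simp
    ultimately show ?thesis using real_q[of ?v 1] by simp
  qed
  show ?thesis
  proof (cases "i = j")
    case True
    then show ?thesis using diag[OF ij(1)] by (simp add: complex_eq_iff)
  next
    case False
    have off: "Im (w * C i j + cnj w * C j i) = 0" if w: "cmod w = 1" for w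
    proof -
      \<comment> \<open>Polarisation: besides diagonal entries the form at this v is w C_ij + conj w
        C_ji; w = 1 compares the imaginary parts and w = \<i> the real parts.\<close>
      define v where "v l = (if l = i then w else 0) + (if l = j then 1 else 0)" for l
      have ww: "w * cnj w = 1" using complex_norm_square[of w] w by simp
      have "q v = (\<Sum>k<r. v k * (cnj w * C k i + C k j))"
      proof -
        have "(\<Sum>l<r. v k * cnj (v l) * C k l) = v k * (cnj w * C k i + C k j)" for k
        proof -
          have "(\<Sum>l<r. v k * cnj (v l) * C k l)
              = (\<Sum>l<r. (if l = i then v k * cnj w * C k l else 0) + (if l = j then v k * C k l else 0))"
            using False by (intro sum.cong refl) (auto simp: v_def)
          then show ?thesis using ij by (simp add: sum.distrib algebra_simps)
        qed
        then show ?thesis by (simp add: q_def)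
      qed
      also have "\<dots> = (\<Sum>k<r. (if k = i then w * (cnj w * C k i + C k j) else 0) + (if k = j then cnj w * C k i + C k j else 0))"
        using False by (intro sum.cong refl) (auto simp: v_def)
      also have "\<dots> = w * (cnj w * C i i + C i j) + (cnj w * C j i + C j j)"
        using ij by (simp add: sum.distrib)
      also have "\<dots> = (w * cnj w) * C i i + w * C i j + cnj w * C j i + C j j" by (simp add: algebra_simps)
      finally have q: "q v = C i i + w * C i j + cnj w * C j i + C j j" by (simp only: ww mult_1)
      have "(\<Sum>l<r. (cmod (v l))\<^sup>2) = (\<Sum>l<r. (if l = i then 1 else 0) + (if l = j then 1 else 0))"
        using False w by (intro sum.cong refl) (auto simp: v_def)
      also have "\<dots> = 2" using ij by (simp add: sum.distrib)
      finally have "Im (q v) = 0" by (rule real_q) simp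
      then show ?thesis using q diag ij by simp
    qed
    from off[of 1] off[of "\<i>"] show ?thesis by (simp add: complex_eq_iff)
  qed
qed

text \<open>For square Q, a left inverse is a right inverse. Here it follows from norms: the product
  of Q with its adjoint has squared distance r - 2 r + r = 0 from the identity.\<close>

lemma orthcols_ctr:
  assumes Q: "orthcols r r Q"
  shows "orthcols r r (ctr Q)"
proof -
  let ?K = "mmul r Q (ctr Q)"
  have fI: "fro2 r r idm = real r"
  proof -
    have "fro2 r r idm = (\<Sum>i<r. \<Sum>j<r. if j = i then 1 else 0)"
      unfolding fro2_def by (intro sum.cong refl) (auto simp: idm_def)
    then show ?thesis by simp
  qed
  have fQ: "fro2 r r Q = real r"
  proof -
    have "fro2 r r Q = ip r r (mmul r (ctr Q) Q) idm"
    proof -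
      have "fro2 r r Q = ip r r Q (mmul r Q idm)"
        unfolding ip_self[symmetric] by (intro ip_cong refl mmul_idm_right[symmetric]) (auto simp: mat_eq_def)
      also have "\<dots> = ip r r (mmul r (ctr Q) Q) idm"
        using ip_mmul_left[of r r r Q idm Q] by (simp only: ip_commute)
      finally show ?thesis .
    qed
    also have "\<dots> = ip r r idm idm"
      by (intro ip_cong refl) (use Q in \<open>auto simp: orthcols_def mat_eq_def\<close>)
    finally show ?thesis by (simp add: ip_self fI)
  qed
  have "fro2 r r ?K = ip r r (ctr Q) (mmul r (ctr Q) (mmul r Q (ctr Q)))"
    by (simp only: ip_self[symmetric] ip_mmul_left)
  also have "\<dots> = ip r r (ctr Q) (ctr Q)"
    unfolding mmul_assoc[of r "ctr Q"]
    by (intro ip_cong refl mmul_idm_left) (use Q in \<open>auto simp: orthcols_def\<close>)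
  finally have fK: "fro2 r r ?K = real r" by (simp add: ip_self fro2_ctr fQ)
  have "ip r r idm ?K = ip r r (mmul r idm Q) Q"
    using ip_mmul_right[of r r r Q "ctr Q" idm] by (simp add: ip_commute)
  also have "\<dots> = ip r r Q Q" by (intro ip_cong refl mmul_idm_left) (auto simp: mat_eq_def)
  finally have "fro2 r r (msub ?K idm) = 0"
    by (simp add: fro2_msub fK fI fQ ip_self ip_commute[of r r ?K])
  then have "\<forall>i<r. \<forall>j<r. (cmod (msub ?K idm i j))\<^sup>2 = 0"
    unfolding fro2_def by (simp add: sum_nonneg_eq_0_iff sum_nonneg)
  then show ?thesis by (simp add: orthcols_def mat_eq_def msub_def)
qed

subsection \<open>One gradient step\<close>

text \<open>With A = P + S, B = P - S, and B' formed alike from P' and S', the right side equals 4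
  |A|^2 + |B - conj B'|^2. Primes mark the mirrored entry of the matrix.\<close>

lemma herm_product_bound:
  fixes P S P' S' :: complex
  assumes "P' + S' = cnj (P + S)"
  shows "0 \<le> 8 * (Re (P * S') + Re (P' * S)) + (cmod ((P - S) + cnj (P' - S')))\<^sup>2"
proof -
  have S': "S' = cnj (P + S) - P'" using assms by (simp add: algebra_simps)
  have "8 * (Re (P * S') + Re (P' * S)) + (cmod ((P - S) + cnj (P' - S')))\<^sup>2
     = 4 * (cmod (P + S))\<^sup>2 + (cmod ((P - S) - cnj (P' - S')))\<^sup>2"
    unfolding S' by (simp only: cmod_power2) (simp add: power2_eq_square algebra_simps)
  then show ?thesis by simp
qed

text \<open>Entries (i, j) and (j, i) are paired, which doubles the 8 of
  \<open>herm_product_bound\<close>. P and S will be the Gram matrices of the true factors with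
  their deviations.\<close>

lemma gauge_cross_term:
  assumes h: "\<And>i j. i < r \<Longrightarrow> j < r \<Longrightarrow> P i j + S i j = cnj (P j i + S j i)"
  shows "- fro2 r r (madd (msub P S) (ctr (msub P S))) \<le> 16 * ip r r P (ctr S)"
proof -
  let ?H = "madd (msub P S) (ctr (msub P S))"
  have ip: "ip r r P (ctr S) = (\<Sum>i<r. \<Sum>j<r. Re (P i j * S j i))"
    unfolding ip_def ctr_def by (intro sum.cong refl) simp
  have ip': "ip r r P (ctr S) = (\<Sum>i<r. \<Sum>j<r. Re (P j i * S i j))"
    unfolding ip by (rule sum.swap)
  have "16 * ip r r P (ctr S) + fro2 r r ?H
      = (\<Sum>i<r. \<Sum>j<r. 8 * (Re (P i j * S j i) + Re (P j i * S i j)) + (cmod ((P i j - S i j) + cnj (P j i - S j i)))\<^sup>2)"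
  proof -
    have "8 * ip r r P (ctr S) = (\<Sum>i<r. \<Sum>j<r. 8 * Re (P i j * S j i))"
      by (simp only: ip sum_distrib_left)
    moreover have "8 * ip r r P (ctr S) = (\<Sum>i<r. \<Sum>j<r. 8 * Re (P j i * S i j))"
      by (simp only: ip' sum_distrib_left)
    moreover have "fro2 r r ?H = (\<Sum>i<r. \<Sum>j<r. (cmod ((P i j - S i j) + cnj (P j i - S j i)))\<^sup>2)"
      by (simp add: fro2_def madd_def msub_def ctr_def)
    ultimately show ?thesis by (simp only: distrib_left sum.distrib)
  qed
  moreover have "0 \<le> \<dots>"
  proof (intro sum_nonneg)
    fix i j assume "i \<in> {..<r}" "j \<in> {..<r}"
    then have "P j i + S j i = cnj (P i j + S i j)" using h by simp
    then show "0 \<le> 8 * (Re (P i j * S j i) + Re (P j i * S i j)) + (cmod ((P i j - S i j) + cnj (P j i - S j i)))\<^sup>2"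
      by (rule herm_product_bound)
  qed
  ultimately show ?thesis by linarith
qed

lemma young: "0 < c \<Longrightarrow> 2 * ip m k A B \<le> c * fro2 m k A + fro2 m k B / c" for c :: real
proof -
  assume c: "0 < c"
  have "0 \<le> fro2 m k (msub (mscale (complex_of_real c) A) B) / c" using c by simp
  also have "fro2 m k (msub (mscale (complex_of_real c) A) B) / c = c * fro2 m k A + fro2 m k B / c - 2 * ip m k A B"
    using c by (simp add: ip_self[symmetric] ip_simps ip_commute[of m k B A] field_simps)
  finally show ?thesis by simp
qed

lemma Re_young: "0 < c \<Longrightarrow> 2 * Re (cnj a * b) \<le> c * (cmod a)\<^sup>2 + (cmod b)\<^sup>2 / c" for c :: real
proof -
  assume c: "0 < c"
  have "0 \<le> (cmod (complex_of_real c * a - b))\<^sup>2 / c" using c by simp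
  also have "(cmod (complex_of_real c * a - b))\<^sup>2 / c = c * (cmod a)\<^sup>2 + (cmod b)\<^sup>2 / c - 2 * Re (cnj a * b)"
    using c by (simp only: cmod_power2) (simp add: power2_eq_square field_simps)
  finally show ?thesis by simp
qed

text \<open>The semi-inner product of the components orthogonal to the Hankel matrices.\<close>

definition qp :: "nat \<Rightarrow> nat \<Rightarrow> cmat \<Rightarrow> cmat \<Rightarrow> real" where
  "qp n1 n2 X Y = ip n1 n2 X Y - (\<Sum>i<n1+n2-1. Re (cnj (Gadj n1 n2 X i) * Gadj n1 n2 Y i))"

lemma Gadj_mscale: "Gadj n1 n2 (mscale c A) i = c * Gadj n1 n2 A i"
  by (simp add: Gadj_adiag mscale_def case_prod_unfold sum_distrib_left)

lemma qp_commute: "qp n1 n2 X Y = qp n1 n2 Y X"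
  by (simp add: qp_def ip_commute[of n1 n2 X Y] algebra_simps)

lemma qp_madd: "qp n1 n2 (madd X Y) Z = qp n1 n2 X Z + qp n1 n2 Y Z"
  by (simp add: qp_def ip_simps Gadj_madd distrib_right sum.distrib)

lemma qp_msub: "qp n1 n2 (msub X Y) Z = qp n1 n2 X Z - qp n1 n2 Y Z"
  by (simp add: qp_def ip_simps Gadj_msub left_diff_distrib sum_subtractf)

lemma qp_mscale: "qp n1 n2 (mscale (complex_of_real c) X) Z = c * qp n1 n2 X Z"
proof -
  have "Re (cnj (Gadj n1 n2 (mscale (complex_of_real c) X) i) * Gadj n1 n2 Z i)
     = c * Re (cnj (Gadj n1 n2 X i) * Gadj n1 n2 Z i)" for i
    unfolding Gadj_mscale complex_cnj_mult complex_cnj_complex_of_real mult.assoc by simp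
  then show ?thesis by (simp add: qp_def ip_simps right_diff_distrib sum_distrib_left)
qed

lemma Re_cnj_self: "Re (cnj z * z) = (cmod z)\<^sup>2"
  by (simp only: cmod_power2) (simp add: power2_eq_square)

lemma qp_self: "qp n1 n2 X X = fro2 n1 n2 X - (\<Sum>i<n1+n2-1. (cmod (Gadj n1 n2 X i))\<^sup>2)"
  by (simp only: qp_def ip_self Re_cnj_self)

lemma qp_nonneg: "0 \<le> qp n1 n2 X X"
  using Gadj_norm_le[of n1 n2 X] by (simp add: qp_self)

lemma qp_self_le: "qp n1 n2 X X \<le> fro2 n1 n2 X"
  by (simp add: qp_self sum_nonneg)

lemma qp_madd2: "qp n1 n2 Z (madd X Y) = qp n1 n2 Z X + qp n1 n2 Z Y"
  by (simp only: qp_commute[of n1 n2 Z] qp_madd)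

lemma qp_mscale2: "qp n1 n2 Z (mscale (complex_of_real c) X) = c * qp n1 n2 Z X"
  by (simp only: qp_commute[of n1 n2 Z] qp_mscale)

lemma qp_young: "0 < c \<Longrightarrow> 2 * qp n1 n2 X Y \<le> c * qp n1 n2 X X + qp n1 n2 Y Y / c" for c :: real
proof -
  assume c: "0 < c"
  let ?Z = "madd (mscale (complex_of_real c) X) (mscale (complex_of_real (- 1)) Y)"
  have "0 \<le> qp n1 n2 ?Z ?Z / c" using c qp_nonneg[of n1 n2 ?Z] by simp
  also have "qp n1 n2 ?Z ?Z = c * (c * qp n1 n2 X X) - 2 * (c * qp n1 n2 X Y) + qp n1 n2 Y Y"
    by (simp only: qp_madd qp_madd2 qp_mscale qp_mscale2 qp_commute[of n1 n2 Y X]) (simp add: algebra_simps)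
  also have "\<dots> / c = c * qp n1 n2 X X - 2 * qp n1 n2 X Y + qp n1 n2 Y Y / c"
    using c by (simp add: field_simps)
  finally show ?thesis by simp
qed

section \<open>Deterministic estimates on a good sample\<close>

text \<open>What a good sample provides, with the probability removed. \<open>S\<close> stands for
  the root of the singular value matrix times a rotation and is known only through its singular
  values, between the roots of \<open>sr\<close> and \<open>s1\<close>; U S and V S are the aligned
  true factors. Intervals of length at least \<open>l0\<close> have controlled counts, and
  antidiagonals within \<open>l0\<close> of either end are the corners.\<close>

locale sampled_hankel =
  fixes n1 n2 r l0 :: nat and p \<nu> s1 sr :: real and \<Omega> :: "nat set" and U V S :: cmat
  assumes dims: "1 \<le> n1" "1 \<le> n2" "1 \<le> l0" "l0 \<le> n1" "l0 \<le> n2"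
    and p: "0 < p" and \<nu>: "0 \<le> \<nu>" and sr: "0 < sr" "sr \<le> s1"
    and orthU: "orthcols n1 r U" and orthV: "orthcols n2 r V"
    and rowU: "\<And>a. a < n1 \<Longrightarrow> rowsq r U a \<le> \<nu>" and rowV: "\<And>b. b < n2 \<Longrightarrow> rowsq r V b \<le> \<nu>"
    and S_up: "\<And>m A. fro2 m r (mmul r A (ctr S)) \<le> s1 * fro2 m r A"
    and S_lo: "\<And>m A. sr * fro2 m r A \<le> fro2 m r (mmul r A (ctr S))"
    and S_up': "\<And>m A. fro2 m r (mmul r A S) \<le> s1 * fro2 m r A"
    and truth_hankel: "\<And>Y. qp n1 n2 (mmul r (mmul r U S) (ctr (mmul r V S))) Y = 0"
    and \<Omega>: "\<Omega> \<subseteq> {..<n1+n2-1}"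
    and cnt: "\<And>j l. l0 \<le> l \<Longrightarrow> l \<le> n1+n2-1 \<Longrightarrow> real (card (\<Omega> \<inter> {j..<j+l})) \<le> 2 * p * real l"
    and corner: "real (card {i\<in>\<Omega>. \<not> (l0 \<le> i \<and> i + l0 < n1+n2-1)}) * \<nu> \<le> p / 1000"
    and tangent: "\<And>X Y. \<bar>(\<Sum>i\<in>\<Omega>. (cmod (Gadj n1 n2 (madd (mmul r U (ctr X)) (mmul r Y (ctr V))) i))\<^sup>2) / p
        - (\<Sum>i<n1+n2-1. (cmod (Gadj n1 n2 (madd (mmul r U (ctr X)) (mmul r Y (ctr V))) i))\<^sup>2)\<bar>
        \<le> (fro2 n2 r X + fro2 n1 r Y) / 100"
begin

definition "n = n1 + n2 - 1"
definition "Lh = mmul r U S"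
definition "Rh = mmul r V S"
definition "good = {i\<in>\<Omega>. l0 \<le> i \<and> i + l0 < n}"
definition "bad = {i\<in>\<Omega>. \<not> (l0 \<le> i \<and> i + l0 < n)}"
definition "samp J X = (\<Sum>i\<in>J. (cmod (Gadj n1 n2 X i))\<^sup>2) / p"

lemma fin\<Omega>: "finite \<Omega>" using \<Omega> finite_subset by blast
lemma fin_gb [simp]: "finite good" "finite bad" by (auto simp: good_def bad_def fin\<Omega>)
lemma good_bad: "good \<inter> bad = {}" "good \<union> bad = \<Omega>" by (auto simp: good_def bad_def)

lemma s1: "0 < s1" using sr by linarith

lemma samp_nonneg [simp]: "0 \<le> samp J X"
  using p by (simp add: samp_def sum_nonneg)

lemma samp_split: "samp \<Omega> X = samp good X + samp bad X"
proof -
  have "sum f \<Omega> = sum f good + sum f bad" for f :: "nat \<Rightarrow> real"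
    using sum.union_disjoint[OF fin_gb good_bad(1), of f] by (simp only: good_bad(2))
  then show ?thesis by (simp only: samp_def add_divide_distrib)
qed

lemma samp_madd_le: "samp J (madd X Y) \<le> 2 * samp J X + 2 * samp J Y"
proof -
  have "(\<Sum>i\<in>J. (cmod (Gadj n1 n2 (madd X Y) i))\<^sup>2)
      \<le> (\<Sum>i\<in>J. 2 * (cmod (Gadj n1 n2 X i))\<^sup>2 + 2 * (cmod (Gadj n1 n2 Y i))\<^sup>2)"
  proof (rule sum_mono)
    fix i
    have "2 * Re (cnj (Gadj n1 n2 X i) * Gadj n1 n2 Y i) \<le> (cmod (Gadj n1 n2 X i))\<^sup>2 + (cmod (Gadj n1 n2 Y i))\<^sup>2"
      using Re_young[of 1 "Gadj n1 n2 X i" "Gadj n1 n2 Y i"] by simp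
    then show "(cmod (Gadj n1 n2 (madd X Y) i))\<^sup>2 \<le> 2 * (cmod (Gadj n1 n2 X i))\<^sup>2 + 2 * (cmod (Gadj n1 n2 Y i))\<^sup>2"
      unfolding Gadj_madd cmod_add_sq by linarith
  qed
  then have "(\<Sum>i\<in>J. (cmod (Gadj n1 n2 (madd X Y) i))\<^sup>2)
      \<le> 2 * (\<Sum>i\<in>J. (cmod (Gadj n1 n2 X i))\<^sup>2) + 2 * (\<Sum>i\<in>J. (cmod (Gadj n1 n2 Y i))\<^sup>2)"
    by (simp add: sum.distrib sum_distrib_left)
  then have "samp J (madd X Y) \<le> (2 * (\<Sum>i\<in>J. (cmod (Gadj n1 n2 X i))\<^sup>2) + 2 * (\<Sum>i\<in>J. (cmod (Gadj n1 n2 Y i))\<^sup>2)) / p"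
    unfolding samp_def using p by (intro divide_right_mono) auto
  then show ?thesis by (simp add: samp_def add_divide_distrib)
qed

lemma samp_good_mmul: "samp good (mmul r A (ctr B)) \<le> 16 * (fro2 n1 r A * fro2 n2 r B)"
proof -
  have "(\<Sum>i\<in>good. (cmod (Gadj n1 n2 (mmul r A (ctr B)) i))\<^sup>2) \<le> 16 * p * (fro2 n1 r A * fro2 n2 r B)"
    unfolding good_def
    by (rule Gadj_sampled_le) (use dims p \<Omega> cnt in \<open>auto simp: n_def\<close>)
  then show ?thesis using p by (simp add: samp_def divide_le_eq mult.commute mult.left_commute)
qed

text \<open>\<beta> measures rows in units of \<nu> and \<epsilon> the index set in units of
  p/\<nu>, so that the same estimate serves the corners and the outliers.\<close>

lemma samp_sparse:
  assumes "finite J" "\<And>b. b < n2 \<Longrightarrow> rowsq r B b \<le> \<beta> * \<nu>" "real (card J) * \<nu> \<le> \<epsilon> * p" "0 \<le> \<beta>"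
  shows "samp J (mmul r A (ctr B)) \<le> \<epsilon> * \<beta> * fro2 n1 r A"
proof -
  have "(\<Sum>i\<in>J. (cmod (Gadj n1 n2 (mmul r A (ctr B)) i))\<^sup>2) \<le> real (card J) * (\<beta> * \<nu>) * fro2 n1 r A"
    by (rule Gadj_sparse_le) (use assms \<nu> in auto)
  also have "\<dots> = (real (card J) * \<nu>) * (\<beta> * fro2 n1 r A)" by (simp add: ac_simps)
  also have "\<dots> \<le> (\<epsilon> * p) * (\<beta> * fro2 n1 r A)"
    using assms by (intro mult_right_mono) auto
  finally show ?thesis using p by (simp add: samp_def divide_le_eq ac_simps)
qed

lemma samp_sparse':
  assumes "finite J" "\<And>a. a < n1 \<Longrightarrow> rowsq r A a \<le> \<beta> * \<nu>" "real (card J) * \<nu> \<le> \<epsilon> * p" "0 \<le> \<beta>"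
  shows "samp J (mmul r A (ctr B)) \<le> \<epsilon> * \<beta> * fro2 n2 r B"
proof -
  have "(\<Sum>i\<in>J. (cmod (Gadj n1 n2 (mmul r A (ctr B)) i))\<^sup>2) \<le> real (card J) * (\<beta> * \<nu>) * fro2 n2 r B"
    by (rule Gadj_sparse_le') (use assms \<nu> in auto)
  also have "\<dots> = (real (card J) * \<nu>) * (\<beta> * fro2 n2 r B)" by (simp add: ac_simps)
  also have "\<dots> \<le> (\<epsilon> * p) * (\<beta> * fro2 n2 r B)"
    using assms by (intro mult_right_mono) auto
  finally show ?thesis using p by (simp add: samp_def divide_le_eq ac_simps)
qed

lemma bad_card: "real (card bad) * \<nu> \<le> (1/1000) * p"
  using corner by (simp add: bad_def n_def)

lemma row_truth: "a < n1 \<Longrightarrow> rowsq r Lh a \<le> s1 * \<nu>" "b < n2 \<Longrightarrow> rowsq r Rh b \<le> s1 * \<nu>"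
proof -
  have e: "rowsq r (mmul r W S) a \<le> s1 * rowsq r W a" for W a
    using S_up'[of 1 "\<lambda>_ j. W a j"] by (simp add: fro2_def rowsq_def mmul_def)
  show "a < n1 \<Longrightarrow> rowsq r Lh a \<le> s1 * \<nu>"
    using e[of U a] rowU[of a] s1 by (simp add: Lh_def mult_left_mono order_trans)
  show "b < n2 \<Longrightarrow> rowsq r Rh b \<le> s1 * \<nu>"
    using e[of V b] rowV[of b] s1 by (simp add: Rh_def mult_left_mono order_trans)
qed

text \<open>Moving S to the other factor exhibits the product as a tangent vector in the form
  required by \<open>tangent\<close>; its size is then that of A times the adjoint of S, and no
  singular value is given away.\<close>

lemma A_Rh: "mmul r A (ctr Rh) = mmul r (mmul r A (ctr S)) (ctr V)"
  by (simp only: Rh_def ctr_mmul mmul_assoc)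

lemma Lh_B: "mmul r Lh (ctr B) = mmul r U (ctr (mmul r B (ctr S)))"
  by (simp only: Lh_def ctr_mmul mmul_assoc ctr_ctr)

lemma fro2_A_Rh: "fro2 m n2 (mmul r A (ctr Rh)) = fro2 m r (mmul r A (ctr S))"
  unfolding A_Rh by (rule fro2_mmul_orth_right) (simp add: orthV)

lemma fro2_Lh_B: "fro2 n1 m (mmul r Lh (ctr B)) = fro2 m r (mmul r B (ctr S))"
proof -
  have "fro2 n1 m (mmul r Lh (ctr B)) = fro2 r m (ctr (mmul r B (ctr S)))"
    unfolding Lh_B by (rule fro2_mmul_orth_left[OF orthU])
  then show ?thesis by (simp only: fro2_ctr)
qed

lemma tangent_samp:
  "\<bar>samp \<Omega> (madd (mmul r A (ctr Rh)) (mmul r Lh (ctr B)))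
    - (\<Sum>i<n. (cmod (Gadj n1 n2 (madd (mmul r A (ctr Rh)) (mmul r Lh (ctr B))) i))\<^sup>2)\<bar>
   \<le> (fro2 n1 r (mmul r A (ctr S)) + fro2 n2 r (mmul r B (ctr S))) / 100"
proof -
  have "madd X Y = madd Y X" for X Y by (simp add: madd_def add.commute)
  then show ?thesis
    using tangent[of "mmul r B (ctr S)" "mmul r A (ctr S)"]
    unfolding A_Rh Lh_B samp_def n_def by (simp add: add.commute)
qed

lemma mmul_zero [simp]: "mmul r (\<lambda>_ _. 0) X = (\<lambda>_ _. 0)" "mmul r X (ctr (\<lambda>_ _. 0)) = (\<lambda>_ _. 0)"
  by (simp_all add: mmul_def ctr_def)

lemma madd_zero [simp]: "madd X (\<lambda>_ _. 0) = X" "madd (\<lambda>_ _. 0) X = X"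
  by (simp_all add: madd_def)

lemma fro2_zero [simp]: "fro2 m k (\<lambda>_ _. 0) = 0"
  by (simp add: fro2_def)

lemma samp_A_Rh: "samp \<Omega> (mmul r A (ctr Rh)) \<le> 101/100 * s1 * fro2 n1 r A"
proof -
  have "samp \<Omega> (mmul r A (ctr Rh)) \<le> (\<Sum>i<n. (cmod (Gadj n1 n2 (mmul r A (ctr Rh)) i))\<^sup>2) + fro2 n1 r (mmul r A (ctr S)) / 100"
    using abs_le_D1[OF tangent_samp[of A "\<lambda>_ _. 0"]] by simp
  also have "\<dots> \<le> 101/100 * fro2 n1 r (mmul r A (ctr S))"
    using Gadj_norm_le[of n1 n2 "mmul r A (ctr Rh)"] by (simp add: fro2_A_Rh n_def)
  also have "\<dots> \<le> 101/100 * s1 * fro2 n1 r A" using S_up[of n1 A] by simp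
  finally show ?thesis .
qed

lemma samp_Lh_B: "samp \<Omega> (mmul r Lh (ctr B)) \<le> 101/100 * s1 * fro2 n2 r B"
proof -
  have "samp \<Omega> (mmul r Lh (ctr B)) \<le> (\<Sum>i<n. (cmod (Gadj n1 n2 (mmul r Lh (ctr B)) i))\<^sup>2) + fro2 n2 r (mmul r B (ctr S)) / 100"
    using abs_le_D1[OF tangent_samp[of "\<lambda>_ _. 0" B]] by simp
  also have "\<dots> \<le> 101/100 * fro2 n2 r (mmul r B (ctr S))"
    using Gadj_norm_le[of n1 n2 "mmul r Lh (ctr B)"] by (simp add: fro2_Lh_B n_def)
  also have "\<dots> \<le> 101/100 * s1 * fro2 n2 r B" using S_up[of n2 B] by simp
  finally show ?thesis .
qed

end

section \<open>Descent and smoothness of the loss at one iterate\<close>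

text \<open>One iterate, aligned with the truth. On the sample the residual \<open>e\<close> is the
  error of the product plus the error \<open>N\<close> of the outlier estimate, which lives on the
  few indices \<open>J\<close>. \<open>gauge\<close> is the first-order condition of the alignment
  and \<open>near\<close> the basin of attraction.\<close>

locale hankel_step = sampled_hankel +
  fixes L R :: cmat and e N :: cvec and J :: "nat set"
  assumes rowL: "\<And>a. a < n1 \<Longrightarrow> rowsq r L a \<le> 3 * s1 * \<nu>" and rowR: "\<And>b. b < n2 \<Longrightarrow> rowsq r R b \<le> 3 * s1 * \<nu>"
    and near: "fro2 n1 r (msub L (mmul r U S)) + fro2 n2 r (msub R (mmul r V S)) \<le> sr / 10000"
    and gauge: "\<And>i j. i < r \<Longrightarrow> j < r \<Longrightarrow>
        mmul n1 (ctr (mmul r U S)) (msub L (mmul r U S)) i j + mmul n2 (ctr (mmul r V S)) (msub R (mmul r V S)) i j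
      = cnj (mmul n1 (ctr (mmul r U S)) (msub L (mmul r U S)) j i + mmul n2 (ctr (mmul r V S)) (msub R (mmul r V S)) j i)"
    and e: "\<And>i. i \<in> \<Omega> \<Longrightarrow> e i = Gadj n1 n2 (msub (mmul r L (ctr R)) (mmul r (mmul r U S) (ctr (mmul r V S)))) i + N i"
    and J: "J \<subseteq> \<Omega>" "real (card J) * \<nu> * s1 \<le> p * sr / 1000"
    and N0: "\<And>i. i \<in> \<Omega> \<Longrightarrow> i \<notin> J \<Longrightarrow> N i = 0"
    and N: "(\<Sum>i\<in>J. (cmod (N i))\<^sup>2)
      \<le> 3 * (\<Sum>i\<in>J. (cmod (Gadj n1 n2 (msub (mmul r L (ctr R)) (mmul r (mmul r U S) (ctr (mmul r V S)))) i))\<^sup>2)"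
begin

definition "dL = msub L Lh"
definition "dR = msub R Rh"
definition "d2 = fro2 n1 r dL + fro2 n2 r dR"
definition "M = msub (mmul r L (ctr R)) (mmul r Lh (ctr Rh))"
definition "T = madd (mmul r dL (ctr Rh)) (mmul r Lh (ctr dR))"
definition "D = mmul r dL (ctr dR)"
text \<open>The sum of the squared norms of the two tangent components, hence between
  \<open>sr\<close> and \<open>s1\<close> times \<open>d2\<close>. It is the yardstick of all
  estimates below.\<close>

definition "T2 = fro2 n1 r (mmul r dL (ctr S)) + fro2 n2 r (mmul r dR (ctr S))"
text \<open>The imbalance of the factors is \<open>H\<close> to first order, twice the Hermitian
  part of \<open>W\<close>, plus the quadratic \<open>F\<close>; see \<open>bal_eq\<close>.\<close>

definition "W = msub (mmul n1 (ctr Lh) dL) (mmul n2 (ctr Rh) dR)"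
definition "H = madd W (ctr W)"
definition "F = msub (mmul n1 (ctr dL) dL) (mmul n2 (ctr dR) dR)"

lemma L_eq: "L = madd Lh dL" and R_eq: "R = madd Rh dR"
  by (simp_all add: dL_def dR_def madd_def msub_def)

lemma M_eq: "M = madd T D"
proof -
  have "msub (mmul r (madd Lh dL) (ctr (madd Rh dR))) (mmul r Lh (ctr Rh)) = madd T D"
    unfolding T_def D_def
    by (simp add: ctr_madd mmul_madd_left mmul_madd_right) (simp add: madd_def msub_def fun_eq_iff)
  then show ?thesis by (simp only: M_def L_eq[symmetric] R_eq[symmetric])
qed

lemma M_eq': "M = madd (mmul r dL (ctr R)) (mmul r Lh (ctr dR))"
proof -
  have "msub (mmul r (madd Lh dL) (ctr (madd Rh dR))) (mmul r Lh (ctr Rh))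
      = madd (mmul r dL (ctr (madd Rh dR))) (mmul r Lh (ctr dR))"
    by (simp add: ctr_madd mmul_madd_left mmul_madd_right) (simp add: madd_def msub_def fun_eq_iff)
  then show ?thesis by (simp only: M_def L_eq[symmetric] R_eq[symmetric])
qed

text \<open>The derivative of the product along the deviation. It is T + 2 D while the error is T +
  D, which produces t^2 + 3 t d + 2 d^2 at each index.\<close>

definition "Y0 = madd (mmul r dL (ctr R)) (mmul r L (ctr dR))"

lemma Y0_eq: "Y0 = madd T (madd D D)"
proof -
  have "madd (mmul r dL (ctr (madd Rh dR))) (mmul r (madd Lh dL) (ctr dR)) = madd T (madd D D)"
    unfolding T_def D_def
    by (simp add: ctr_madd mmul_madd_left mmul_madd_right) (simp add: madd_def msub_def fun_eq_iff)
  then show ?thesis by (simp only: Y0_def L_eq[symmetric] R_eq[symmetric])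
qed

text \<open>The true factors are balanced, both Gram matrices being that of S, so only terms in the
  deviations survive.\<close>

lemma bal_eq: "i < r \<Longrightarrow> j < r \<Longrightarrow> balE n1 n2 L R i j = madd H F i j"
proof -
  assume ij: "i < r" "j < r"
  have e: "mmul m (ctr (mmul r X S)) (mmul r X S) i j = mmul r (ctr S) S i j" if "orthcols m r X" for X m
  proof -
    have "mmul m (ctr (mmul r X S)) (mmul r X S) i j = mmul r (ctr S) (mmul r (mmul m (ctr X) X) S) i j"
      by (simp only: ctr_mmul mmul_assoc)
    also have "\<dots> = mmul r (ctr S) S i j"
      unfolding mmul_def[of r "ctr S"] using that
      by (intro sum.cong refl arg_cong2[of _ _ _ _ "(*)"] mmul_idm_left) (auto simp: orthcols_def)
    finally show ?thesis .
  qed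
  have b: "mmul n1 (ctr Lh) Lh i j = mmul n2 (ctr Rh) Rh i j"
    unfolding Lh_def Rh_def e[OF orthU] e[OF orthV] ..
  have "balE n1 n2 (madd Lh dL) (madd Rh dR) i j = madd H F i j"
    unfolding balE_def H_def W_def F_def
    by (simp add: ctr_madd ctr_msub ctr_mmul mmul_madd_left mmul_madd_right) (simp add: madd_def msub_def b)
  then show ?thesis by (simp only: L_eq[symmetric] R_eq[symmetric])
qed

lemma d2_nonneg: "0 \<le> d2" by (simp add: d2_def)

lemma d2_small: "d2 \<le> sr / 10000"
  using near by (simp add: d2_def dL_def dR_def Lh_def Rh_def)

lemma dLR: "fro2 n1 r dL \<le> d2" "fro2 n2 r dR \<le> d2" by (simp_all add: d2_def)

lemma T2_lower: "sr * d2 \<le> T2"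
  using S_lo[of n1 dL] S_lo[of n2 dR] by (simp add: d2_def T2_def distrib_left)

lemma T2_nonneg: "0 \<le> T2" by (simp add: T2_def)

text \<open>Closeness to the truth makes second-order terms a fixed small fraction of
  \<open>T2\<close>, free of the condition number.\<close>

lemma d4: "d2 * d2 \<le> T2 / 10000"
proof -
  have "d2 * d2 \<le> sr / 10000 * d2" by (rule mult_right_mono[OF d2_small d2_nonneg])
  then show ?thesis using T2_lower by simp
qed

lemma fro2_T_le: "fro2 n1 n2 T \<le> 2 * T2"
proof -
  have "fro2 n1 n2 T \<le> 2 * fro2 n1 n2 (mmul r dL (ctr Rh)) + 2 * fro2 n1 n2 (mmul r Lh (ctr dR))"
    unfolding T_def by (rule fro2_madd_le)
  then show ?thesis by (simp add: fro2_A_Rh fro2_Lh_B T2_def)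
qed

text \<open>The Procrustes alignment makes \<open>Lh\<^sup>* dL + Rh\<^sup>* dR\<close> Hermitian; hence the cross term is
  nonnegative up to the imbalance \<open>H\<close>.\<close>

lemma fro2_T_ge: "T2 - fro2 r r H / 8 \<le> fro2 n1 n2 T"
proof -
  have "ip n1 n2 (mmul r dL (ctr Rh)) (mmul r Lh (ctr dR))
      = ip n1 n2 (mmul r Lh (ctr dR)) (mmul r dL (ctr Rh))" by (rule ip_commute)
  also have "\<dots> = ip r n2 (ctr dR) (mmul r (mmul n1 (ctr Lh) dL) (ctr Rh))"
    by (simp only: ip_mmul_left mmul_assoc)
  also have "\<dots> = ip r n2 (mmul r (mmul n1 (ctr Lh) dL) (ctr Rh)) (ctr dR)" by (rule ip_commute)
  also have "\<dots> = ip r r (mmul n1 (ctr Lh) dL) (ctr (mmul n2 (ctr Rh) dR))"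
    by (simp only: ip_mmul_right ctr_mmul ctr_ctr)
  finally have "ip n1 n2 (mmul r dL (ctr Rh)) (mmul r Lh (ctr dR))
      = ip r r (mmul n1 (ctr Lh) dL) (ctr (mmul n2 (ctr Rh) dR))" .
  moreover have "- fro2 r r H \<le> 16 * ip r r (mmul n1 (ctr Lh) dL) (ctr (mmul n2 (ctr Rh) dR))"
    unfolding H_def W_def
    by (rule gauge_cross_term) (rule gauge[folded Lh_def Rh_def, folded dL_def dR_def])
  ultimately show ?thesis
    unfolding T_def fro2_madd by (simp add: fro2_A_Rh fro2_Lh_B T2_def)
qed

lemma fro2_D: "fro2 n1 n2 D \<le> T2 / 10000"
proof -
  have "fro2 n1 n2 D \<le> fro2 n1 r dL * fro2 n2 r dR" unfolding D_def by (rule fro2_mmul_ctr_le)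
  also have "\<dots> \<le> d2 * d2" by (intro mult_mono dLR d2_nonneg) auto
  finally show ?thesis using d4 by linarith
qed

lemma samp_good_D: "samp good D \<le> 16 * (T2 / 10000)"
proof -
  have "samp good D \<le> 16 * (fro2 n1 r dL * fro2 n2 r dR)" unfolding D_def by (rule samp_good_mmul)
  also have "fro2 n1 r dL * fro2 n2 r dR \<le> d2 * d2" by (intro mult_mono dLR d2_nonneg) auto
  finally show ?thesis using d4 by linarith
qed

lemma samp_bad_T: "samp bad T \<le> T2 / 500"
proof -
  have "samp bad (mmul r dL (ctr Rh)) \<le> 1/1000 * 1 * fro2 n1 r (mmul r dL (ctr S))"
    unfolding A_Rh by (rule samp_sparse[OF _ _ bad_card]) (use rowV in auto)
  moreover have "samp bad (mmul r Lh (ctr dR)) \<le> 1/1000 * 1 * fro2 n2 r (mmul r dR (ctr S))"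
    unfolding Lh_B by (rule samp_sparse'[OF _ _ bad_card]) (use rowU in auto)
  ultimately show ?thesis
    using samp_madd_le[of bad "mmul r dL (ctr Rh)" "mmul r Lh (ctr dR)"] by (simp add: T_def T2_def)
qed

lemma samp_T: "\<bar>samp \<Omega> T - (\<Sum>i<n. (cmod (Gadj n1 n2 T i))\<^sup>2)\<bar> \<le> T2 / 100"
  unfolding T_def T2_def by (rule tangent_samp)

lemma J_card: "real (card J) * \<nu> \<le> (sr / (1000 * s1)) * p"
  using J(2) s1 by (simp add: field_simps)

lemma finJ: "finite J" using J(1) fin\<Omega> finite_subset by blast

text \<open>The row bound of R carries \<open>s1\<close> and the size of \<open>J\<close> carries
  \<open>sr\<close> / \<open>s1\<close>. Their product is of order \<open>sr\<close>, hence
  comparable with \<open>T2\<close> when A is the deviation.\<close>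

lemma samp_J_R: "samp J (mmul r A (ctr R)) \<le> 3 * sr / 1000 * fro2 n1 r A"
proof -
  have "samp J (mmul r A (ctr R)) \<le> (sr / (1000 * s1)) * (3 * s1) * fro2 n1 r A"
    by (rule samp_sparse[OF finJ _ J_card]) (use rowR s1 in auto)
  then show ?thesis using s1 by simp
qed

lemma samp_J_L: "samp J (mmul r L (ctr B)) \<le> 3 * sr / 1000 * fro2 n2 r B"
proof -
  have "samp J (mmul r L (ctr B)) \<le> (sr / (1000 * s1)) * (3 * s1) * fro2 n2 r B"
    by (rule samp_sparse'[OF finJ _ J_card]) (use rowL s1 in auto)
  then show ?thesis using s1 by simp
qed

lemma samp_J_Lh: "samp J (mmul r Lh (ctr B)) \<le> sr / 1000 * fro2 n2 r B"
proof -
  have "samp J (mmul r Lh (ctr B)) \<le> (sr / (1000 * s1)) * s1 * fro2 n2 r B"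
    by (rule samp_sparse'[OF finJ _ J_card]) (use row_truth s1 in auto)
  then show ?thesis using s1 by simp
qed

lemma samp_J_Y0: "samp J Y0 \<le> 6 * T2 / 1000"
  using samp_madd_le[of J "mmul r dL (ctr R)" "mmul r L (ctr dR)"] samp_J_R[of dL] samp_J_L[of dR] T2_lower
  by (simp add: Y0_def d2_def distrib_left)

lemma samp_J_M: "samp J M \<le> 6 * T2 / 1000"
proof -
  have "sr / 1000 * fro2 n2 r dR \<le> 3 * sr / 1000 * fro2 n2 r dR" using sr by (intro mult_right_mono) auto
  then show ?thesis
    using samp_madd_le[of J "mmul r dL (ctr R)" "mmul r Lh (ctr dR)"] samp_J_R[of dL] samp_J_Lh[of dR] T2_lower
    by (simp add: M_eq' d2_def distrib_left)
qed

lemma N_le: "(\<Sum>i\<in>\<Omega>. (cmod (N i))\<^sup>2) / p \<le> 18 * T2 / 1000"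
proof -
  have "(\<Sum>i\<in>\<Omega>. (cmod (N i))\<^sup>2) = (\<Sum>i\<in>J. (cmod (N i))\<^sup>2)"
    by (rule sum.mono_neutral_right) (use N0 J fin\<Omega> in auto)
  also have "\<dots> \<le> 3 * (\<Sum>i\<in>J. (cmod (Gadj n1 n2 M i))\<^sup>2)"
    using N by (simp add: M_def Lh_def Rh_def)
  finally have "(\<Sum>i\<in>\<Omega>. (cmod (N i))\<^sup>2) / p \<le> 3 * samp J M"
    unfolding samp_def using p by (simp add: divide_right_mono)
  then show ?thesis using samp_J_M by linarith
qed

text \<open>The gradient paired with a direction, by \<open>grad_form\<close>. The direction
  \<open>(dL, dR)\<close> yields descent; the gradient as its own direction yields its squared
  norm.\<close>

definition "form A B = (\<Sum>i\<in>\<Omega>. Re (cnj (e i) * Gadj n1 n2 (madd (mmul r A (ctr R)) (mmul r L (ctr B))) i)) / p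
    + qp n1 n2 M (madd (mmul r A (ctr R)) (mmul r L (ctr B)))
    + 1/16 * ip r r (madd H F) (msub (mmul n1 (ctr L) A) (mmul n2 (ctr R) B))"

lemma e_M: "i \<in> \<Omega> \<Longrightarrow> e i = Gadj n1 n2 M i + N i"
  using e by (simp add: M_def Lh_def Rh_def)

lemma F_le: "fro2 r r F \<le> 4 * T2 / 10000"
proof -
  have "fro2 r r F \<le> 2 * (fro2 n1 r dL * fro2 n1 r dL) + 2 * (fro2 n2 r dR * fro2 n2 r dR)"
    unfolding F_def
    by (rule order_trans[OF fro2_msub_le]) (intro add_mono mult_left_mono fro2_ctr_mmul_le, auto)
  also have "\<dots> \<le> 2 * (d2 * d2) + 2 * (d2 * d2)"
    by (intro add_mono mult_left_mono mult_mono dLR d2_nonneg) auto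
  finally show ?thesis using d4 by linarith
qed

text \<open>On the corner samples the term quadratic in \<open>D\<close> is kept: it has a favourable sign and
  absorbs the cross term, so no bound on it (which would involve the condition number) is needed.\<close>

lemma descent: "T2 / 64 + samp \<Omega> D + fro2 r r H / 128 \<le> form dL dR"
proof -
  let ?t = "Gadj n1 n2 T" and ?d = "Gadj n1 n2 D"
  have Y: "madd (mmul r dL (ctr R)) (mmul r L (ctr dR)) = Y0" by (simp add: Y0_def)
  have Mi: "Gadj n1 n2 M i = ?t i + ?d i" for i by (simp add: M_eq Gadj_madd)
  have Yi: "Gadj n1 n2 Y0 i = ?t i + (?d i + ?d i)" for i by (simp add: Y0_eq Gadj_madd)
  define q where "q i = Re (cnj (?t i + ?d i) * (?t i + (?d i + ?d i)))" for i
  have prod: "q i = (cmod (?t i))\<^sup>2 + 3 * Re (cnj (?t i) * ?d i) + 2 * (cmod (?d i))\<^sup>2" for i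
    unfolding q_def by (simp only: cmod_power2) (simp add: power2_eq_square algebra_simps)
  \<comment> \<open>Young's inequality with weight 1/6 here and 3/2 in the next fact: the former
    spends d^2, which is small on good samples, the latter spends t^2, which is small at the
    corners.\<close>
  have g: "3/4 * (cmod (?t i))\<^sup>2 - 7 * (cmod (?d i))\<^sup>2 \<le> q i" for i
    using Re_young[of "1/6" "- ?t i" "?d i"] unfolding prod by simp
  have b: "(cmod (?d i))\<^sup>2 - 5/4 * (cmod (?t i))\<^sup>2 \<le> q i" for i
    using Re_young[of "3/2" "- ?t i" "?d i"] unfolding prod by simp
  have G: "3/4 * samp good T - 7 * samp good D \<le> (\<Sum>i\<in>good. q i) / p"
  proof -
    have "3/4 * samp good T - 7 * samp good D = (\<Sum>i\<in>good. 3/4 * (cmod (?t i))\<^sup>2 - 7 * (cmod (?d i))\<^sup>2) / p"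
      by (simp only: samp_def sum_subtractf sum_distrib_left[symmetric] diff_divide_distrib times_divide_eq_right)
    also have "\<dots> \<le> (\<Sum>i\<in>good. q i) / p"
      using p by (intro divide_right_mono sum_mono g) auto
    finally show ?thesis .
  qed
  have B: "samp bad D - 5/4 * samp bad T \<le> (\<Sum>i\<in>bad. q i) / p"
  proof -
    have "samp bad D - 5/4 * samp bad T = (\<Sum>i\<in>bad. (cmod (?d i))\<^sup>2 - 5/4 * (cmod (?t i))\<^sup>2) / p"
      by (simp only: samp_def sum_subtractf sum_distrib_left[symmetric] diff_divide_distrib times_divide_eq_right)
    also have "\<dots> \<le> (\<Sum>i\<in>bad. q i) / p"
      using p by (intro divide_right_mono sum_mono b) auto
    finally show ?thesis .
  qed
  have split: "sum f \<Omega> = sum f good + sum f bad" for f :: "nat \<Rightarrow> real"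
    using sum.union_disjoint[OF fin_gb good_bad(1), of f] by (simp only: good_bad(2))
  \<comment> \<open>One copy of \<open>samp good D\<close> is added and subtracted, so that the full
    sampled energy of \<open>D\<close> stands with a positive sign; it later pays for the same
    energy in the squared gradient.\<close>
  have data: "3/4 * samp \<Omega> T - 8 * samp good D + samp \<Omega> D - 2 * samp bad T
      \<le> (\<Sum>i\<in>\<Omega>. q i) / p"
  proof -
    have "3/4 * a - 7 * b \<le> x \<Longrightarrow> c - 5/4 * d \<le> y \<Longrightarrow> 3/4 * (a + d) - 8 * b + (b + c) - 2 * d \<le> x + y"
      for a b c d x y :: real by argo
    from this[OF G B] show ?thesis unfolding samp_split[of T] samp_split[of D] split add_divide_distrib .
  qed
  \<comment> \<open>The outlier error meets \<open>Y0\<close> on \<open>J\<close> only; 12/1000 is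
    the mean of 18/1000 and 6/1000.\<close>
  have noise: "- 12 * T2 / 1000 \<le> (\<Sum>i\<in>\<Omega>. Re (cnj (N i) * Gadj n1 n2 Y0 i)) / p"
  proof -
    have "(\<Sum>i\<in>\<Omega>. Re (cnj (N i) * Gadj n1 n2 Y0 i)) = (\<Sum>i\<in>J. Re (cnj (N i) * Gadj n1 n2 Y0 i))"
      by (rule sum.mono_neutral_right) (use N0 J fin\<Omega> in auto)
    moreover have "(\<Sum>i\<in>J. - ((cmod (N i))\<^sup>2 + (cmod (Gadj n1 n2 Y0 i))\<^sup>2) / 2) \<le> (\<Sum>i\<in>J. Re (cnj (N i) * Gadj n1 n2 Y0 i))"
    proof (rule sum_mono)
      fix i show "- ((cmod (N i))\<^sup>2 + (cmod (Gadj n1 n2 Y0 i))\<^sup>2) / 2 \<le> Re (cnj (N i) * Gadj n1 n2 Y0 i)"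
        using Re_young[of 1 "- N i" "Gadj n1 n2 Y0 i"] by simp
    qed
    ultimately have "(\<Sum>i\<in>J. - ((cmod (N i))\<^sup>2 + (cmod (Gadj n1 n2 Y0 i))\<^sup>2) / 2) / p
        \<le> (\<Sum>i\<in>\<Omega>. Re (cnj (N i) * Gadj n1 n2 Y0 i)) / p"
      using p by (simp add: divide_right_mono)
    moreover have "(\<Sum>i\<in>J. - ((cmod (N i))\<^sup>2 + (cmod (Gadj n1 n2 Y0 i))\<^sup>2) / 2) / p
        = - ((\<Sum>i\<in>J. (cmod (N i))\<^sup>2) / p + samp J Y0) / 2"
      by (simp add: samp_def sum_negf sum.distrib add_divide_distrib diff_divide_distrib sum_divide_distrib[symmetric] sum_subtractf)
    moreover have "(\<Sum>i\<in>J. (cmod (N i))\<^sup>2) / p \<le> (\<Sum>i\<in>\<Omega>. (cmod (N i))\<^sup>2) / p"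
      using p J fin\<Omega> by (intro divide_right_mono sum_mono2) auto
    ultimately show ?thesis using N_le samp_J_Y0 by argo
  qed
  have perp: "3/4 * qp n1 n2 T T - 7 * (T2 / 10000) \<le> qp n1 n2 M Y0"
  proof -
    have "qp n1 n2 M Y0 = qp n1 n2 T T + 3 * qp n1 n2 T D + 2 * qp n1 n2 D D"
      by (simp add: M_eq Y0_eq qp_madd qp_madd2 qp_commute[of n1 n2 D T])
    moreover have "2 * qp n1 n2 (mscale (complex_of_real (- 1)) T) D \<le> 1/6 * qp n1 n2 (mscale (complex_of_real (- 1)) T) (mscale (complex_of_real (- 1)) T) + qp n1 n2 D D / (1/6)"
      by (rule qp_young) simp
    then have "- 2 * qp n1 n2 T D \<le> 1/6 * qp n1 n2 T T + 6 * qp n1 n2 D D"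
      by (simp only: qp_mscale qp_mscale2) simp
    moreover have "qp n1 n2 D D \<le> T2 / 10000" using qp_self_le[of n1 n2 D] fro2_D by linarith
    ultimately show ?thesis by linarith
  qed
  have bal: "fro2 r r H / 64 - T2 / 10000 \<le> 1/16 * ip r r (madd H F) (msub (mmul n1 (ctr L) dL) (mmul n2 (ctr R) dR))"
  proof -
    have WF: "msub (mmul n1 (ctr L) dL) (mmul n2 (ctr R) dR) = madd W F"
    proof -
      have "msub (mmul n1 (ctr (madd Lh dL)) dL) (mmul n2 (ctr (madd Rh dR)) dR) = madd W F"
        unfolding W_def F_def by (simp add: ctr_madd mmul_madd_left) (simp add: madd_def msub_def fun_eq_iff)
      then show ?thesis by (simp only: L_eq[symmetric] R_eq[symmetric])
    qed
    have ctrH: "ctr H = H" unfolding H_def by (simp add: ctr_madd) (simp add: madd_def add.commute)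
    have ctrF: "ctr F = F" unfolding F_def by (simp add: ctr_msub ctr_mmul)
    \<comment> \<open>Against a Hermitian matrix only the Hermitian part of \<open>W\<close>
      counts.\<close>
    have W2: "2 * ip r r X W = ip r r X H" if "ctr X = X" for X
    proof -
      have "ip r r X (ctr W) = ip r r X W" using ip_ctr[of r r X W] that by simp
      then show ?thesis unfolding H_def ip_simps by simp
    qed
    have "ip r r (madd H F) (madd W F) = fro2 r r H / 2 + 3/2 * ip r r H F + fro2 r r F"
      using W2[OF ctrH] W2[OF ctrF] by (simp add: ip_simps ip_self ip_commute[of r r F H])
    moreover have "2 * ip r r (mscale (complex_of_real (- 1)) H) F \<le> 1/3 * fro2 r r (mscale (complex_of_real (- 1)) H) + fro2 r r F / (1/3)"
      by (rule young) simp
    then have "- 2 * ip r r H F \<le> 1/3 * fro2 r r H + 3 * fro2 r r F"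
      by (simp only: ip_self[symmetric] ip_mscale_left ip_mscale_right) simp
    ultimately show ?thesis unfolding WF using F_le T2_nonneg by linarith
  qed
  have "form dL dR = (\<Sum>i\<in>\<Omega>. q i) / p
     + (\<Sum>i\<in>\<Omega>. Re (cnj (N i) * Gadj n1 n2 Y0 i)) / p + qp n1 n2 M Y0
     + 1/16 * ip r r (madd H F) (msub (mmul n1 (ctr L) dL) (mmul n2 (ctr R) dR))"
  proof -
    have "(\<Sum>i\<in>\<Omega>. Re (cnj (e i) * Gadj n1 n2 Y0 i))
       = (\<Sum>i\<in>\<Omega>. q i + Re (cnj (N i) * Gadj n1 n2 Y0 i))"
    proof (intro sum.cong refl)
      fix i assume "i \<in> \<Omega>"
      then have "cnj (e i) = cnj (?t i + ?d i) + cnj (N i)" by (simp add: e_M Mi)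
      then show "Re (cnj (e i) * Gadj n1 n2 Y0 i)
          = q i + Re (cnj (N i) * Gadj n1 n2 Y0 i)"
        by (simp only: q_def distrib_right plus_complex.sel Yi)
    qed
    then show ?thesis unfolding form_def Y by (simp add: sum.distrib add_divide_distrib)
  qed
  moreover have "fro2 n1 n2 T = qp n1 n2 T T + (\<Sum>i<n. (cmod (?t i))\<^sup>2)" by (simp add: qp_self n_def)
  \<comment> \<open>Origin of 1/64: with \<lambda> = 1/16 the imbalance is available with weight
    1/64 only, and half of that is to remain. So merely 1/16 of |T|^2 is traded for
    \<open>T2\<close> minus |H|^2/8; the resulting \<open>T2\<close>/16 exceeds the losses, about
    0.037 \<open>T2\<close> in all, by more than \<open>T2\<close>/64.\<close>
  ultimately show ?thesis
    using data noise perp bal samp_T samp_good_D samp_bad_T fro2_T_ge fro2_nonneg[of r r H] fro2_nonneg[of n1 n2 T] T2_nonneg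
    by linarith
qed

lemma row_dLR: "a < n1 \<Longrightarrow> rowsq r dL a \<le> 8 * s1 * \<nu>" "b < n2 \<Longrightarrow> rowsq r dR b \<le> 8 * s1 * \<nu>"
proof -
  show "a < n1 \<Longrightarrow> rowsq r dL a \<le> 8 * s1 * \<nu>"
    using rowsq_msub_le[of r L Lh a] rowL[of a] row_truth(1)[of a] by (simp add: dL_def)
  show "b < n2 \<Longrightarrow> rowsq r dR b \<le> 8 * s1 * \<nu>"
    using rowsq_msub_le[of r R Rh b] rowR[of b] row_truth(2)[of b] by (simp add: dR_def)
qed

lemma fro2_A_dR: "fro2 m n2 (mmul r A (ctr dR)) \<le> s1 / 10000 * fro2 m r A"
proof -
  have "fro2 m n2 (mmul r A (ctr dR)) \<le> fro2 m r A * fro2 n2 r dR" by (rule fro2_mmul_ctr_le)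
  also have "\<dots> \<le> fro2 m r A * (s1 / 10000)"
    using dLR(2) d2_small sr by (intro mult_left_mono) auto
  finally show ?thesis by (simp add: mult.commute)
qed

lemma fro2_dL_B: "fro2 n1 m (mmul r dL (ctr B)) \<le> s1 / 10000 * fro2 m r B"
proof -
  have "fro2 n1 m (mmul r dL (ctr B)) \<le> fro2 n1 r dL * fro2 m r B" by (rule fro2_mmul_ctr_le)
  also have "\<dots> \<le> (s1 / 10000) * fro2 m r B"
    using dLR(1) d2_small sr by (intro mult_right_mono) auto
  finally show ?thesis .
qed

lemma fro2_A_R: "fro2 n1 n2 (mmul r A (ctr R)) \<le> 4 * s1 * fro2 n1 r A"
proof -
  have "mmul r A (ctr (madd Rh dR)) = madd (mmul r A (ctr Rh)) (mmul r A (ctr dR))"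
    by (simp add: ctr_madd mmul_madd_right)
  then have "fro2 n1 n2 (mmul r A (ctr R)) \<le> 2 * fro2 n1 n2 (mmul r A (ctr Rh)) + 2 * fro2 n1 n2 (mmul r A (ctr dR))"
    using fro2_madd_le[of n1 n2 "mmul r A (ctr Rh)" "mmul r A (ctr dR)"] by (simp only: R_eq[symmetric])
  moreover have "0 \<le> s1 * fro2 n1 r A" using s1 by simp
  ultimately show ?thesis using S_up[of n1 A] fro2_A_dR[of n1 A] by (simp add: fro2_A_Rh)
qed

lemma fro2_L_B: "fro2 n1 n2 (mmul r L (ctr B)) \<le> 4 * s1 * fro2 n2 r B"
proof -
  have "mmul r (madd Lh dL) (ctr B) = madd (mmul r Lh (ctr B)) (mmul r dL (ctr B))"
    by (simp add: mmul_madd_left)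
  then have "fro2 n1 n2 (mmul r L (ctr B)) \<le> 2 * fro2 n1 n2 (mmul r Lh (ctr B)) + 2 * fro2 n1 n2 (mmul r dL (ctr B))"
    using fro2_madd_le[of n1 n2 "mmul r Lh (ctr B)" "mmul r dL (ctr B)"] by (simp only: L_eq[symmetric])
  moreover have "0 \<le> s1 * fro2 n2 r B" using s1 by simp
  ultimately show ?thesis using S_up[of n2 B] fro2_dL_B[of n2 B] by (simp add: fro2_Lh_B)
qed

text \<open>R splits into truth and deviation. The true part is tangent; the deviation is bounded by
  the counts away from the corners and by its own row bound at the corners.\<close>

lemma samp_A_R: "samp \<Omega> (mmul r A (ctr R)) \<le> 4 * s1 * fro2 n1 r A"
proof -
  have "mmul r A (ctr (madd Rh dR)) = madd (mmul r A (ctr Rh)) (mmul r A (ctr dR))"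
    by (simp add: ctr_madd mmul_madd_right)
  then have 1: "samp \<Omega> (mmul r A (ctr R)) \<le> 2 * samp \<Omega> (mmul r A (ctr Rh)) + 2 * samp \<Omega> (mmul r A (ctr dR))"
    using samp_madd_le[of \<Omega> "mmul r A (ctr Rh)" "mmul r A (ctr dR)"] by (simp only: R_eq[symmetric])
  have "fro2 n1 r A * fro2 n2 r dR \<le> fro2 n1 r A * (s1 / 10000)"
    using dLR(2) d2_small sr by (intro mult_left_mono) auto
  then have 2: "samp good (mmul r A (ctr dR)) \<le> 16 / 10000 * (s1 * fro2 n1 r A)"
    using samp_good_mmul[of A dR] by (simp add: mult.commute)
  have "samp bad (mmul r A (ctr dR)) \<le> 1/1000 * (8 * s1) * fro2 n1 r A"
    by (rule samp_sparse[OF _ _ bad_card]) (use row_dLR s1 in auto)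
  then have 3: "samp bad (mmul r A (ctr dR)) \<le> 8/1000 * (s1 * fro2 n1 r A)" by simp
  have 4: "samp \<Omega> (mmul r A (ctr Rh)) \<le> 101/100 * (s1 * fro2 n1 r A)" using samp_A_Rh[of A] by simp
  have "0 \<le> s1 * fro2 n1 r A" using s1 by simp
  then have "samp \<Omega> (mmul r A (ctr R)) \<le> 4 * (s1 * fro2 n1 r A)"
    using 1 2 3 4 samp_split[of "mmul r A (ctr dR)"] by linarith
  then show ?thesis by simp
qed

lemma samp_L_B: "samp \<Omega> (mmul r L (ctr B)) \<le> 4 * s1 * fro2 n2 r B"
proof -
  have "mmul r (madd Lh dL) (ctr B) = madd (mmul r Lh (ctr B)) (mmul r dL (ctr B))"
    by (simp add: mmul_madd_left)
  then have 1: "samp \<Omega> (mmul r L (ctr B)) \<le> 2 * samp \<Omega> (mmul r Lh (ctr B)) + 2 * samp \<Omega> (mmul r dL (ctr B))"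
    using samp_madd_le[of \<Omega> "mmul r Lh (ctr B)" "mmul r dL (ctr B)"] by (simp only: L_eq[symmetric])
  have "fro2 n1 r dL * fro2 n2 r B \<le> (s1 / 10000) * fro2 n2 r B"
    using dLR(1) d2_small sr by (intro mult_right_mono) auto
  then have 2: "samp good (mmul r dL (ctr B)) \<le> 16 / 10000 * (s1 * fro2 n2 r B)"
    using samp_good_mmul[of dL B] by simp
  have "samp bad (mmul r dL (ctr B)) \<le> 1/1000 * (8 * s1) * fro2 n2 r B"
    by (rule samp_sparse'[OF _ _ bad_card]) (use row_dLR s1 in auto)
  then have 3: "samp bad (mmul r dL (ctr B)) \<le> 8/1000 * (s1 * fro2 n2 r B)" by simp
  have 4: "samp \<Omega> (mmul r Lh (ctr B)) \<le> 101/100 * (s1 * fro2 n2 r B)" using samp_Lh_B[of B] by simp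
  have "0 \<le> s1 * fro2 n2 r B" using s1 by simp
  then have "samp \<Omega> (mmul r L (ctr B)) \<le> 4 * (s1 * fro2 n2 r B)"
    using 1 2 3 4 samp_split[of "mmul r dL (ctr B)"] by linarith
  then show ?thesis by simp
qed

text \<open>The factors have operator norm at most twice the root of \<open>s1\<close>: that of the
  truth is at most the root itself, and the deviation is far smaller.\<close>

lemma fro2_factor_adj:
  assumes X: "orthcols m r X" and Z: "Z = madd (mmul r X S) dZ" and dZ: "fro2 m r dZ \<le> s1 / 10000"
  shows "fro2 r r (mmul m (ctr Z) A) \<le> 4 * s1 * fro2 m r A"
proof -
  have "fro2 r r (mmul m (ctr (mmul r X S)) A) = fro2 r r (mmul r (mmul m (ctr A) X) S)"
    using fro2_ctr[of r r "mmul m (ctr (mmul r X S)) A"] by (simp add: ctr_mmul mmul_assoc)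
  also have "\<dots> \<le> s1 * fro2 r r (mmul m (ctr A) X)" by (rule S_up')
  also have "\<dots> \<le> s1 * fro2 r m (ctr A)" using s1 by (intro mult_left_mono fro2_mmul_orth_le X) auto
  finally have 1: "fro2 r r (mmul m (ctr (mmul r X S)) A) \<le> s1 * fro2 m r A" by (simp only: fro2_ctr)
  have "fro2 r r (mmul m (ctr dZ) A) \<le> fro2 m r dZ * fro2 m r A" by (rule fro2_ctr_mmul_le)
  also have "\<dots> \<le> s1 / 10000 * fro2 m r A" by (rule mult_right_mono[OF dZ]) simp
  finally have 2: "fro2 r r (mmul m (ctr dZ) A) \<le> s1 / 10000 * fro2 m r A" .
  have "0 \<le> s1 * fro2 m r A" using s1 by simp
  moreover have "mmul m (ctr Z) A = madd (mmul m (ctr (mmul r X S)) A) (mmul m (ctr dZ) A)"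
    unfolding Z by (simp add: ctr_madd mmul_madd_left)
  ultimately show ?thesis
    using 1 2 fro2_madd_le[of r r "mmul m (ctr (mmul r X S)) A" "mmul m (ctr dZ) A"] by simp
qed

text \<open>The energy of the three residuals of the loss, outlier error included. It bounds the
  squared gradient from above.\<close>

definition "stuff = (\<Sum>i\<in>\<Omega>. (cmod (e i))\<^sup>2) / p + qp n1 n2 M M + fro2 r r (madd H F) / 16"

lemma stuff_nonneg: "0 \<le> stuff"
  using p by (simp add: stuff_def qp_nonneg sum_nonneg)

text \<open>The sampled energy of \<open>D\<close> and the imbalance are left unestimated on
  purpose: \<open>descent\<close> supplies the same two quantities with favourable sign.\<close>

lemma stuff_le: "stuff \<le> 11 * T2 + 3 * samp \<Omega> D + fro2 r r H / 8"
proof -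
  have 3: "(cmod (a + b + c))\<^sup>2 \<le> 3 * (cmod a)\<^sup>2 + 3 * (cmod b)\<^sup>2 + 3 * (cmod c)\<^sup>2" for a b c :: complex
  proof -
    have "2 * Re (cnj a * b) \<le> (cmod a)\<^sup>2 + (cmod b)\<^sup>2" "2 * Re (cnj (a + b) * c) = 2 * Re (cnj a * c) + 2 * Re (cnj b * c)"
      "2 * Re (cnj a * c) \<le> (cmod a)\<^sup>2 + (cmod c)\<^sup>2" "2 * Re (cnj b * c) \<le> (cmod b)\<^sup>2 + (cmod c)\<^sup>2"
      using Re_young[of 1 a b] Re_young[of 1 a c] Re_young[of 1 b c] by (simp_all add: algebra_simps)
    then show ?thesis unfolding cmod_add_sq by linarith
  qed
  have "(\<Sum>i\<in>\<Omega>. (cmod (e i))\<^sup>2) \<le> (\<Sum>i\<in>\<Omega>. 3 * (cmod (Gadj n1 n2 T i))\<^sup>2 + 3 * (cmod (Gadj n1 n2 D i))\<^sup>2 + 3 * (cmod (N i))\<^sup>2)"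
    by (rule sum_mono) (simp add: e_M M_eq Gadj_madd 3)
  also have "\<dots> = 3 * (\<Sum>i\<in>\<Omega>. (cmod (Gadj n1 n2 T i))\<^sup>2) + 3 * (\<Sum>i\<in>\<Omega>. (cmod (Gadj n1 n2 D i))\<^sup>2) + 3 * (\<Sum>i\<in>\<Omega>. (cmod (N i))\<^sup>2)"
    by (simp only: sum.distrib sum_distrib_left)
  finally have "(\<Sum>i\<in>\<Omega>. (cmod (e i))\<^sup>2) / p \<le> (3 * (\<Sum>i\<in>\<Omega>. (cmod (Gadj n1 n2 T i))\<^sup>2) + 3 * (\<Sum>i\<in>\<Omega>. (cmod (Gadj n1 n2 D i))\<^sup>2) + 3 * (\<Sum>i\<in>\<Omega>. (cmod (N i))\<^sup>2)) / p"
    using p by (intro divide_right_mono) auto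
  then have 1: "(\<Sum>i\<in>\<Omega>. (cmod (e i))\<^sup>2) / p \<le> 3 * samp \<Omega> T + 3 * samp \<Omega> D + 3 * ((\<Sum>i\<in>\<Omega>. (cmod (N i))\<^sup>2) / p)"
    by (simp only: samp_def add_divide_distrib times_divide_eq_right)
  have 2: "samp \<Omega> T \<le> 2 * T2 + T2 / 100"
    using abs_le_D1[OF samp_T] Gadj_norm_le[of n1 n2 T] fro2_T_le unfolding n_def by linarith
  have "2 * qp n1 n2 T D \<le> 1 * qp n1 n2 T T + qp n1 n2 D D / 1" by (rule qp_young) simp
  then have 4: "qp n1 n2 M M \<le> 2 * qp n1 n2 T T + 2 * qp n1 n2 D D"
    by (simp add: M_eq qp_madd qp_madd2 qp_commute[of n1 n2 D T])
  have 5: "qp n1 n2 T T \<le> 2 * T2" "qp n1 n2 D D \<le> T2 / 10000"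
    using qp_self_le[of n1 n2 T] fro2_T_le qp_self_le[of n1 n2 D] fro2_D by linarith+
  show ?thesis
    unfolding stuff_def using 1 2 4 5 fro2_madd_le[of r r H F] F_le N_le T2_nonneg by linarith
qed

text \<open>Cauchy-Schwarz with weight 20 \<open>s1\<close>, so that the dual terms sum to 8/20 +
  8/20 + 8/320 = 33/40 of the squared direction. Being below 1, this share can be moved to the left
  when the direction is the gradient itself.\<close>

lemma form_le: "2 * form A B \<le> 20 * s1 * stuff + 33/40 * (fro2 n1 r A + fro2 n2 r B)"
proof -
  let ?c = "20 * s1" and ?Y = "madd (mmul r A (ctr R)) (mmul r L (ctr B))"
    and ?Z = "msub (mmul n1 (ctr L) A) (mmul n2 (ctr R) B)" and ?g = "fro2 n1 r A + fro2 n2 r B"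
  have c: "0 < ?c" using s1 by simp
  have Ysamp: "samp \<Omega> ?Y \<le> 8 * (s1 * ?g)"
    using samp_madd_le[of \<Omega> "mmul r A (ctr R)" "mmul r L (ctr B)"] samp_A_R[of A] samp_L_B[of B] by (simp add: algebra_simps)
  have Yqp: "qp n1 n2 ?Y ?Y \<le> 8 * (s1 * ?g)"
    using qp_self_le[of n1 n2 ?Y] fro2_madd_le[of n1 n2 "mmul r A (ctr R)" "mmul r L (ctr B)"] fro2_A_R[of A] fro2_L_B[of B]
    by (simp add: algebra_simps)
  have sm: "fro2 n1 r dL \<le> s1 / 10000" "fro2 n2 r dR \<le> s1 / 10000"
    using dLR d2_small sr by linarith+
  have Zb: "fro2 r r ?Z \<le> 8 * (s1 * ?g)"
    using fro2_msub_le[of r r "mmul n1 (ctr L) A" "mmul n2 (ctr R) B"]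
      fro2_factor_adj[OF orthU L_eq[unfolded Lh_def] sm(1), of A] fro2_factor_adj[OF orthV R_eq[unfolded Rh_def] sm(2), of B]
    by (simp add: algebra_simps)
  have "2 * (\<Sum>i\<in>\<Omega>. Re (cnj (e i) * Gadj n1 n2 ?Y i)) \<le> ?c * (\<Sum>i\<in>\<Omega>. (cmod (e i))\<^sup>2) + (\<Sum>i\<in>\<Omega>. (cmod (Gadj n1 n2 ?Y i))\<^sup>2) / ?c"
    unfolding sum_distrib_left sum_divide_distrib sum.distrib[symmetric] by (intro sum_mono Re_young c)
  then have "2 * (\<Sum>i\<in>\<Omega>. Re (cnj (e i) * Gadj n1 n2 ?Y i)) / p \<le> (?c * (\<Sum>i\<in>\<Omega>. (cmod (e i))\<^sup>2) + (\<Sum>i\<in>\<Omega>. (cmod (Gadj n1 n2 ?Y i))\<^sup>2) / ?c) / p"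
    using p by (intro divide_right_mono) auto
  then have 1: "2 * ((\<Sum>i\<in>\<Omega>. Re (cnj (e i) * Gadj n1 n2 ?Y i)) / p) \<le> ?c * ((\<Sum>i\<in>\<Omega>. (cmod (e i))\<^sup>2) / p) + samp \<Omega> ?Y / ?c"
    by (simp only: samp_def add_divide_distrib times_divide_eq_right divide_divide_eq_left mult.commute[of p])
  have 2: "2 * qp n1 n2 M ?Y \<le> ?c * qp n1 n2 M M + qp n1 n2 ?Y ?Y / ?c" by (rule qp_young[OF c])
  have 3: "2 * ip r r (madd H F) ?Z \<le> ?c * fro2 r r (madd H F) + fro2 r r ?Z / ?c" by (rule young[OF c])
  have dv: "x / ?c \<le> 8/20 * ?g" if "x \<le> 8 * (s1 * ?g)" for x
    using that c by (simp add: divide_le_eq algebra_simps)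
  have 4: "2 * form A B \<le> ?c * stuff + (samp \<Omega> ?Y / ?c + qp n1 n2 ?Y ?Y / ?c + fro2 r r ?Z / ?c / 16)"
    using 1 2 3 unfolding form_def stuff_def distrib_left by simp
  have 5: "samp \<Omega> ?Y / ?c + qp n1 n2 ?Y ?Y / ?c + fro2 r r ?Z / ?c / 16 \<le> 33/40 * ?g"
    using dv[OF Ysamp] dv[OF Yqp] dv[OF Zb] by simp
  show ?thesis using 4 5 by linarith
qed

lemma grad_form:
  assumes res: "\<And>i. i \<in> \<Omega> \<Longrightarrow> e i = Gadj n1 n2 (mmul r L (ctr R)) i + s i - f i"
  shows "ip n1 r (gradL n1 n2 r p (1/16) \<Omega> f s L R) A + ip n2 r (gradR n1 n2 r p (1/16) \<Omega> f s L R) B = form A B"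
proof -
  let ?Y = "madd (mmul r A (ctr R)) (mmul r L (ctr B))" and ?P = "perp n1 n2 (mmul r L (ctr R))"
    and ?E = "balE n1 n2 L R"
  define G where "G = residual n1 n2 r \<Omega> f s L R"
  have P: "perpLR n1 n2 r L R = ?P" by (simp add: perpLR_def perp_def)
  have l: "ip n1 r (mmul n2 X R) A = ip n1 n2 X (mmul r A (ctr R))" for X by (rule ip_mmul_right)
  have rr: "ip n2 r (mmul n1 (ctr X) L) B = ip n1 n2 X (mmul r L (ctr B))" for X
    using ip_mmul_right[of n2 r n1 "ctr X" L B] ip_ctr[of n2 n1 X "mmul r L (ctr B)"] by (simp add: ctr_mmul)
  have 1: "ip n1 n2 G ?Y = (\<Sum>i\<in>\<Omega>. Re (cnj (e i) * Gadj n1 n2 ?Y i))"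
  proof -
    have "ip n1 n2 G ?Y = (\<Sum>i<n1+n2-1. if i \<in> \<Omega> then Re (cnj (e i) * Gadj n1 n2 ?Y i) else 0)"
      unfolding G_def residual_def Gop_adjoint
    proof (intro sum.cong refl)
      fix i
      have "projO \<Omega> (\<lambda>i. Gadj n1 n2 (mmul r L (ctr R)) i + s i - f i) i = (if i \<in> \<Omega> then e i else 0)"
        by (simp add: projO_def res)
      then show "Re (cnj (projO \<Omega> (\<lambda>i. Gadj n1 n2 (mmul r L (ctr R)) i + s i - f i) i) * Gadj n1 n2 ?Y i)
          = (if i \<in> \<Omega> then Re (cnj (e i) * Gadj n1 n2 ?Y i) else 0)" by simp
    qed
    also have "\<dots> = (\<Sum>i\<in>{..<n1+n2-1} \<inter> \<Omega>. Re (cnj (e i) * Gadj n1 n2 ?Y i))"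
      by (rule sum.inter_restrict[symmetric]) simp
    also have "{..<n1+n2-1} \<inter> \<Omega> = \<Omega>" using \<Omega> by auto
    finally show ?thesis .
  qed
  have 2: "ip n1 n2 ?P ?Y = qp n1 n2 M ?Y"
  proof -
    have "ip n1 n2 ?P ?Y = qp n1 n2 (mmul r L (ctr R)) ?Y" by (simp add: ip_perp qp_def)
    moreover have "qp n1 n2 M ?Y = qp n1 n2 (mmul r L (ctr R)) ?Y - qp n1 n2 (mmul r Lh (ctr Rh)) ?Y"
      unfolding M_def by (rule qp_msub)
    ultimately show ?thesis using truth_hankel[of ?Y] by (simp add: Lh_def Rh_def)
  qed
  have 3: "ip n1 r (mmul r L ?E) A - ip n2 r (mmul r R ?E) B = ip r r (madd H F) (msub (mmul n1 (ctr L) A) (mmul n2 (ctr R) B))"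
  proof -
    have "ip n1 r (mmul r L ?E) A - ip n2 r (mmul r R ?E) B = ip r r ?E (msub (mmul n1 (ctr L) A) (mmul n2 (ctr R) B))"
      by (simp add: ip_mmul_left ip_msub_right)
    then show ?thesis by (simp only: ip_cong[OF bal_eq refl])
  qed
  have Lg: "ip n1 r (gradL n1 n2 r p (1/16) \<Omega> f s L R) A
      = 1/p * ip n1 n2 G (mmul r A (ctr R)) + ip n1 n2 ?P (mmul r A (ctr R)) + 1/16 * ip n1 r (mmul r L ?E) A"
    unfolding gradL_def G_def[symmetric] P ip_simps l ..
  have Rg: "ip n2 r (gradR n1 n2 r p (1/16) \<Omega> f s L R) B
      = 1/p * ip n1 n2 G (mmul r L (ctr B)) + ip n1 n2 ?P (mmul r L (ctr B)) - 1/16 * ip n2 r (mmul r R ?E) B"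
    unfolding gradR_def G_def[symmetric] P ip_simps rr ..
  show ?thesis
    unfolding Lg Rg form_def 1[symmetric] 2[symmetric] 3[symmetric] ip_madd_right
    by (simp add: add_divide_distrib)
qed

text \<open>Expanding the squared distance after the step sets twice the pairing with the deviation
  against \<eta> times the squared gradient. The step size turns the latter into at most 20 ct
  \<open>stuff\<close> \<le> \<open>stuff\<close>/1000, which \<open>descent\<close>
  outweighs.\<close>

lemma gradient_step:
  assumes res: "\<And>i. i \<in> \<Omega> \<Longrightarrow> e i = Gadj n1 n2 (mmul r L (ctr R)) i + s i - f i"
    and ct: "0 < ct" "ct \<le> 1 / 20000"
  shows "fro2 n1 r (msub (msub L (mscale (complex_of_real (ct / s1)) (gradL n1 n2 r p (1/16) \<Omega> f s L R))) Lh)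
     + fro2 n2 r (msub (msub R (mscale (complex_of_real (ct / s1)) (gradR n1 n2 r p (1/16) \<Omega> f s L R))) Rh)
    \<le> (1 - ct / s1 * sr / 64) * d2"
proof -
  let ?gL = "gradL n1 n2 r p (1/16) \<Omega> f s L R" and ?gR = "gradR n1 n2 r p (1/16) \<Omega> f s L R"
  define \<eta> where "\<eta> = ct / s1"
  define \<gamma> where "\<gamma> = fro2 n1 r ?gL + fro2 n2 r ?gR"
  have \<eta>: "0 < \<eta>" "\<eta> * s1 = ct" using ct s1 by (auto simp: \<eta>_def)
  have e1: "msub (msub X (mscale c g)) Y = msub (msub X Y) (mscale c g)" for X Y g c
    by (simp add: msub_def fun_eq_iff)
  have sc: "fro2 m r (mscale (complex_of_real \<eta>) g) = \<eta> * (\<eta> * fro2 m r g)" for m g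
    by (simp only: ip_self[symmetric] ip_mscale_left ip_mscale_right)
  have expand: "fro2 n1 r (msub (msub L (mscale (complex_of_real \<eta>) ?gL)) Lh)
     + fro2 n2 r (msub (msub R (mscale (complex_of_real \<eta>) ?gR)) Rh) = d2 - 2 * (\<eta> * form dL dR) + \<eta> * (\<eta> * \<gamma>)"
  proof -
    have f: "form dL dR = ip n1 r dL ?gL + ip n2 r dR ?gR"
      using grad_form[OF res, of dL dR] by (simp only: ip_commute)
    show ?thesis
      unfolding e1 dL_def[symmetric] dR_def[symmetric] fro2_msub sc ip_mscale_right d2_def \<gamma>_def f
      by (simp add: algebra_simps)
  qed
  have "form ?gL ?gR = \<gamma>" using grad_form[OF res, of ?gL ?gR] by (simp add: \<gamma>_def ip_self)
  then have "\<gamma> \<le> 20 * s1 * stuff"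
  proof -
    assume "form ?gL ?gR = \<gamma>"
    moreover have "0 \<le> 20 * s1 * stuff" using stuff_nonneg s1 by simp
    ultimately show ?thesis using form_le[of ?gL ?gR] unfolding \<gamma>_def[symmetric] by linarith
  qed
  then have "\<eta> * \<gamma> \<le> \<eta> * (20 * s1 * stuff)" using \<eta> by (intro mult_left_mono) auto
  also have "\<dots> = 20 * ct * stuff" using \<eta>(2) by (simp add: ac_simps)
  also have "\<dots> \<le> 1 / 1000 * stuff" using ct stuff_nonneg by (intro mult_right_mono) auto
  finally have "\<eta> * \<gamma> \<le> 1/1000 * stuff" .
  then have "\<eta> * \<gamma> - 2 * form dL dR \<le> - (sr / 64 * d2)"
    using stuff_le descent T2_lower T2_nonneg fro2_nonneg[of r r H] samp_nonneg[of \<Omega> D] by argo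
  then have "\<eta> * (\<eta> * \<gamma> - 2 * form dL dR) \<le> \<eta> * - (sr / 64 * d2)" using \<eta> by (intro mult_left_mono) auto
  then show ?thesis unfolding \<eta>_def[symmetric] expand by (simp add: algebra_simps)
qed

end

subsection \<open>Hard thresholding\<close>

text \<open>The error is -g at kept indices. A missed outlier has size at most |q| + |g|, and its
  |q| is dominated by that of a kept index without outlier, where q is -g or 0. At least as many
  entries are kept as there are outliers, so missed outliers inject into such indices. The square
  bound serves the iterations, the uniform bound the initialization.\<close>

lemma hard_thr_outliers:
  assumes thr: "hard_thr n m q v" and \<Omega>: "\<Omega> \<subseteq> {..<n}" and K: "K \<subseteq> \<Omega>" "card K \<le> m"
    and q0: "\<And>i. i \<notin> \<Omega> \<Longrightarrow> q i = 0" and q1: "\<And>i. i \<in> \<Omega> \<Longrightarrow> q i = w i - g i"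
    and w0: "\<And>i. i \<in> \<Omega> \<Longrightarrow> i \<notin> K \<Longrightarrow> w i = 0"
  obtains J where "J \<subseteq> \<Omega>" "card J \<le> m + card K"
    "\<And>i. i \<in> \<Omega> \<Longrightarrow> i \<notin> J \<Longrightarrow> v i - w i = 0"
    "(\<Sum>i\<in>J. (cmod (v i - w i))\<^sup>2) \<le> 3 * (\<Sum>i\<in>J. (cmod (g i))\<^sup>2)"
    "\<And>X i. (\<And>i. i \<in> \<Omega> \<Longrightarrow> cmod (g i) \<le> X) \<Longrightarrow> i \<in> J \<Longrightarrow> cmod (v i - w i) \<le> 2 * X"
    "\<And>i. i < n \<Longrightarrow> i \<notin> \<Omega> \<Longrightarrow> v i = 0"
proof -
  obtain S where S: "S \<subseteq> {..<n}" "card S = min m n"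
    and top: "\<And>i j. i \<in> S \<Longrightarrow> j \<in> {..<n} - S \<Longrightarrow> cmod (q j) \<le> cmod (q i)"
    and v: "\<And>i. i < n \<Longrightarrow> v i = (if i \<in> S then q i else 0)"
    using thr unfolding hard_thr_def by blast
  have fin: "finite S" "finite \<Omega>" "finite K" using S \<Omega> K finite_subset[OF _ finite_lessThan[of n]] by blast+
  let ?A = "S \<inter> \<Omega>" and ?B = "K - S"
  \<comment> \<open>Kept entries of the sample together with missed outliers. Entries kept outside
    the sample are zero and do no harm.\<close>
  define J where "J = ?A \<union> ?B"
  have cK: "card K \<le> card S"
    using K(2) card_mono[OF finite_lessThan[of n], of K] K(1) \<Omega> S(2) by auto
  have cBS: "card ?B \<le> card (S - K)"
  proof -
    have "card K = card (K \<inter> S) + card ?B" "card S = card (S \<inter> K) + card (S - K)"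
      using fin by (simp_all add: card_Diff_subset_Int Int_commute card_mono)
    then show ?thesis using cK by (simp add: Int_commute)
  qed
  have NA: "v i - w i = - g i" if "i \<in> ?A" for i using that v[of i] \<Omega> q1[of i] by auto
  have NB: "v i - w i = - (q i + g i)" if "i \<in> ?B" for i
  proof -
    have "i \<in> \<Omega>" "i < n" using that K(1) \<Omega> by auto
    then show ?thesis using that v[of i] q1[of i] by simp
  qed
  have qK: "q j = - g j" if "j \<in> (S - K) \<inter> \<Omega>" for j using that q1[of j] w0[of j] by auto
  have dom: "cmod (q i) \<le> cmod (q j)" if "i \<in> ?B" "j \<in> S - K" for i j
    using top[of j i] that \<Omega> K(1) by auto
  show thesis
  proof (rule that[of J])
    show "J \<subseteq> \<Omega>" using K(1) by (auto simp: J_def)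
    have "card J \<le> card ?A + card ?B" unfolding J_def by (rule card_Un_le)
    also have "\<dots> \<le> m + card K"
      using card_mono[OF fin(1), of ?A] S(2) card_mono[OF fin(3), of ?B] by (intro add_mono) auto
    finally show "card J \<le> m + card K" .
    show "v i - w i = 0" if "i \<in> \<Omega>" "i \<notin> J" for i
      using that v[of i] \<Omega> w0[of i] by (auto simp: J_def)
    show "v i = 0" if "i < n" "i \<notin> \<Omega>" for i using that v[of i] q0[of i] by simp
    obtain \<phi> where \<phi>: "inj_on \<phi> ?B" "\<phi> ` ?B \<subseteq> S - K"
      using card_le_inj[of ?B "S - K"] fin cBS by auto
    have "(\<Sum>i\<in>?B. (cmod (q i))\<^sup>2) \<le> (\<Sum>i\<in>?B. (cmod (q (\<phi> i)))\<^sup>2)"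
      by (intro sum_mono power_mono dom) (use \<phi> in auto)
    also have "\<dots> = (\<Sum>j\<in>\<phi> ` ?B. (cmod (q j))\<^sup>2)" using \<phi>(1) by (simp add: sum.reindex)
    also have "\<dots> \<le> (\<Sum>j\<in>S - K. (cmod (q j))\<^sup>2)" by (rule sum_mono2) (use \<phi> fin in auto)
    also have "\<dots> = (\<Sum>j\<in>(S - K) \<inter> \<Omega>. (cmod (q j))\<^sup>2)"
      by (rule sum.mono_neutral_right) (use fin q0 in auto)
    also have "\<dots> = (\<Sum>j\<in>(S - K) \<inter> \<Omega>. (cmod (g j))\<^sup>2)" by (intro sum.cong refl) (simp only: qK norm_minus_cancel)
    also have "\<dots> \<le> (\<Sum>j\<in>?A. (cmod (g j))\<^sup>2)" by (rule sum_mono2) (use fin in auto)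
    finally have qB: "(\<Sum>i\<in>?B. (cmod (q i))\<^sup>2) \<le> (\<Sum>j\<in>?A. (cmod (g j))\<^sup>2)" .
    have "(\<Sum>i\<in>?B. (cmod (v i - w i))\<^sup>2) \<le> (\<Sum>i\<in>?B. 2 * (cmod (q i))\<^sup>2 + 2 * (cmod (g i))\<^sup>2)"
    proof (rule sum_mono)
      fix i assume "i \<in> ?B"
      then have "(cmod (v i - w i))\<^sup>2 = (cmod (q i + g i))\<^sup>2" by (simp only: NB norm_minus_cancel)
      then show "(cmod (v i - w i))\<^sup>2 \<le> 2 * (cmod (q i))\<^sup>2 + 2 * (cmod (g i))\<^sup>2"
        using Re_young[of 1 "q i" "g i"] unfolding cmod_add_sq by simp
    qed
    also have "\<dots> = 2 * (\<Sum>i\<in>?B. (cmod (q i))\<^sup>2) + 2 * (\<Sum>i\<in>?B. (cmod (g i))\<^sup>2)"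
      by (simp add: sum.distrib sum_distrib_left)
    finally have B: "(\<Sum>i\<in>?B. (cmod (v i - w i))\<^sup>2) \<le> 2 * (\<Sum>i\<in>?B. (cmod (q i))\<^sup>2) + 2 * (\<Sum>i\<in>?B. (cmod (g i))\<^sup>2)" .
    have A: "(\<Sum>i\<in>?A. (cmod (v i - w i))\<^sup>2) = (\<Sum>i\<in>?A. (cmod (g i))\<^sup>2)"
      by (intro sum.cong refl) (simp only: NA norm_minus_cancel)
    have sJ: "sum h J = sum h ?A + sum h ?B" for h :: "nat \<Rightarrow> real"
      unfolding J_def by (rule sum.union_disjoint) (use fin in auto)
    have "0 \<le> (\<Sum>i\<in>?B. (cmod (g i))\<^sup>2)" by (simp add: sum_nonneg)
    then show "(\<Sum>i\<in>J. (cmod (v i - w i))\<^sup>2) \<le> 3 * (\<Sum>i\<in>J. (cmod (g i))\<^sup>2)"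
      unfolding sJ A using B qB by argo
    fix X i assume X: "\<And>i. i \<in> \<Omega> \<Longrightarrow> cmod (g i) \<le> X" and i: "i \<in> J"
    have X0: "0 \<le> X" using X[of i] i K(1) by (auto simp: J_def intro: order_trans[OF norm_ge_zero])
    show "cmod (v i - w i) \<le> 2 * X"
    proof (cases "i \<in> ?A")
      case True
      then show ?thesis using NA[of i] X[of i] X0 by simp
    next
      case False
      then have iB: "i \<in> ?B" using i by (auto simp: J_def)
      then have "\<phi> i \<in> S - K" using \<phi> by auto
      then have "cmod (q i) \<le> cmod (q (\<phi> i))" by (rule dom[OF iB])
      also have "\<dots> \<le> X"
        using \<open>\<phi> i \<in> S - K\<close> q0[of "\<phi> i"] qK[of "\<phi> i"] X[of "\<phi> i"] X0 by (cases "\<phi> i \<in> \<Omega>") auto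
      finally have "cmod (q i) \<le> X" .
      moreover have "cmod (g i) \<le> X" using X[of i] iB K(1) by auto
      ultimately show ?thesis using norm_triangle_ineq[of "q i" "g i"] by (simp only: NB[OF iB] norm_minus_cancel)
    qed
  qed
qed

subsection \<open>Projection onto the incoherent matrices\<close>

lemma norm2inf_sq_le_iff:
  assumes "1 \<le> m" "0 \<le> B"
  shows "(norm2inf m k X)\<^sup>2 \<le> B \<longleftrightarrow> (\<forall>a<m. rowsq k X a \<le> B)"
proof -
  have e: "norm2inf m k X = Max ((\<lambda>i. sqrt (rowsq k X i)) ` {..<m})"
    by (simp add: norm2inf_def rowsq_def)
  have ne: "(\<lambda>i. sqrt (rowsq k X i)) ` {..<m} \<noteq> {}" using assms(1) by (auto simp: lessThan_empty_iff)
  have n0: "0 \<le> norm2inf m k X"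
    unfolding e using assms(1) by (intro order_trans[OF _ Max_ge[of _ "sqrt (rowsq k X 0)"]]) auto
  have "(norm2inf m k X)\<^sup>2 \<le> B \<longleftrightarrow> norm2inf m k X \<le> sqrt B"
    using n0 assms(2) real_le_rsqrt real_sqrt_pow2 power_mono by (metis)
  also have "\<dots> \<longleftrightarrow> (\<forall>a<m. sqrt (rowsq k X a) \<le> sqrt B)"
    unfolding e using ne by (subst Max_le_iff) auto
  finally show ?thesis by simp
qed

lemma is_row_proj_rows:
  assumes "is_row_proj m k B A P" "1 \<le> m" "a < m"
  shows "rowsq k P a \<le> B"
proof -
  have "(norm2inf m k P)\<^sup>2 \<le> B" using assms(1) by (simp add: is_row_proj_def)
  moreover from this have "0 \<le> B" by (rule order_trans[OF zero_le_power2])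
  ultimately show ?thesis using norm2inf_sq_le_iff[OF assms(2)] assms(3) by blast
qed

text \<open>The variational inequality of a nearest point in a convex set: moving from P by a
  fraction t towards a feasible X does not approach A, so as t tends to 0 the angle at P is not
  acute.\<close>

lemma is_row_proj_nonexpansive:
  assumes P: "is_row_proj m k B A P" and m: "1 \<le> m" and X: "\<And>a. a < m \<Longrightarrow> rowsq k X a \<le> B"
  shows "fro2 m k (msub P X) \<le> fro2 m k (msub A X)"
proof -
  have B0: "0 \<le> B" using X[of 0] m rowsq_nonneg[of k X 0] by linarith
  have rP: "rowsq k P a \<le> B" if "a < m" for a by (rule is_row_proj_rows[OF P m that])
  let ?u = "msub A P" and ?w = "msub X P"
  have key: "2 * ip m k ?u ?w \<le> t * fro2 m k ?w" if t: "0 < t" "t \<le> 1" for t :: real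
  proof -
    define Z where "Z = madd P (mscale (complex_of_real t) ?w)"
    have "rowsq k Z a \<le> B" if a: "a < m" for a
    proof -
      have "sqrt (rowsq k Z a) = L2_set (\<lambda>j. cmod (Z a j)) {..<k}" by (simp add: L2_set_def rowsq_def)
      also have "\<dots> \<le> L2_set (\<lambda>j. (1 - t) * cmod (P a j) + t * cmod (X a j)) {..<k}"
      proof (rule L2_set_mono)
        fix j
        have "Z a j = complex_of_real (1 - t) * P a j + complex_of_real t * X a j"
          by (simp add: Z_def madd_def mscale_def msub_def algebra_simps)
        then have "cmod (Z a j) \<le> cmod (complex_of_real (1 - t) * P a j) + cmod (complex_of_real t * X a j)"
          by (simp only: norm_triangle_ineq)
        then show "cmod (Z a j) \<le> (1 - t) * cmod (P a j) + t * cmod (X a j)"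
          using t by (simp only: norm_mult norm_of_real abs_of_nonneg diff_ge_0_iff_ge less_imp_le)
      qed simp
      also have "\<dots> \<le> L2_set (\<lambda>j. (1 - t) * cmod (P a j)) {..<k} + L2_set (\<lambda>j. t * cmod (X a j)) {..<k}"
        by (rule L2_set_triangle_ineq)
      also have "\<dots> = (1 - t) * sqrt (rowsq k P a) + t * sqrt (rowsq k X a)"
        using t by (simp add: L2_set_right_distrib[symmetric]) (simp add: L2_set_def rowsq_def)
      also have "\<dots> \<le> (1 - t) * sqrt B + t * sqrt B"
        using t rP[OF a] X[OF a] by (intro add_mono mult_left_mono) auto
      also have "\<dots> = sqrt B" by (simp add: algebra_simps)
      finally show ?thesis by simp
    qed
    then have "(norm2inf m k Z)\<^sup>2 \<le> B" using norm2inf_sq_le_iff[OF m B0] by blast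
    then have "fro2 m k ?u \<le> fro2 m k (msub A Z)" using P by (simp add: is_row_proj_def)
    also have "msub A Z = msub ?u (mscale (complex_of_real t) ?w)"
      by (simp add: Z_def madd_def mscale_def msub_def fun_eq_iff)
    also have "fro2 m k \<dots> = fro2 m k ?u - t * (2 * ip m k ?u ?w) + t * (t * fro2 m k ?w)"
    proof -
      have "fro2 m k (mscale (complex_of_real t) ?w) = t * (t * fro2 m k ?w)"
        by (simp only: ip_self[symmetric] ip_mscale_left ip_mscale_right)
      then show ?thesis by (simp only: fro2_msub ip_mscale_right)
    qed
    finally have "t * (2 * ip m k ?u ?w) \<le> t * (t * fro2 m k ?w)" by simp
    then show ?thesis using t by (simp add: mult_le_cancel_left_pos)
  qed
  have "ip m k ?u ?w \<le> 0"
  proof (rule ccontr)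
    assume "\<not> ip m k ?u ?w \<le> 0"
    then have pos: "0 < ip m k ?u ?w" by simp
    \<comment> \<open>Small enough that t times the squared length of the move is at most the inner
      product, of which \<open>key\<close> requires twice.\<close>
    define t where "t = min 1 (ip m k ?u ?w / (fro2 m k ?w + 1))"
    have t: "0 < t" "t \<le> 1" using pos by (auto simp: t_def intro!: divide_pos_pos add_nonneg_pos)
    have "t * fro2 m k ?w \<le> t * (fro2 m k ?w + 1)" using t by simp
    also have "\<dots> \<le> ip m k ?u ?w / (fro2 m k ?w + 1) * (fro2 m k ?w + 1)"
      by (intro mult_right_mono) (auto simp: t_def)
    also have "\<dots> = ip m k ?u ?w" using fro2_nonneg[of m k ?w] by (simp add: add_nonneg_eq_0_iff)
    finally show False using key[OF t] pos by linarith
  qed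
  moreover have "fro2 m k (msub A X) = fro2 m k ?u + fro2 m k ?w - 2 * ip m k ?u ?w"
  proof -
    have "msub A X = msub ?u ?w" by (simp add: msub_def fun_eq_iff)
    then show ?thesis using fro2_msub[of m k ?u ?w] by simp
  qed
  moreover have "fro2 m k (msub P X) = fro2 m k ?w"
    by (simp add: fro2_def msub_def norm_minus_commute)
  ultimately show ?thesis using fro2_nonneg[of m k ?u] by linarith
qed

subsection \<open>Singular values as bilinear forms\<close>

definition bil :: "nat \<Rightarrow> nat \<Rightarrow> cvec \<Rightarrow> cmat \<Rightarrow> cvec \<Rightarrow> complex" where
  "bil m k u M v = (\<Sum>a<m. \<Sum>b<k. cnj (u a) * M a b * v b)"

lemma orthcols_isometry:
  assumes "orthcols m q U"
  shows "(\<Sum>i<m. (cmod (\<Sum>j<q. U i j * y j))\<^sup>2) = (\<Sum>j<q. (cmod (y j))\<^sup>2)"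
  using fro2_mmul_orth_left[OF assms, of 1 "\<lambda>l _. y l"] by (simp add: fro2_def mmul_def)

lemma orthcols_bessel:
  assumes "orthcols m q U"
  shows "(\<Sum>l<q. (cmod (\<Sum>a<m. y a * U a l))\<^sup>2) \<le> (\<Sum>a<m. (cmod (y a))\<^sup>2)"
  using fro2_mmul_orth_le[OF assms, of 1 "\<lambda>_ a. y a"] by (simp add: fro2_def mmul_def)

lemma orthcols_col: "orthcols m q U \<Longrightarrow> j < q \<Longrightarrow> nsq {..<m} (\<lambda>a. U a j) = 1"
proof -
  assume "orthcols m q U" "j < q"
  then have "(\<Sum>l<m. cnj (U l j) * U l j) = 1" by (simp add: orthcols_iff)
  then have "complex_of_real (nsq {..<m} (\<lambda>a. U a j)) = 1"
    unfolding nsq_def by (simp only: of_real_sum complex_norm_square mult.commute)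
  then show ?thesis using of_real_eq_1_iff by blast
qed

lemma svd_mono:
  assumes "svd_form m k q M U \<sigma> V" "i \<le> j" "j < q"
  shows "\<sigma> j \<le> \<sigma> i"
  using assms(2,3)
proof (induction j rule: dec_induct)
  case (step j)
  then show ?case using assms(1) by (force simp: svd_form_def intro: order_trans)
qed simp

lemma svd_entry:
  assumes "svd_form m k q M U \<sigma> V" "a < m" "b < k"
  shows "M a b = (\<Sum>l<q. complex_of_real (\<sigma> l) * (U a l * cnj (V b l)))"
proof -
  have "M a b = mmul q (mmul q U (diagm \<sigma>)) (ctr V) a b" using assms by (simp add: svd_form_def mat_eq_def)
  also have "\<dots> = (\<Sum>l<q. complex_of_real (\<sigma> l) * (U a l * cnj (V b l)))"
  proof -
    have "mmul q U (diagm \<sigma>) a l = U a l * complex_of_real (\<sigma> l)" if "l < q" for l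
    proof -
      have "mmul q U (diagm \<sigma>) a l = (\<Sum>j<q. if j = l then U a j * complex_of_real (\<sigma> j) else 0)"
        unfolding mmul_def diagm_def by (intro sum.cong refl) auto
      then show ?thesis using that by simp
    qed
    then show ?thesis unfolding mmul_def[of q "mmul q U (diagm \<sigma>)"] ctr_def
      by (intro sum.cong refl) simp
  qed
  finally show ?thesis .
qed

lemma svd_bil:
  assumes "svd_form m k q M U \<sigma> V"
  shows "bil m k u M v = (\<Sum>l<q. complex_of_real (\<sigma> l) * ((\<Sum>a<m. cnj (u a) * U a l) * cnj (\<Sum>b<k. cnj (v b) * V b l)))"
proof -
  have "bil m k u M v = (\<Sum>a<m. \<Sum>b<k. \<Sum>l<q. complex_of_real (\<sigma> l) * ((cnj (u a) * U a l) * cnj (cnj (v b) * V b l)))"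
    unfolding bil_def
    by (intro sum.cong refl) (simp add: svd_entry[OF assms] sum_distrib_left sum_distrib_right ac_simps)
  also have "\<dots> = (\<Sum>a<m. \<Sum>l<q. \<Sum>b<k. complex_of_real (\<sigma> l) * ((cnj (u a) * U a l) * cnj (cnj (v b) * V b l)))"
    by (intro sum.cong refl sum.swap)
  also have "\<dots> = (\<Sum>l<q. \<Sum>a<m. \<Sum>b<k. complex_of_real (\<sigma> l) * ((cnj (u a) * U a l) * cnj (cnj (v b) * V b l)))"
    by (rule sum.swap)
  finally show ?thesis unfolding cnj_sum sum_product by (simp only: sum_distrib_left)
qed

lemma svd_bil_le:
  assumes svd: "svd_form m k q M U \<sigma> V" and q: "1 \<le> q"
  shows "cmod (bil m k u M v) \<le> \<sigma> 0 * (sqrt (nsq {..<m} u) * sqrt (nsq {..<k} v))"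
proof -
  let ?a = "\<lambda>l. \<Sum>a<m. cnj (u a) * U a l" and ?b = "\<lambda>l. \<Sum>b<k. cnj (v b) * V b l"
  have s0: "0 \<le> \<sigma> 0" "\<And>l. l < q \<Longrightarrow> 0 \<le> \<sigma> l" using svd q by (auto simp: svd_form_def)
  have "cmod (bil m k u M v) \<le> (\<Sum>l<q. \<sigma> 0 * (\<bar>cmod (?a l)\<bar> * \<bar>cmod (?b l)\<bar>))"
    unfolding svd_bil[OF svd]
  proof (rule sum_norm_le)
    fix l assume "l \<in> {..<q}"
    then have "\<sigma> l \<le> \<sigma> 0" "0 \<le> \<sigma> l" using svd_mono[OF svd, of 0 l] s0 by auto
    then show "cmod (complex_of_real (\<sigma> l) * (?a l * cnj (?b l))) \<le> \<sigma> 0 * (\<bar>cmod (?a l)\<bar> * \<bar>cmod (?b l)\<bar>)"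
      by (simp only: norm_mult norm_of_real complex_mod_cnj abs_norm_cancel abs_of_nonneg) (simp add: mult_right_mono)
  qed
  also have "\<dots> \<le> \<sigma> 0 * (L2_set (\<lambda>l. cmod (?a l)) {..<q} * L2_set (\<lambda>l. cmod (?b l)) {..<q})"
    unfolding sum_distrib_left[symmetric] by (intro mult_left_mono L2_set_mult_ineq s0)
  also have "\<dots> \<le> \<sigma> 0 * (sqrt (nsq {..<m} u) * sqrt (nsq {..<k} v))"
  proof -
    have "L2_set (\<lambda>l. cmod (?a l)) {..<q} \<le> sqrt (nsq {..<m} u)"
      using orthcols_bessel[of m q U "\<lambda>a. cnj (u a)"] svd by (simp add: L2_set_def nsq_def svd_form_def)
    moreover have "L2_set (\<lambda>l. cmod (?b l)) {..<q} \<le> sqrt (nsq {..<k} v)"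
      using orthcols_bessel[of k q V "\<lambda>a. cnj (v a)"] svd by (simp add: L2_set_def nsq_def svd_form_def)
    ultimately show ?thesis using s0 by (intro mult_left_mono mult_mono) (auto simp: L2_set_nonneg)
  qed
  finally show ?thesis .
qed

text \<open>With \<open>svd_bil_le\<close> this makes the largest singular value the maximum of the
  form over unit vectors, so its perturbation is controlled by bounds on forms alone.\<close>

lemma svd_bil_top:
  assumes svd: "svd_form m k q M U \<sigma> V" and q: "1 \<le> q"
  shows "bil m k (\<lambda>a. U a 0) M (\<lambda>b. V b 0) = complex_of_real (\<sigma> 0)"
proof -
  have oU: "(\<Sum>a<m. cnj (U a 0) * U a l) = (if 0 = l then 1 else 0)"
    and oV: "(\<Sum>a<k. cnj (V a 0) * V a l) = (if 0 = l then 1 else 0)" if "l < q" for l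
  proof -
    have "orthcols m q U" "orthcols k q V" "0 < q" using svd q by (auto simp: svd_form_def)
    then show "(\<Sum>a<m. cnj (U a 0) * U a l) = (if 0 = l then 1 else 0)"
      "(\<Sum>a<k. cnj (V a 0) * V a l) = (if 0 = l then 1 else 0)"
      using that unfolding orthcols_iff by blast+
  qed
  have "bil m k (\<lambda>a. U a 0) M (\<lambda>b. V b 0) = (\<Sum>l<q. if l = 0 then complex_of_real (\<sigma> l) else 0)"
    unfolding svd_bil[OF svd] by (intro sum.cong refl) (auto simp: oU oV)
  then show ?thesis using q by simp
qed

text \<open>Evaluates the norm in the row constraints of the algorithm, whose bound thereby becomes
  2 \<nu> times the top singular value of the initial estimate.\<close>

lemma opnorm_scaled_orth:
  assumes U: "orthcols m r U" and r: "1 \<le> r" and \<sigma>: "\<And>i. i < r \<Longrightarrow> 0 \<le> \<sigma> i" "\<And>i. i < r \<Longrightarrow> \<sigma> i \<le> \<sigma> 0"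
  shows "opnorm m r (mmul r U (diagm (\<lambda>i. sqrt (\<sigma> i)))) = sqrt (\<sigma> 0)"
proof -
  let ?L = "mmul r U (diagm (\<lambda>i. sqrt (\<sigma> i)))"
  have L: "?L i j = U i j * complex_of_real (sqrt (\<sigma> j))" if "j < r" for i j
  proof -
    have "?L i j = (\<Sum>l<r. if l = j then U i l * complex_of_real (sqrt (\<sigma> l)) else 0)"
      unfolding mmul_def diagm_def by (intro sum.cong refl) auto
    then show ?thesis using that by simp
  qed
  have e: "(\<Sum>i<m. (cmod (\<Sum>j<r. ?L i j * v j))\<^sup>2) = (\<Sum>j<r. \<sigma> j * (cmod (v j))\<^sup>2)" for v
  proof -
    have "(\<Sum>i<m. (cmod (\<Sum>j<r. ?L i j * v j))\<^sup>2)
        = (\<Sum>i<m. (cmod (\<Sum>j<r. U i j * (complex_of_real (sqrt (\<sigma> j)) * v j)))\<^sup>2)"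
      by (simp add: L mult.assoc)
    also have "\<dots> = (\<Sum>j<r. (cmod (complex_of_real (sqrt (\<sigma> j)) * v j))\<^sup>2)" by (rule orthcols_isometry[OF U])
    also have "\<dots> = (\<Sum>j<r. \<sigma> j * (cmod (v j))\<^sup>2)"
      using \<sigma>(1) by (intro sum.cong refl) (simp add: norm_mult power_mult_distrib)
    finally show ?thesis .
  qed
  show ?thesis
    unfolding opnorm_def e
  proof (rule cSup_eq_maximum)
    let ?v = "\<lambda>j. if j = 0 then 1 else 0 :: complex"
    have "(\<Sum>j<r. \<sigma> j * (cmod (?v j))\<^sup>2) = (\<Sum>j<r. if j = 0 then \<sigma> j else 0)" by (intro sum.cong refl) auto
    moreover have "(\<Sum>j<r. (cmod (?v j))\<^sup>2) = (\<Sum>j<r. if j = 0 then 1 else 0)" by (intro sum.cong refl) auto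
    ultimately have "(\<Sum>j<r. \<sigma> j * (cmod (?v j))\<^sup>2) = \<sigma> 0" "(\<Sum>j<r. (cmod (?v j))\<^sup>2) = 1" using r by simp_all
    then show "sqrt (\<sigma> 0) \<in> {sqrt (\<Sum>j<r. \<sigma> j * (cmod (v j))\<^sup>2) |v. (\<Sum>j<r. (cmod (v j))\<^sup>2) \<le> 1}"
      by (intro CollectI exI[of _ ?v]) simp
  next
    fix x assume "x \<in> {sqrt (\<Sum>j<r. \<sigma> j * (cmod (v j))\<^sup>2) |v. (\<Sum>j<r. (cmod (v j))\<^sup>2) \<le> 1}"
    then obtain v where x: "x = sqrt (\<Sum>j<r. \<sigma> j * (cmod (v j))\<^sup>2)" and v: "(\<Sum>j<r. (cmod (v j))\<^sup>2) \<le> 1" by auto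
    have "(\<Sum>j<r. \<sigma> j * (cmod (v j))\<^sup>2) \<le> (\<Sum>j<r. \<sigma> 0 * (cmod (v j))\<^sup>2)"
      by (intro sum_mono mult_right_mono \<sigma>) auto
    also have "\<dots> \<le> \<sigma> 0" using mult_left_mono[OF v, of "\<sigma> 0"] \<sigma>(1)[of 0] r by (simp add: sum_distrib_left)
    finally show "x \<le> sqrt (\<sigma> 0)" using x by simp
  qed
qed

text \<open>A single antidiagonal of ones is a partial permutation, of norm at most 1, whence the l1
  norm of h. This suffices for the few small errors of the initial thresholding.\<close>

lemma hankel_bil_sparse:
  fixes n1 n2 :: nat
  shows "cmod (\<Sum>a<n1. \<Sum>b<n2. cnj (u a) * h (a + b) * v b)
    \<le> (\<Sum>i<n1+n2-1. cmod (h i)) * (sqrt (nsq {..<n1} u) * sqrt (nsq {..<n2} v))"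
proof -
  let ?N = "sqrt (nsq {..<n1} u) * sqrt (nsq {..<n2} v)"
  have "cmod (\<Sum>a<n1. \<Sum>b<n2. cnj (u a) * h (a + b) * v b)
      = cmod (\<Sum>i<n1+n2-1. \<Sum>(a, b)\<in>adiag n1 n2 i. cnj (u a) * h (a + b) * v b)"
    by (simp only: sum_over_adiag)
  also have "\<dots> \<le> (\<Sum>i<n1+n2-1. cmod (h i) * ?N)"
  proof (rule sum_norm_le)
    fix i
    have "cmod (\<Sum>(a, b)\<in>adiag n1 n2 i. cnj (u a) * h (a + b) * v b)
        \<le> (\<Sum>z\<in>adiag n1 n2 i. cmod (h i) * (\<bar>cmod (u (fst z))\<bar> * \<bar>cmod (v (snd z))\<bar>))"
      by (rule sum_norm_le) (auto simp: adiag_def norm_mult)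
    also have "\<dots> \<le> cmod (h i) * (L2_set (\<lambda>z. cmod (u (fst z))) (adiag n1 n2 i) * L2_set (\<lambda>z. cmod (v (snd z))) (adiag n1 n2 i))"
      unfolding sum_distrib_left[symmetric] by (intro mult_left_mono L2_set_mult_ineq) simp
    also have "\<dots> \<le> cmod (h i) * ?N"
    proof -
      have "(\<Sum>z\<in>adiag n1 n2 i. (cmod (u (fst z)))\<^sup>2) = (\<Sum>a\<in>fst ` adiag n1 n2 i. (cmod (u a))\<^sup>2)"
        by (subst sum.reindex) (auto simp: inj_on_def adiag_def)
      also have "\<dots> \<le> nsq {..<n1} u" unfolding nsq_def by (rule sum_mono2) (auto simp: adiag_def)
      finally have 1: "L2_set (\<lambda>z. cmod (u (fst z))) (adiag n1 n2 i) \<le> sqrt (nsq {..<n1} u)"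
        by (simp add: L2_set_def)
      have "(\<Sum>z\<in>adiag n1 n2 i. (cmod (v (snd z)))\<^sup>2) = (\<Sum>b\<in>snd ` adiag n1 n2 i. (cmod (v b))\<^sup>2)"
        by (subst sum.reindex) (auto simp: inj_on_def adiag_def)
      also have "\<dots> \<le> nsq {..<n2} v" unfolding nsq_def by (rule sum_mono2) (auto simp: adiag_def)
      finally have 2: "L2_set (\<lambda>z. cmod (v (snd z))) (adiag n1 n2 i) \<le> sqrt (nsq {..<n2} v)"
        by (simp add: L2_set_def)
      show ?thesis using 1 2 by (intro mult_left_mono mult_mono) (auto simp: L2_set_nonneg)
    qed
    finally show "cmod (\<Sum>(a, b)\<in>adiag n1 n2 i. cnj (u a) * h (a + b) * v b) \<le> cmod (h i) * ?N" .
  qed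
  finally show ?thesis by (simp add: sum_distrib_right)
qed

subsection \<open>The sampling events\<close>

lemma sum_adiag_snd:
  "(\<Sum>(a, b)\<in>adiag n1 n2 i. h a b) = (\<Sum>b<n2. if b \<le> i \<and> i - b < n1 then h (i - b) b else 0)"
proof -
  have "(\<Sum>b<n2. if b \<le> i \<and> i - b < n1 then h (i - b) b else 0) = (\<Sum>b\<in>{b\<in>{..<n2}. b \<le> i \<and> i - b < n1}. h (i - b) b)"
    by (rule sum.inter_filter[symmetric]) simp
  also have "\<dots> = (\<Sum>z\<in>adiag n1 n2 i. h (fst z) (snd z))"
    by (rule sum.reindex_bij_witness[of _ snd "\<lambda>b. (i - b, b)"]) (auto simp: adiag_def)
  finally show ?thesis by (simp add: case_prod_unfold)
qed

lemma sum_adiag_fst: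
  "(\<Sum>(a, b)\<in>adiag n1 n2 i. h a b) = (\<Sum>a<n1. if a \<le> i \<and> i - a < n2 then h a (i - a) else 0)"
  using sum_adiag_snd[of "\<lambda>b a. h a b" n2 n1 i] sum_adiag_swap[of h n2 n1 i] by simp

text \<open>The coefficient vector of one sampled coordinate as a linear functional on the tangent
  space. Left summands index the entries of X, which enter conjugated, and right summands those of
  Y; see \<open>tcoord_Gadj\<close>.\<close>

definition tcoord :: "nat \<Rightarrow> nat \<Rightarrow> cmat \<Rightarrow> cmat \<Rightarrow> nat \<Rightarrow> (nat \<times> nat) + (nat \<times> nat) \<Rightarrow> complex" where
  "tcoord n1 n2 U V i z = (case z of
      Inl (b, l) \<Rightarrow> if b \<le> i \<and> i - b < n1 then U (i - b) l else 0
    | Inr (a, l) \<Rightarrow> if a \<le> i \<and> i - a < n2 then cnj (V (i - a) l) else 0) / complex_of_real (sqrt (real (vsig n1 n2 i)))"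

definition tidx :: "nat \<Rightarrow> nat \<Rightarrow> nat \<Rightarrow> ((nat \<times> nat) + (nat \<times> nat)) set" where
  "tidx n1 n2 r = ({..<n2} \<times> {..<r}) <+> ({..<n1} \<times> {..<r})"

lemma sum_tidx:
  "(\<Sum>z\<in>tidx n1 n2 r. f z) = (\<Sum>b<n2. \<Sum>l<r. f (Inl (b, l))) + (\<Sum>a<n1. \<Sum>l<r. f (Inr (a, l)))"
  by (simp add: tidx_def sum.Plus sum.cartesian_product o_def case_prod_unfold)

lemma tcoord_Gadj:
  "(\<Sum>z\<in>tidx n1 n2 r. tcoord n1 n2 U V i z * (case z of Inl (b, l) \<Rightarrow> cnj (X b l) | Inr (a, l) \<Rightarrow> Y a l))
    = Gadj n1 n2 (madd (mmul r U (ctr X)) (mmul r Y (ctr V))) i"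
proof -
  let ?s = "complex_of_real (sqrt (real (vsig n1 n2 i)))"
  have 1: "(\<Sum>b<n2. \<Sum>l<r. tcoord n1 n2 U V i (Inl (b, l)) * cnj (X b l)) = Gadj n1 n2 (mmul r U (ctr X)) i"
    unfolding Gadj_adiag sum_adiag_snd sum_divide_distrib
    by (intro sum.cong refl) (auto simp: tcoord_def mmul_def ctr_def sum_divide_distrib intro!: sum.neutral)
  have 2: "(\<Sum>a<n1. \<Sum>l<r. tcoord n1 n2 U V i (Inr (a, l)) * Y a l) = Gadj n1 n2 (mmul r Y (ctr V)) i"
    unfolding Gadj_adiag sum_adiag_fst sum_divide_distrib
    by (intro sum.cong refl) (auto simp: tcoord_def mmul_def ctr_def sum_divide_distrib mult.commute intro!: sum.neutral)
  show ?thesis unfolding sum_tidx Gadj_madd using 1 2 by simp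
qed

lemma tidx_nsq:
  "nsq (tidx n1 n2 r) (\<lambda>z. case z of Inl (b, l) \<Rightarrow> cnj (X b l) | Inr (a, l) \<Rightarrow> Y a l) = fro2 n2 r X + fro2 n1 r Y"
  by (simp add: nsq_def sum_tidx fro2_def)

text \<open>Each block is an average of squared rows along the antidiagonal, at most \<nu>.\<close>

lemma tcoord_nsq:
  assumes U: "\<And>a. a < n1 \<Longrightarrow> rowsq r U a \<le> \<nu>" and V: "\<And>b. b < n2 \<Longrightarrow> rowsq r V b \<le> \<nu>" and \<nu>: "0 \<le> \<nu>"
  shows "nsq (tidx n1 n2 r) (tcoord n1 n2 U V i) \<le> 2 * \<nu>"
proof -
  let ?s = "real (vsig n1 n2 i)"
  have bd: "(\<Sum>z\<in>adiag n1 n2 i. h z) / ?s \<le> \<nu>" if "\<And>z. z \<in> adiag n1 n2 i \<Longrightarrow> h z \<le> \<nu>" for h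
  proof -
    have "(\<Sum>z\<in>adiag n1 n2 i. h z) \<le> (\<Sum>z\<in>adiag n1 n2 i. \<nu>)" by (rule sum_mono[OF that])
    then have "(\<Sum>z\<in>adiag n1 n2 i. h z) / ?s \<le> ?s * \<nu> / ?s"
      by (intro divide_right_mono) (simp_all add: vsig_adiag)
    also have "\<dots> \<le> \<nu>" using \<nu> by simp
    finally show ?thesis .
  qed
  have sq: "(cmod (z / complex_of_real (sqrt ?s)))\<^sup>2 = (cmod z)\<^sup>2 / ?s" for z
    by (simp add: norm_divide power_divide)
  have "(\<Sum>b<n2. \<Sum>l<r. (cmod (tcoord n1 n2 U V i (Inl (b, l))))\<^sup>2)
      = (\<Sum>b<n2. if b \<le> i \<and> i - b < n1 then rowsq r U (i - b) else 0) / ?s"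
    unfolding sum_divide_distrib by (intro sum.cong refl) (auto simp: tcoord_def sq rowsq_def sum_divide_distrib intro!: sum.neutral)
  also have "\<dots> = (\<Sum>z\<in>adiag n1 n2 i. rowsq r U (fst z)) / ?s"
    using sum_adiag_snd[of "\<lambda>a b. rowsq r U a" n1 n2 i] by (simp add: case_prod_unfold)
  also have "\<dots> \<le> \<nu>" by (rule bd) (use U in \<open>auto simp: adiag_def\<close>)
  finally have 1: "(\<Sum>b<n2. \<Sum>l<r. (cmod (tcoord n1 n2 U V i (Inl (b, l))))\<^sup>2) \<le> \<nu>" .
  have "(\<Sum>a<n1. \<Sum>l<r. (cmod (tcoord n1 n2 U V i (Inr (a, l))))\<^sup>2)
      = (\<Sum>a<n1. if a \<le> i \<and> i - a < n2 then rowsq r V (i - a) else 0) / ?s"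
    unfolding sum_divide_distrib by (intro sum.cong refl) (auto simp: tcoord_def sq rowsq_def sum_divide_distrib intro!: sum.neutral)
  also have "\<dots> = (\<Sum>z\<in>adiag n1 n2 i. rowsq r V (snd z)) / ?s"
    using sum_adiag_fst[of "\<lambda>a b. rowsq r V b" n1 n2 i] by (simp add: case_prod_unfold)
  also have "\<dots> \<le> \<nu>" by (rule bd) (use V in \<open>auto simp: adiag_def\<close>)
  finally have 2: "(\<Sum>a<n1. \<Sum>l<r. (cmod (tcoord n1 n2 U V i (Inr (a, l))))\<^sup>2) \<le> \<nu>" .
  show ?thesis unfolding nsq_def sum_tidx using 1 2 by simp
qed

definition tangent_event :: "nat \<Rightarrow> nat \<Rightarrow> nat \<Rightarrow> real \<Rightarrow> cmat \<Rightarrow> cmat \<Rightarrow> (nat \<Rightarrow> bool) \<Rightarrow> bool" where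
  "tangent_event n1 n2 r p U V \<omega> \<longleftrightarrow> (\<forall>\<theta>.
    \<bar>\<Sum>i<n1+n2-1. xi p (\<omega> i) * (cmod (\<Sum>z\<in>tidx n1 n2 r. tcoord n1 n2 U V i z * \<theta> z))\<^sup>2\<bar> \<le> 1/100 * nsq (tidx n1 n2 r) \<theta>)"

definition hankel_event :: "nat \<Rightarrow> nat \<Rightarrow> real \<Rightarrow> real \<Rightarrow> cvec \<Rightarrow> (nat \<Rightarrow> bool) \<Rightarrow> bool" where
  "hankel_event n1 n2 p s1 x \<omega> \<longleftrightarrow> (\<forall>u v.
    cmod (\<Sum>a<n1. \<Sum>b<n2. cnj (u a) * (complex_of_real (xi p (\<omega> (a + b))) * x (a + b)) * v b)
      \<le> s1/10 * (sqrt (nsq {..<n1} u) * sqrt (nsq {..<n2} v)))"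

definition count_event :: "nat \<Rightarrow> real \<Rightarrow> (nat \<Rightarrow> bool) \<Rightarrow> bool" where
  "count_event n p \<omega> \<longleftrightarrow> (\<forall>j<n. \<forall>l\<le>n. 20 * ln (real n) / p \<le> real l \<longrightarrow>
    real (card ({i. i < n \<and> \<omega> i} \<inter> {j..<j+l})) \<le> 2 * p * real l)"

definition sampling_event :: "nat \<Rightarrow> nat \<Rightarrow> nat \<Rightarrow> real \<Rightarrow> real \<Rightarrow> cvec \<Rightarrow> cmat \<Rightarrow> cmat \<Rightarrow> (nat \<Rightarrow> bool) \<Rightarrow> bool" where
  "sampling_event n1 n2 r p s1 x U V \<omega> \<longleftrightarrow>
    tangent_event n1 n2 r p U V \<omega> \<and> hankel_event n1 n2 p s1 x \<omega> \<and> count_event (n1 + n2 - 1) p \<omega>"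

text \<open>Three failures of probability at most 2/n^2 each. The hypotheses \<open>p1\<close> and
  \<open>p2\<close> match the two demands of Bernstein's inequality: the size of a single term and
  the variance.\<close>

lemma sampling_event_prob:
  assumes n: "n = n1 + n2 - 1" "1 \<le> n1" "1 \<le> n2" "3 \<le> n" and p: "0 < p" "p \<le> 1" and s1: "0 < s1"
    and rows: "\<And>a. a < n1 \<Longrightarrow> rowsq r U a \<le> \<nu>" "\<And>b. b < n2 \<Longrightarrow> rowsq r V b \<le> \<nu>" and \<nu>: "0 \<le> \<nu>"
    and x: "\<And>i. i < n \<Longrightarrow> cmod (x i) \<le> s1 * \<nu>"
    and p1: "1000000 * (\<nu> * ln n) \<le> p" and p2: "1000000 * (n * \<nu>\<^sup>2 * ln n) \<le> p"
  shows "1 - 6 / (real n)\<^sup>2 \<le> measure_pmf.prob (bern_model n p) {\<omega>. sampling_event n1 n2 r p s1 x U V \<omega>}"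
proof -
  let ?M = "bern_model n p"
  let ?L = "ln (real n)"
  have L: "1 \<le> ?L"
  proof -
    have "exp 1 \<le> real n" using n(4) by (intro order_trans[OF exp_le]) simp
    then show ?thesis using n(4) by (subst ln_ge_iff) auto
  qed
  define B1 where "B1 = {\<omega>. \<not> tangent_event n1 n2 r p U V \<omega>}"
  define B2 where "B2 = {\<omega>. \<not> hankel_event n1 n2 p s1 x \<omega>}"
  define B3 where "B3 = {\<omega>. \<not> count_event n p \<omega>}"
  have ev: "{\<omega>. sampling_event n1 n2 r p s1 x U V \<omega>} = - (B1 \<union> B2 \<union> B3)"
    by (auto simp: sampling_event_def B1_def B2_def B3_def n(1))
  have e3: "real n ^ 3 * exp (- 3 * ?L) = 1"
  proof -
    have "exp (- 3 * ?L) = inverse (exp (3 * ?L))" by (simp add: exp_minus)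
    also have "exp (3 * ?L) = real n ^ 3" using n(4) exp_of_nat_mult[of 3 ?L] by simp
    finally show ?thesis using n(4) by simp
  qed
  have e3': "exp (- 3 * ?L) = 1 / real n ^ 3" using e3 n(4) by (simp add: field_simps)
  have le23: "2 / real n ^ 3 \<le> 2 / (real n)\<^sup>2"
    using n(4) by (intro divide_left_mono power_increasing) auto
  have nn: "real n * (s1 * \<nu>)\<^sup>2 = s1\<^sup>2 * (n * \<nu>\<^sup>2)" "real n * (2 * \<nu>)\<^sup>2 = 4 * (n * \<nu>\<^sup>2)"
    by (simp_all add: power_mult_distrib)
  have pL: "n * \<nu>\<^sup>2 / p \<le> 1 / (1000000 * ?L)"
  proof -
    have "n * \<nu>\<^sup>2 * (1000000 * ?L) \<le> p" using p2 by (simp add: ac_simps)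
    then show ?thesis using p L by (simp add: field_simps)
  qed
  have vL: "0 \<le> \<nu> * ?L" using \<nu> L by simp
  have b1: "measure_pmf.prob ?M B1 \<le> 2 / (real n)\<^sup>2"
  proof -
    \<comment> \<open>400 ln n times the deviation 1/100 gives -4 ln n, of which the variance
      returns at most ln n.\<close>
    have "measure_pmf.prob ?M B1 \<le> 2 * exp (- (400 * ?L) * (1/100) + (400 * ?L)\<^sup>2 * (card {..<n} * (2 * \<nu>)\<^sup>2) / p)"
      unfolding B1_def tangent_event_def not_all not_le n(1)[symmetric] bern_model_def
    proof (rule bernoulli_quadratic_form)
      show "finite (tidx n1 n2 r)" by (simp add: tidx_def)
      show "nsq (tidx n1 n2 r) (tcoord n1 n2 U V i) \<le> 2 * \<nu>" for i by (rule tcoord_nsq[OF rows \<nu>])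
      have "400 * ?L * (2 * \<nu>) = 800 * (\<nu> * ?L)" by simp
      then show "400 * ?L * (2 * \<nu>) \<le> p" using p1 vL by linarith
    qed (use p L in auto)
    also have "\<dots> \<le> 2 * exp (- 3 * ?L)"
    proof -
      have "(400 * ?L)\<^sup>2 * (card {..<n} * (2 * \<nu>)\<^sup>2) / p = 640000 * ?L\<^sup>2 * (n * \<nu>\<^sup>2 / p)"
        by (simp add: nn power_mult_distrib)
      also have "\<dots> \<le> 640000 * ?L\<^sup>2 * (1 / (1000000 * ?L))" by (intro mult_left_mono pL) auto
      also have "\<dots> \<le> ?L" using L by (simp add: power2_eq_square)
      finally show ?thesis by simp
    qed
    finally show ?thesis using le23 unfolding e3' by simp
  qed
  have b2: "measure_pmf.prob ?M B2 \<le> 2 / (real n)\<^sup>2"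
  proof -
    \<comment> \<open>Again -4 ln n, from 40 ln n / s1 and the deviation s1/10; the n frequencies
      turn n^(-3) into n^(-2).\<close>
    have "measure_pmf.prob ?M B2 \<le> real n * (2 * exp (- (40 * ?L / s1) * (s1/10) + (40 * ?L / s1)\<^sup>2 * (n * (s1 * \<nu>)\<^sup>2) / p))"
      unfolding B2_def hankel_event_def not_all not_le
    proof (rule bernoulli_hankel_norm)
      have e: "40 * ?L / s1 * (s1 * \<nu>) = 40 * (\<nu> * ?L)" using s1 by simp
      show "40 * ?L / s1 * (s1 * \<nu>) \<le> p" unfolding e using p1 vL by linarith
      show "n1 + n2 \<le> Suc n" "0 < n" "n1 \<le> n" "n2 \<le> n" using n by auto
    qed (use p L s1 x in auto)
    also have "\<dots> \<le> real n * (2 * exp (- 3 * ?L))"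
    proof -
      have "(40 * ?L / s1)\<^sup>2 * (n * (s1 * \<nu>)\<^sup>2) / p = 1600 * ?L\<^sup>2 * (n * \<nu>\<^sup>2 / p)"
        using s1 by (simp add: nn power_divide power_mult_distrib)
      also have "\<dots> \<le> 1600 * ?L\<^sup>2 * (1 / (1000000 * ?L))" by (intro mult_left_mono pL) auto
      also have "\<dots> \<le> ?L" using L by (simp add: power2_eq_square)
      finally have "- (40 * ?L / s1) * (s1/10) + (40 * ?L / s1)\<^sup>2 * (n * (s1 * \<nu>)\<^sup>2) / p \<le> - 3 * ?L"
        using s1 by simp
      then show ?thesis by (intro mult_left_mono) auto
    qed
    also have "\<dots> = 2 / (real n)\<^sup>2" using n(4) unfolding e3' by (simp add: power2_eq_square power3_eq_cube)
    finally show ?thesis .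
  qed
  have b3: "measure_pmf.prob ?M B3 \<le> 2 / (real n)\<^sup>2"
  proof -
    \<comment> \<open>The minimal length 20 ln n / p makes each interval fail with probability at
      most 2 n^(-5), against n^2 intervals.\<close>
    have "measure_pmf.prob ?M B3 \<le> real n * real n * (2 * exp (- (p * (20 * ?L / p)) / 4))"
    proof -
      have "B3 = {\<omega>. \<exists>j<n. \<exists>l\<le>n. 20 * ?L / p \<le> real l \<and> 2 * p * real l < real (card ({i. i < n \<and> \<omega> i} \<inter> {j..<j+l}))}"
        unfolding B3_def count_event_def by (meson not_less)
      then show ?thesis by (simp only:) (rule bernoulli_interval_counts, use p L in auto)
    qed
    also have "\<dots> = real n * real n * (2 * (exp (- 3 * ?L) * exp (- 2 * ?L)))"
      using p by (simp add: mult_exp_exp)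
    also have "\<dots> \<le> real n * real n * (2 * (exp (- 3 * ?L) * exp (- 1 * ?L)))"
      using L by (intro mult_left_mono) auto
    also have "exp (- 1 * ?L) = 1 / real n" using n(4) by (simp add: exp_minus divide_inverse)
    also have "real n * real n * (2 * (exp (- 3 * ?L) * (1 / real n))) = 2 / (real n)\<^sup>2"
      using n(4) unfolding e3' by (simp add: power2_eq_square power3_eq_cube)
    finally show ?thesis .
  qed
  have "measure_pmf.prob ?M (B1 \<union> B2 \<union> B3) \<le> measure_pmf.prob ?M (B1 \<union> B2) + measure_pmf.prob ?M B3"
    by (rule measure_Un_le) auto
  also have "measure_pmf.prob ?M (B1 \<union> B2) \<le> measure_pmf.prob ?M B1 + measure_pmf.prob ?M B2"
    by (rule measure_Un_le) auto
  finally have "measure_pmf.prob ?M (B1 \<union> B2 \<union> B3) \<le> 6 / (real n)\<^sup>2" using b1 b2 b3 by simp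
  moreover have "measure_pmf.prob ?M (- (B1 \<union> B2 \<union> B3)) = 1 - measure_pmf.prob ?M (B1 \<union> B2 \<union> B3)"
    using measure_pmf.prob_compl[of "B1 \<union> B2 \<union> B3" ?M] by (simp add: Compl_eq_Diff_UNIV)
  ultimately show ?thesis unfolding ev by simp
qed

subsection \<open>Runs of the algorithm\<close>

lemma mmul_diagm: "j < r \<Longrightarrow> mmul r X (diagm d) a j = X a j * complex_of_real (d j)"
proof -
  assume j: "j < r"
  have "mmul r X (diagm d) a j = (\<Sum>l<r. if l = j then X a l * complex_of_real (d l) else 0)"
    unfolding mmul_def diagm_def by (intro sum.cong refl) auto
  then show ?thesis using j by simp
qed

lemma fro2_mmul_diagm_sqrt:
  assumes "\<And>j. j < r \<Longrightarrow> 0 \<le> \<sigma> j"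
  shows "fro2 m r (mmul r X (diagm (\<lambda>i. sqrt (\<sigma> i)))) = (\<Sum>a<m. \<Sum>j<r. \<sigma> j * (cmod (X a j))\<^sup>2)"
  unfolding fro2_def using assms
  by (intro sum.cong refl) (simp add: mmul_diagm norm_mult power_mult_distrib mult.commute)

lemma qp_cong: "mat_eq n1 n2 X X' \<Longrightarrow> qp n1 n2 X Y = qp n1 n2 X' Y"
  unfolding qp_def by (simp add: Gadj_cong[of n1 n2 X X'] ip_cong[of n1 n2 X X' Y Y] mat_eq_def)

lemma Dinv_Dop: "1 \<le> n1 \<Longrightarrow> 1 \<le> n2 \<Longrightarrow> i < n1 + n2 - 1 \<Longrightarrow> Dinv n1 n2 (Dop n1 n2 x) i = x i"
  using vsig_pos[of n1 n2 i] by (simp add: Dinv_def Dop_def)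

lemma qp_hank: "1 \<le> n1 \<Longrightarrow> 1 \<le> n2 \<Longrightarrow> qp n1 n2 (hank x) Y = 0"
proof -
  assume n: "1 \<le> n1" "1 \<le> n2"
  have "ip n1 n2 (hank x) Y = ip n1 n2 (Gop n1 n2 (Dop n1 n2 x)) Y"
    by (rule ip_cong) (use n in \<open>auto simp: Gop_def hank_def Dinv_Dop\<close>)
  then show ?thesis by (simp add: qp_def Gop_adjoint Gadj_hank)
qed

section \<open>Scales of a problem instance\<close>

text \<open>An instance with the constants made explicit. The lower bound on \<gamma> lets the
  thresholding keep at least as many entries as there are outliers, the upper bound limits the false
  alarms; n \<ge> 3 makes ln n at least 1.\<close>

locale hsgd_problem =
  fixes n1 n2 r :: nat and \<mu> :: real and xn wn :: cvec and U V :: cmat and \<sigma> :: "nat \<Rightarrow> real"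
    and p \<alpha> ct :: real and \<gamma> :: "nat \<Rightarrow> real"
  assumes dims: "1 \<le> n1" "1 \<le> n2" "1 \<le> r" and n3: "3 \<le> n1 + n2 - 1"
    and svd: "compact_svd n1 n2 r (hank xn) U \<sigma> V"
    and incU: "norm2inf n1 r U \<le> sqrt (\<mu> * cs_of n1 n2 * real r / real (n1 + n2 - 1))"
    and incV: "norm2inf n2 r V \<le> sqrt (\<mu> * cs_of n1 n2 * real r / real (n1 + n2 - 1))"
    and p: "0 < p" "p \<le> 1"
    and rate: "1000000 * (cs_of n1 n2)\<^sup>2 * \<mu>\<^sup>2 * (real r)\<^sup>2 * ln (real (n1 + n2 - 1)) / real (n1 + n2 - 1) \<le> p"
    and outl: "\<alpha> \<le> (1/3000) / (cs_of n1 n2 * \<mu> * real r * (\<sigma> 0 / \<sigma> (r - 1))\<^sup>2)"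
    and \<gamma>: "\<And>k. 1 \<le> \<gamma> k" "\<And>k. \<gamma> k \<le> 2"
    and ct: "0 < ct" "ct \<le> 1 / 20000"
begin

definition "n = n1 + n2 - 1"
definition "\<nu> = \<mu> * cs_of n1 n2 * real r / real n"
definition "s1 = \<sigma> 0"
definition "sr = \<sigma> (r - 1)"
definition "D = diagm (\<lambda>i. sqrt (\<sigma> i))"
definition "Lnat = mmul r U D"
definition "Rnat = mmul r V D"
definition "f = Dop n1 n2 (\<lambda>i. xn i + wn i)"

lemma n: "n1 + n2 - 1 = n" "3 \<le> n" "n1 \<le> n" "n2 \<le> n" "a < n1 \<Longrightarrow> b < n2 \<Longrightarrow> a + b < n"
    "n1 + n2 - Suc 0 = n"
  using n3 dims by (auto simp: n_def)

lemma svdf: "svd_form n1 n2 r (hank xn) U \<sigma> V" and \<sigma>pos: "i < r \<Longrightarrow> 0 < \<sigma> i"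
  using svd by (auto simp: compact_svd_def)

lemma orth: "orthcols n1 r U" "orthcols n2 r V"
  using svdf by (auto simp: svd_form_def)

lemma sr: "0 < sr" "sr \<le> s1" "0 < s1"
  using \<sigma>pos[of "r - 1"] \<sigma>pos[of 0] svd_mono[OF svdf, of 0 "r - 1"] dims by (auto simp: sr_def s1_def)

lemma \<sigma>_bounds: "j < r \<Longrightarrow> sr \<le> \<sigma> j" "j < r \<Longrightarrow> \<sigma> j \<le> s1"
  using svd_mono[OF svdf, of j "r - 1"] svd_mono[OF svdf, of 0 j] by (auto simp: sr_def s1_def)

lemma incoherence:
  assumes "norm2inf m r X \<le> sqrt (\<mu> * cs_of n1 n2 * real r / real (n1 + n2 - 1))" "1 \<le> m"
  shows "0 \<le> \<nu> \<and> (\<forall>a<m. rowsq r X a \<le> \<nu>)"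
proof -
  have le: "norm2inf m r X \<le> sqrt \<nu>" using assms(1) by (simp add: \<nu>_def n_def)
  have n0: "0 \<le> norm2inf m r X"
    unfolding norm2inf_def using assms(2)
    by (intro order_trans[OF _ Max_ge[of _ "sqrt (\<Sum>j<r. (cmod (X 0 j))\<^sup>2)"]]) (auto simp: sum_nonneg)
  have \<nu>: "0 \<le> \<nu>" using order_trans[OF n0 le] by simp
  have "(norm2inf m r X)\<^sup>2 \<le> (sqrt \<nu>)\<^sup>2" by (rule power_mono[OF le n0])
  then show ?thesis using \<nu> norm2inf_sq_le_iff[OF assms(2) \<nu>] by simp
qed

lemma \<nu>: "0 \<le> \<nu>" and rowU: "a < n1 \<Longrightarrow> rowsq r U a \<le> \<nu>" and rowV: "b < n2 \<Longrightarrow> rowsq r V b \<le> \<nu>"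
  using incoherence[OF incU dims(1)] incoherence[OF incV dims(2)] by auto

text \<open>A unit column is spread over m rows of square at most \<nu>. For U and V this gives c_s
  \<le> \<tau> in \<open>cs_le\<close>, the source of the lower bounds on incoherence used
  below.\<close>

lemma rows_sum:
  assumes "orthcols m r X" "\<And>a. a < m \<Longrightarrow> rowsq r X a \<le> \<nu>"
  shows "1 \<le> real m * \<nu>"
proof -
  have "1 = nsq {..<m} (\<lambda>a. X a 0)" using orthcols_col[OF assms(1), of 0] dims by simp
  also have "\<dots> \<le> (\<Sum>a<m. rowsq r X a)"
    unfolding nsq_def rowsq_def using dims by (intro sum_mono member_le_sum) auto
  also have "\<dots> \<le> (\<Sum>a<m. \<nu>)" by (intro sum_mono assms(2)) auto
  finally show ?thesis by simp
qed

lemma \<tau>_def: "real n * \<nu> = cs_of n1 n2 * \<mu> * real r"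
  using n by (simp add: \<nu>_def)

lemma cs_le: "cs_of n1 n2 \<le> real n * \<nu>"
proof -
  have "real n / real n1 \<le> real n * \<nu>"
    using rows_sum[OF orth(1) rowU] dims mult_left_mono[of 1 "real n1 * \<nu>" "real n"] by (simp add: divide_le_eq ac_simps)
  moreover have "real n / real n2 \<le> real n * \<nu>"
    using rows_sum[OF orth(2) rowV] dims mult_left_mono[of 1 "real n2 * \<nu>" "real n"] by (simp add: divide_le_eq ac_simps)
  ultimately show ?thesis by (simp add: cs_of_def n)
qed

lemma cs: "1 \<le> cs_of n1 n2" "real n / cs_of n1 n2 \<le> real n1" "real n / cs_of n1 n2 \<le> real n2"
proof -
  have "1 \<le> real n / real n1" using n dims by (simp add: le_divide_eq)
  then show c: "1 \<le> cs_of n1 n2" by (simp add: cs_of_def n)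
  have "real n / real n1 \<le> cs_of n1 n2" "real n / real n2 \<le> cs_of n1 n2" by (simp_all add: cs_of_def n)
  then show "real n / cs_of n1 n2 \<le> real n1" "real n / cs_of n1 n2 \<le> real n2"
    using c dims by (simp_all add: divide_le_eq ac_simps)
qed

lemma n\<nu>: "1 \<le> real n * \<nu>" using cs_le cs(1) by linarith

lemma ln_n: "1 \<le> ln (real n)"
proof -
  have "exp 1 \<le> real n" using n(2) by (intro order_trans[OF exp_le]) simp
  then show ?thesis using n(2) by (subst ln_ge_iff) auto
qed

lemma rate2: "1000000 * (n * \<nu>\<^sup>2 * ln n) \<le> p"
proof -
  have "(cs_of n1 n2)\<^sup>2 * \<mu>\<^sup>2 * (real r)\<^sup>2 = (real n * \<nu>)\<^sup>2" by (simp add: \<tau>_def power_mult_distrib)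
  then have "1000000 * (cs_of n1 n2)\<^sup>2 * \<mu>\<^sup>2 * (real r)\<^sup>2 * ln (real n) / real n = 1000000 * ((real n * \<nu>)\<^sup>2 * ln (real n) / real n)"
    by (simp add: mult.assoc)
  also have "(real n * \<nu>)\<^sup>2 * ln (real n) / real n = n * \<nu>\<^sup>2 * ln n" using n(2) by (simp add: power2_eq_square)
  finally show ?thesis using rate by (simp add: n)
qed

lemma rate1: "1000000 * (\<nu> * ln n) \<le> p"
proof -
  have "\<nu> * ln n * 1 \<le> \<nu> * ln n * (real n * \<nu>)" using n\<nu> \<nu> ln_n by (intro mult_left_mono) auto
  also have "\<dots> = n * \<nu>\<^sup>2 * ln n" by (simp add: power2_eq_square)
  finally show ?thesis using rate2 by linarith
qed

text \<open>With \<kappa> squared the left side is even at most \<open>sr\<close>^2 / (3000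
  \<open>s1\<close>).\<close>

lemma outl': "\<alpha> * real n * \<nu> * s1 \<le> sr / 3000"
proof -
  let ?\<kappa> = "s1 / sr"
  have t: "0 < real n * \<nu>" using n\<nu> by linarith
  have "\<alpha> \<le> (1/3000) / (real n * \<nu> * ?\<kappa>\<^sup>2)" using outl by (simp only: \<tau>_def s1_def sr_def)
  then have "\<alpha> * (real n * \<nu> * s1) \<le> (1/3000) / (real n * \<nu> * ?\<kappa>\<^sup>2) * (real n * \<nu> * s1)"
    using t sr by (intro mult_right_mono) auto
  also have "\<dots> = (1/3000) * (sr * (sr / s1))"
  proof -
    have "x / (t * (s / u)\<^sup>2) * (t * s) = x * (u * (u / s))" if "t \<noteq> 0" "s \<noteq> 0" "u \<noteq> 0" for x t s u :: real
      using that by (simp add: power2_eq_square field_simps)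
    moreover have "real n * \<nu> \<noteq> 0" "s1 \<noteq> 0" "sr \<noteq> 0" using t sr by linarith+
    ultimately show ?thesis by blast
  qed
  also have "\<dots> \<le> (1/3000) * (sr * 1)" using sr by (intro mult_left_mono) auto
  finally show ?thesis by (simp add: mult.assoc)
qed

lemma hank_eq: "mat_eq n1 n2 (mmul r Lnat (ctr Rnat)) (hank xn)"
  unfolding mat_eq_def
proof (intro allI impI)
  fix a b assume ab: "a < n1" "b < n2"
  have "mmul r Lnat (ctr Rnat) a b = (\<Sum>l<r. complex_of_real (\<sigma> l) * (U a l * cnj (V b l)))"
    unfolding mmul_def[of r Lnat] ctr_def
  proof (intro sum.cong refl)
    fix l assume l: "l \<in> {..<r}"
    then have "complex_of_real (sqrt (\<sigma> l)) * complex_of_real (sqrt (\<sigma> l)) = complex_of_real (\<sigma> l)"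
      using \<sigma>pos[of l] by (simp flip: of_real_mult)
    then show "Lnat a l * cnj (Rnat b l) = complex_of_real (\<sigma> l) * (U a l * cnj (V b l))"
      using l by (simp add: Lnat_def Rnat_def D_def mmul_diagm ac_simps)
  qed
  then show "mmul r Lnat (ctr Rnat) a b = hank xn a b" using svd_entry[OF svdf ab] by simp
qed

lemma fro2_D_up: "fro2 m r (mmul r X D) \<le> s1 * fro2 m r X"
proof -
  have "fro2 m r (mmul r X D) = (\<Sum>a<m. \<Sum>j<r. \<sigma> j * (cmod (X a j))\<^sup>2)"
    unfolding D_def by (rule fro2_mmul_diagm_sqrt) (use \<sigma>pos in \<open>auto intro: less_imp_le\<close>)
  also have "\<dots> \<le> (\<Sum>a<m. \<Sum>j<r. s1 * (cmod (X a j))\<^sup>2)"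
    by (intro sum_mono mult_right_mono \<sigma>_bounds) auto
  finally show ?thesis by (simp add: fro2_def sum_distrib_left)
qed

lemma fro2_D_lo: "sr * fro2 m r X \<le> fro2 m r (mmul r X D)"
proof -
  have "sr * fro2 m r X = (\<Sum>a<m. \<Sum>j<r. sr * (cmod (X a j))\<^sup>2)" by (simp add: fro2_def sum_distrib_left)
  also have "\<dots> \<le> (\<Sum>a<m. \<Sum>j<r. \<sigma> j * (cmod (X a j))\<^sup>2)"
    by (intro sum_mono mult_right_mono \<sigma>_bounds) auto
  also have "\<dots> = fro2 m r (mmul r X D)"
    unfolding D_def by (rule fro2_mmul_diagm_sqrt[symmetric]) (use \<sigma>pos in \<open>auto intro: less_imp_le\<close>)
  finally show ?thesis .
qed

lemma rowsq_D: "rowsq r (mmul r X D) a \<le> s1 * rowsq r X a"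
  using fro2_D_up[of 1 "\<lambda>_ j. X a j"] by (simp add: fro2_def rowsq_def mmul_def)

text \<open>Every signal entry is an entry of the incoherent matrix; the position chosen on its
  antidiagonal has the largest admissible row index.\<close>

lemma xn_bound: "i < n \<Longrightarrow> cmod (xn i) \<le> s1 * \<nu>"
proof -
  assume i: "i < n"
  define a where "a = min i (n1 - 1)"
  define b where "b = i - a"
  have ab: "a < n1" "b < n2" "a + b = i" using i dims by (auto simp: a_def b_def n_def)
  have "xn i = mmul r Lnat (ctr Rnat) a b" using hank_eq ab by (simp add: mat_eq_def hank_def)
  then have "(cmod (xn i))\<^sup>2 \<le> rowsq r Lnat a * rowsq r Rnat b" using mmul_entry_le[of r Lnat Rnat a b] by simp
  also have "\<dots> \<le> (s1 * \<nu>) * (s1 * \<nu>)"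
  proof (intro mult_mono)
    show "rowsq r Lnat a \<le> s1 * \<nu>" "rowsq r Rnat b \<le> s1 * \<nu>"
      unfolding Lnat_def Rnat_def using rowU[OF ab(1)] rowV[OF ab(2)] sr
      by (auto intro!: order_trans[OF rowsq_D] mult_left_mono)
  qed (use sr \<nu> in auto)
  finally have "(cmod (xn i))\<^sup>2 \<le> (s1 * \<nu>)\<^sup>2" by (simp only: power2_eq_square)
  then show ?thesis by (rule power2_le_imp_le) (use sr \<nu> in simp)
qed

lemma sampling_prob:
  "1 - 6 / (real n)\<^sup>2 \<le> measure_pmf.prob (bern_model n p) {\<omega>. sampling_event n1 n2 r p s1 xn U V \<omega>}"
  by (rule sampling_event_prob[OF n(1)[symmetric] dims(1,2) n(2) p sr(3) rowU rowV \<nu> xn_bound rate1 rate2])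

definition "l0 = nat \<lceil>20 * ln n / p\<rceil>"

text \<open>Rounding up at most doubles 20 ln n / p, which is at least 1. To fit into both sides of
  the matrix, the rate gives (40 ln n / p) \<tau>^2 \<le> n, and c_s \<le> \<tau>^2 turns this into
  \<open>l0\<close> \<le> n / c_s.\<close>

lemma l0: "20 * ln n / p \<le> real l0" "real l0 \<le> 40 * ln n / p" "1 \<le> l0" "l0 \<le> n1" "l0 \<le> n2"
proof -
  let ?y = "20 * ln n / p"
  have y: "1 \<le> ?y" using p ln_n by (simp add: le_divide_eq)
  show 1: "?y \<le> real l0" unfolding l0_def using y by linarith
  have "real l0 \<le> ?y + 1" unfolding l0_def using y by linarith
  also have "\<dots> \<le> 40 * ln n / p" using y by simp
  finally show 2: "real l0 \<le> 40 * ln n / p" .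
  show "1 \<le> l0" using 1 y by linarith
  have "real n * (40 * ln n / p) * \<nu>\<^sup>2 \<le> 1"
  proof -
    have "0 \<le> n * \<nu>\<^sup>2 * ln n" using ln_n by simp
    then have "40 * (n * \<nu>\<^sup>2 * ln n) \<le> p" using rate2 by linarith
    then show ?thesis using p by (simp add: field_simps)
  qed
  then have "40 * ln n / p * (real n * \<nu>)\<^sup>2 \<le> real n"
  proof -
    assume a: "real n * (40 * ln n / p) * \<nu>\<^sup>2 \<le> 1"
    have "40 * ln n / p * (real n * \<nu>)\<^sup>2 = real n * (real n * (40 * ln n / p) * \<nu>\<^sup>2)"
      by (simp add: power2_eq_square)
    also have "\<dots> \<le> real n * 1" by (rule mult_left_mono[OF a]) simp
    finally show ?thesis by simp
  qed
  moreover have "cs_of n1 n2 \<le> (real n * \<nu>)\<^sup>2"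
    using cs_le n\<nu> mult_left_mono[of 1 "real n * \<nu>" "real n * \<nu>"] by (simp add: power2_eq_square)
  then have "40 * ln n / p * cs_of n1 n2 \<le> 40 * ln n / p * (real n * \<nu>)\<^sup>2"
    using p ln_n by (intro mult_left_mono) auto
  ultimately have "40 * ln n / p * cs_of n1 n2 \<le> real n" by linarith
  then have "40 * ln n / p \<le> real n / cs_of n1 n2" using cs(1) by (simp add: le_divide_eq)
  then show "l0 \<le> n1" "l0 \<le> n2" using 2 cs(2,3) by linarith+
qed

end

section \<open>A run on a good sample\<close>

locale hsgd_sample = hsgd_problem +
  fixes \<omega> :: "nat \<Rightarrow> bool" and \<Omega> :: "nat set"
  assumes \<Omega>_def: "\<Omega> = {i. i < n1 + n2 - 1 \<and> \<omega> i}"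
    and event: "sampling_event n1 n2 r p (\<sigma> 0) xn U V \<omega>"
    and sparse: "real (card {i \<in> \<Omega>. wn i \<noteq> 0}) \<le> \<alpha> * p * real (n1 + n2 - 1)"
begin

lemma \<Omega>: "\<Omega> = {i. i < n \<and> \<omega> i}" "\<Omega> \<subseteq> {..<n}" "finite \<Omega>"
  by (auto simp: \<Omega>_def n_def)

lemma sum_xi: "(\<Sum>i<n. xi p (\<omega> i) * c i) = (\<Sum>i\<in>\<Omega>. c i) / p - (\<Sum>i<n. c i)"
proof -
  have "(\<Sum>i<n. xi p (\<omega> i) * c i) = (\<Sum>i<n. if \<omega> i then c i / p else 0) - (\<Sum>i<n. c i)"
    unfolding sum_subtractf[symmetric] by (intro sum.cong refl) (simp add: xi_def algebra_simps)
  also have "(\<Sum>i<n. if \<omega> i then c i / p else 0) = (\<Sum>i\<in>{i\<in>{..<n}. \<omega> i}. c i / p)"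
    by (rule sum.inter_filter[symmetric]) simp
  also have "{i\<in>{..<n}. \<omega> i} = \<Omega>" by (auto simp: \<Omega>)
  finally show ?thesis by (simp add: sum_divide_distrib)
qed

lemma event_tangent:
  "\<bar>(\<Sum>i\<in>\<Omega>. (cmod (Gadj n1 n2 (madd (mmul r U (ctr X)) (mmul r Y (ctr V))) i))\<^sup>2) / p
        - (\<Sum>i<n. (cmod (Gadj n1 n2 (madd (mmul r U (ctr X)) (mmul r Y (ctr V))) i))\<^sup>2)\<bar>
        \<le> (fro2 n2 r X + fro2 n1 r Y) / 100"
proof -
  let ?\<theta> = "\<lambda>z. case z of Inl (b, l) \<Rightarrow> cnj (X b l) | Inr (a, l) \<Rightarrow> Y a l"
  have "\<bar>\<Sum>i<n. xi p (\<omega> i) * (cmod (\<Sum>z\<in>tidx n1 n2 r. tcoord n1 n2 U V i z * ?\<theta> z))\<^sup>2\<bar> \<le> 1/100 * nsq (tidx n1 n2 r) ?\<theta>"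
    using event unfolding sampling_event_def tangent_event_def n by blast
  then show ?thesis unfolding tcoord_Gadj tidx_nsq sum_xi by simp
qed

lemma event_op: "cmod (\<Sum>a<n1. \<Sum>b<n2. cnj (u a) * (complex_of_real (xi p (\<omega> (a + b))) * xn (a + b)) * v b)
        \<le> s1/10 * (sqrt (nsq {..<n1} u) * sqrt (nsq {..<n2} v))"
  using event unfolding sampling_event_def hankel_event_def s1_def by blast

lemma event_count: "l0 \<le> l \<Longrightarrow> l \<le> n \<Longrightarrow> real (card (\<Omega> \<inter> {j..<j+l})) \<le> 2 * p * real l"
proof (cases "j < n")
  case True
  assume l: "l0 \<le> l" "l \<le> n"
  then have "20 * ln (real n) / p \<le> real l" using l0(1) by linarith
  then show ?thesis using event l True unfolding sampling_event_def count_event_def n \<Omega>(1) by blast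
next
  case False
  then have "\<Omega> \<inter> {j..<j+l} = {}" using \<Omega>(2) by auto
  then show ?thesis using p by simp
qed

text \<open>Each end holds at most 2 p \<open>l0\<close> samples, together at most 160 ln n; times
  \<nu> this is far below p by the rate.\<close>

lemma corner_count: "real (card {i\<in>\<Omega>. \<not> (l0 \<le> i \<and> i + l0 < n)}) * \<nu> \<le> p / 1000"
proof -
  let ?C = "{i\<in>\<Omega>. \<not> (l0 \<le> i \<and> i + l0 < n)}"
  have ln: "l0 \<le> n" using l0(4) n(3) by linarith
  have "?C \<subseteq> (\<Omega> \<inter> {0..<0+l0}) \<union> (\<Omega> \<inter> {n-l0..<n-l0+l0})" using \<Omega>(2) ln by auto
  then have "card ?C \<le> card ((\<Omega> \<inter> {0..<0+l0}) \<union> (\<Omega> \<inter> {n-l0..<n-l0+l0}))" by (intro card_mono) auto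
  also have "\<dots> \<le> card (\<Omega> \<inter> {0..<0+l0}) + card (\<Omega> \<inter> {n-l0..<n-l0+l0})" by (rule card_Un_le)
  finally have "real (card ?C) \<le> real (card (\<Omega> \<inter> {0..<0+l0})) + real (card (\<Omega> \<inter> {n-l0..<n-l0+l0}))" by linarith
  also have "\<dots> \<le> 4 * p * real l0" using event_count[OF order_refl ln, of 0] event_count[OF order_refl ln, of "n - l0"] by linarith
  also have "\<dots> \<le> 4 * p * (40 * ln n / p)" using l0(2) p by (intro mult_left_mono) auto
  also have "\<dots> = 160 * ln n" using p by simp
  finally have "real (card ?C) * \<nu> \<le> 160 * ln n * \<nu>" using \<nu> by (rule mult_right_mono)
  also have "\<dots> = 160 * (\<nu> * ln n)" by simp
  also have "\<dots> \<le> p / 1000" using rate1 mult_nonneg_nonneg[of \<nu> "ln n"] \<nu> ln_n by linarith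
  finally show ?thesis .
qed

definition "K = {i \<in> \<Omega>. wn i \<noteq> 0}"

lemma K: "K \<subseteq> \<Omega>" "real (card K) \<le> \<alpha> * p * n" "0 \<le> \<alpha> * p * n"
proof -
  show "K \<subseteq> \<Omega>" by (auto simp: K_def)
  show k: "real (card K) \<le> \<alpha> * p * n" using sparse by (simp only: K_def n)
  show "0 \<le> \<alpha> * p * n" using k by (rule order_trans[OF of_nat_0_le_iff])
qed

text \<open>The floor in \<open>keep\<close> is harmless because the number of outliers is an
  integer at most \<alpha> p n.\<close>

lemma keep_bounds:
  assumes "1 \<le> c" "c \<le> 2"
  shows "card K \<le> keep (c * \<alpha> * p) n" "real (keep (c * \<alpha> * p) n) \<le> 2 * (\<alpha> * p * n)"
proof -
  have e: "c * \<alpha> * p * real n = c * (\<alpha> * p * n)" by simp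
  have lo: "\<alpha> * p * n \<le> c * (\<alpha> * p * n)" using mult_right_mono[OF assms(1) K(3)] by simp
  have hi: "c * (\<alpha> * p * n) \<le> 2 * (\<alpha> * p * n)" by (rule mult_right_mono[OF assms(2) K(3)])
  have "int (card K) \<le> \<lfloor>c * (\<alpha> * p * n)\<rfloor>" using K(2) lo by (simp add: le_floor_iff)
  then show "card K \<le> keep (c * \<alpha> * p) n" unfolding keep_def e by linarith
  have "real (nat \<lfloor>c * (\<alpha> * p * n)\<rfloor>) \<le> c * (\<alpha> * p * n)" using lo K(3) by linarith
  then show "real (keep (c * \<alpha> * p) n) \<le> 2 * (\<alpha> * p * n)" unfolding keep_def e using hi by linarith
qed

text \<open>The factor 3 counts at most 2 \<alpha> p n kept entries and \<alpha> p n
  outliers.\<close>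

lemma outl_p: "3 * (\<alpha> * p * n) * \<nu> * s1 \<le> p * sr / 1000"
proof -
  have "3 * p * (\<alpha> * real n * \<nu> * s1) \<le> 3 * p * (sr / 3000)" using outl' p by (intro mult_left_mono) auto
  then show ?thesis by (simp add: ac_simps)
qed

lemma Dop_add: "Dop n1 n2 (\<lambda>i. x i + y i) i = Dop n1 n2 x i + Dop n1 n2 y i"
  by (simp add: Dop_def distrib_left)

lemma truth_Q: "orthcols r r Q \<Longrightarrow> mat_eq n1 n2 (mmul r (mmul r U (mmul r D Q)) (ctr (mmul r V (mmul r D Q)))) (hank xn)"
proof -
  assume Q: "orthcols r r Q"
  have "mmul r (mmul r U (mmul r D Q)) (ctr (mmul r V (mmul r D Q))) = mmul r Lnat (mmul r (mmul r Q (ctr Q)) (ctr Rnat))"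
    unfolding Lnat_def Rnat_def by (simp only: ctr_mmul mmul_assoc)
  also have "\<dots> = mmul r Lnat (ctr Rnat)"
    unfolding mmul_def[of r Lnat] using orthcols_ctr[OF Q]
    by (intro ext sum.cong refl arg_cong2[of _ _ _ _ "(*)"] mmul_idm_left) (auto simp: orthcols_def)
  finally show ?thesis using hank_eq by simp
qed

lemma ctr_D: "ctr D = D"
  by (auto simp: ctr_def D_def diagm_def fun_eq_iff)

text \<open>Rotations preserve Frobenius norms and the events involve only U and V. One good sample
  thus serves all rotations, and the alignment may change at every step.\<close>

lemma sampled_hankel: "orthcols r r Q \<Longrightarrow> sampled_hankel n1 n2 r l0 p \<nu> s1 sr \<Omega> U V (mmul r D Q)"
proof
  assume Q: "orthcols r r Q"
  have rot: "fro2 m r (mmul r A (ctr (mmul r D Q))) = fro2 m r (mmul r (mmul r A (ctr Q)) D)"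
    "fro2 m r (mmul r A (ctr Q)) = fro2 m r A" "fro2 m r (mmul r A (mmul r D Q)) = fro2 m r (mmul r A D)" for m A
  proof -
    show "fro2 m r (mmul r A (ctr (mmul r D Q))) = fro2 m r (mmul r (mmul r A (ctr Q)) D)"
      by (simp only: ctr_mmul mmul_assoc ctr_D)
    show "fro2 m r (mmul r A (ctr Q)) = fro2 m r A" by (rule fro2_mmul_orth_right) (simp add: Q)
    show "fro2 m r (mmul r A (mmul r D Q)) = fro2 m r (mmul r A D)"
      unfolding mmul_assoc by (rule fro2_mmul_orth_right[OF orthcols_ctr[OF Q]])
  qed
  show "fro2 m r (mmul r A (ctr (mmul r D Q))) \<le> s1 * fro2 m r A" for m A
    using fro2_D_up[of m "mmul r A (ctr Q)"] by (simp only: rot)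
  show "sr * fro2 m r A \<le> fro2 m r (mmul r A (ctr (mmul r D Q)))" for m A
    using fro2_D_lo[of m "mmul r A (ctr Q)"] by (simp only: rot)
  show "fro2 m r (mmul r A (mmul r D Q)) \<le> s1 * fro2 m r A" for m A
    using fro2_D_up[of m A] by (simp only: rot)
  show "qp n1 n2 (mmul r (mmul r U (mmul r D Q)) (ctr (mmul r V (mmul r D Q)))) Y = 0" for Y
    using qp_cong[OF truth_Q[OF Q]] qp_hank dims by simp
  show "\<bar>(\<Sum>i\<in>\<Omega>. (cmod (Gadj n1 n2 (madd (mmul r U (ctr X)) (mmul r Y (ctr V))) i))\<^sup>2) / p
        - (\<Sum>i<n1+n2-1. (cmod (Gadj n1 n2 (madd (mmul r U (ctr X)) (mmul r Y (ctr V))) i))\<^sup>2)\<bar>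
        \<le> (fro2 n2 r X + fro2 n1 r Y) / 100" for X Y
    unfolding n by (rule event_tangent)
  show "real (card (\<Omega> \<inter> {j..<j+l})) \<le> 2 * p * real l" if "l0 \<le> l" "l \<le> n1 + n2 - 1" for j l
    using event_count that unfolding n by blast
  show "real (card {i\<in>\<Omega>. \<not> (l0 \<le> i \<and> i + l0 < n1+n2-1)}) * \<nu> \<le> p / 1000"
    unfolding n by (rule corner_count)
qed (use dims l0 p \<nu> sr orth rowU rowV \<Omega> in \<open>auto simp: n\<close>)

text \<open>Estimate minus truth is the Hankel matrix of the centred weights times x, bounded by the
  event, minus that of the thresholding error over p, bounded by its l1 norm: at most 2 \<alpha> p n
  entries of size 2 \<open>s1\<close> \<nu> / p. Thresholding after removal of the weights is what
  makes the noise level the uniform bound on x.\<close>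

lemma init_form:
  assumes thr: "hard_thr n (keep (\<alpha> * p) n) (Dinv n1 n2 (projO \<Omega> f)) v"
    and s0: "\<And>i. i < n \<Longrightarrow> s i = Dop n1 n2 v i"
  shows "cmod (bil n1 n2 u (mscale (complex_of_real (1 / p)) (Gop n1 n2 (\<lambda>i. projO \<Omega> f i - s i))) w - bil n1 n2 u (hank xn) w)
    \<le> s1 / 5 * (sqrt (nsq {..<n1} u) * sqrt (nsq {..<n2} w))"
proof -
  let ?q = "Dinv n1 n2 (projO \<Omega> f)" and ?N = "sqrt (nsq {..<n1} u) * sqrt (nsq {..<n2} w)"
  have kb: "card K \<le> keep (\<alpha> * p) n" "real (keep (\<alpha> * p) n) \<le> 2 * (\<alpha> * p * n)"
    using keep_bounds[of 1] by simp_all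
  have keep1: "real (keep (\<alpha> * p) n) \<le> \<alpha> * p * n"
    using K(3) unfolding keep_def by linarith
  have q1: "?q i = wn i - (- xn i)" if "i \<in> \<Omega>" for i
  proof -
    have "?q i = Dinv n1 n2 (Dop n1 n2 (\<lambda>i. xn i + wn i)) i" using that by (simp add: Dinv_def projO_def f_def)
    then show ?thesis using that \<Omega>(1) dims by (simp add: Dinv_Dop n(6))
  qed
  obtain J where J: "J \<subseteq> \<Omega>" "card J \<le> keep (\<alpha> * p) n + card K"
    and N0: "\<And>i. i \<in> \<Omega> \<Longrightarrow> i \<notin> J \<Longrightarrow> v i - wn i = 0"
    and NX: "\<And>X i. (\<And>i. i \<in> \<Omega> \<Longrightarrow> cmod (- xn i) \<le> X) \<Longrightarrow> i \<in> J \<Longrightarrow> cmod (v i - wn i) \<le> 2 * X"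
    and v0: "\<And>i. i < n \<Longrightarrow> i \<notin> \<Omega> \<Longrightarrow> v i = 0"
  proof (rule hard_thr_outliers[OF thr \<Omega>(2) K(1) kb(1), of wn "\<lambda>i. - xn i"])
    show "?q i = 0" if "i \<notin> \<Omega>" for i using that by (simp add: Dinv_def projO_def)
    show "wn i = 0" if "i \<in> \<Omega>" "i \<notin> K" for i using that by (simp add: K_def)
  qed (use q1 in auto)
  define h where "h i = (if i \<in> J then (v i - wn i) / complex_of_real p else 0)" for i
  have NX': "cmod (v i - wn i) \<le> 2 * (s1 * \<nu>)" if "i \<in> J" for i
    by (rule NX[OF _ that]) (use xn_bound \<Omega>(1) in auto)
  have entry: "mscale (complex_of_real (1 / p)) (Gop n1 n2 (\<lambda>i. projO \<Omega> f i - s i)) a b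
      = hank xn a b + complex_of_real (xi p (\<omega> (a + b))) * xn (a + b) - h (a + b)" if ab: "a < n1" "b < n2" for a b
  proof -
    let ?i = "a + b"
    have i: "?i < n" using n(5)[OF ab] .
    have "Dinv n1 n2 (\<lambda>i. projO \<Omega> f i - s i) ?i = ?q ?i - Dinv n1 n2 (Dop n1 n2 v) ?i"
      using s0[OF i] by (simp add: Dinv_def diff_divide_distrib)
    also have "Dinv n1 n2 (Dop n1 n2 v) ?i = v ?i" using i dims by (simp add: Dinv_Dop n(6))
    finally have e: "mscale (complex_of_real (1 / p)) (Gop n1 n2 (\<lambda>i. projO \<Omega> f i - s i)) a b
        = complex_of_real (1 / p) * (?q ?i - v ?i)" by (simp add: mscale_def Gop_def hank_def)
    show ?thesis
    proof (cases "?i \<in> \<Omega>")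
      case True
      then have w: "\<omega> ?i" using \<Omega>(1) by auto
      have hh: "h ?i = (v ?i - wn ?i) / complex_of_real p" using True N0[of ?i] by (simp add: h_def)
      show ?thesis unfolding e hh q1[OF True] using w p by (simp add: hank_def xi_def field_simps)
    next
      case False
      then have w: "\<not> \<omega> ?i" using \<Omega>(1) i by auto
      have hh: "h ?i = 0" "?q ?i = 0" using False J(1) by (auto simp: h_def Dinv_def projO_def)
      show ?thesis unfolding e hh v0[OF i False] using w by (simp add: hank_def xi_def)
    qed
  qed
  have "bil n1 n2 u (mscale (complex_of_real (1 / p)) (Gop n1 n2 (\<lambda>i. projO \<Omega> f i - s i))) w - bil n1 n2 u (hank xn) w
      = (\<Sum>a<n1. \<Sum>b<n2. cnj (u a) * (complex_of_real (xi p (\<omega> (a + b))) * xn (a + b)) * w b)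
        - (\<Sum>a<n1. \<Sum>b<n2. cnj (u a) * h (a + b) * w b)"
    unfolding bil_def sum_subtractf[symmetric]
    by (intro sum.cong refl) (simp only: entry lessThan_iff, simp add: algebra_simps)
  also have "cmod \<dots> \<le> s1/10 * ?N + (\<Sum>i<n. cmod (h i)) * ?N"
    using event_op[of u w] hankel_bil_sparse[where ?n1.0 = n1 and ?n2.0 = n2 and u = u and h = h and v = w]
    by (intro order_trans[OF norm_triangle_ineq4] add_mono) (simp_all add: n(6))
  also have "(\<Sum>i<n. cmod (h i)) \<le> s1 / 10"
  proof -
    have J': "J \<subseteq> {..<n}" using J(1) \<Omega>(2) by blast
    have "(\<Sum>i<n. cmod (h i)) = (\<Sum>i\<in>J. cmod (h i))"
      by (rule sum.mono_neutral_right) (use J' in \<open>auto simp: h_def\<close>)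
    also have "\<dots> \<le> (\<Sum>i\<in>J. 2 * (s1 * \<nu>) / p)"
      using NX' p by (intro sum_mono) (simp add: h_def norm_divide divide_right_mono)
    also have "\<dots> = real (card J) * (2 * (s1 * \<nu>) / p)" by simp
    also have "\<dots> \<le> (2 * (\<alpha> * p * n)) * (2 * (s1 * \<nu>) / p)"
      using J(2) keep1 K(2) sr \<nu> p by (intro mult_right_mono) auto
    also have "\<dots> = 4 * (\<alpha> * real n * \<nu> * s1)" using p by simp
    also have "\<dots> \<le> s1 / 10" using outl' sr by linarith
    finally show ?thesis .
  qed
  finally show ?thesis by (simp add: mult_right_mono algebra_simps)
qed

text \<open>Testing with top singular pairs on either side puts the largest singular value of the
  estimate between 4/5 and 6/5 of \<open>s1\<close>. The lower bounds make the truth feasible for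
  the constraints; the upper bounds make every iterate incoherent.\<close>

lemma init_bounds:
  assumes thr: "hard_thr n (keep (\<alpha> * p) n) (Dinv n1 n2 (projO \<Omega> f)) v"
    and s0: "\<And>i. i < n \<Longrightarrow> s i = Dop n1 n2 v i"
    and svd0: "trunc_svd n1 n2 r (mscale (complex_of_real (1 / p)) (Gop n1 n2 (\<lambda>i. projO \<Omega> f i - s i))) U0 \<sigma>0 V0"
  defines "BL \<equiv> 2 * \<mu> * real r * cs_of n1 n2 / real n * (opnorm n1 r (mmul r U0 (diagm (\<lambda>i. sqrt (\<sigma>0 i)))))\<^sup>2"
    and "BR \<equiv> 2 * \<mu> * real r * cs_of n1 n2 / real n * (opnorm n2 r (mmul r V0 (diagm (\<lambda>i. sqrt (\<sigma>0 i)))))\<^sup>2"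
  shows "s1 * \<nu> \<le> BL \<and> BL \<le> 3 * s1 * \<nu> \<and> s1 * \<nu> \<le> BR \<and> BR \<le> 3 * s1 * \<nu>"
proof -
  let ?M0 = "mscale (complex_of_real (1 / p)) (Gop n1 n2 (\<lambda>i. projO \<Omega> f i - s i))"
  let ?q = "min n1 n2"
  obtain Uf \<sigma>f Vf where r: "r \<le> ?q" and F: "svd_form n1 n2 ?q ?M0 Uf \<sigma>f Vf"
    and U0: "\<And>i j. j < r \<Longrightarrow> U0 i j = Uf i j" and V0: "\<And>i j. j < r \<Longrightarrow> V0 i j = Vf i j"
    and \<sigma>0: "\<And>i. i < r \<Longrightarrow> \<sigma>0 i = \<sigma>f i"
    using svd0 unfolding trunc_svd_def by blast
  have q: "1 \<le> ?q" using dims by simp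
  have sub: "orthcols m ?q X \<Longrightarrow> (\<And>i j. j < r \<Longrightarrow> Y i j = X i j) \<Longrightarrow> orthcols m r Y" for m X Y
    using r unfolding orthcols_iff by simp
  have oU0: "orthcols n1 r U0" by (rule sub[OF _ U0]) (use F in \<open>simp add: svd_form_def\<close>)
  have oV0: "orthcols n2 r V0" by (rule sub[OF _ V0]) (use F in \<open>simp add: svd_form_def\<close>)
  have nn: "0 \<le> \<sigma>0 i" "\<sigma>0 i \<le> \<sigma>0 0" if "i < r" for i
    using that r dims \<sigma>0[of i] \<sigma>0[of 0] svd_mono[OF F, of 0 i] F by (auto simp: svd_form_def)
  have c1: "nsq {..<n1} (\<lambda>a. Uf a 0) = 1" "nsq {..<n2} (\<lambda>a. Vf a 0) = 1"
    using F orthcols_col[of n1 ?q Uf 0] orthcols_col[of n2 ?q Vf 0] q by (auto simp: svd_form_def)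
  have c2: "nsq {..<n1} (\<lambda>a. U a 0) = 1" "nsq {..<n2} (\<lambda>a. V a 0) = 1"
    using orthcols_col[OF orth(1), of 0] orthcols_col[OF orth(2), of 0] dims by auto
  have up: "\<sigma>f 0 \<le> s1 + s1 / 5"
  proof -
    have "\<sigma>f 0 \<le> cmod (bil n1 n2 (\<lambda>a. Uf a 0) ?M0 (\<lambda>b. Vf b 0))"
      unfolding svd_bil_top[OF F q] by simp
    also have "\<dots> \<le> cmod (bil n1 n2 (\<lambda>a. Uf a 0) (hank xn) (\<lambda>b. Vf b 0)) + s1 / 5"
      using init_form[OF thr s0, of "\<lambda>a. Uf a 0" "\<lambda>b. Vf b 0"]
        norm_triangle_sub[of "bil n1 n2 (\<lambda>a. Uf a 0) ?M0 (\<lambda>b. Vf b 0)" "bil n1 n2 (\<lambda>a. Uf a 0) (hank xn) (\<lambda>b. Vf b 0)"]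
      unfolding c1 by simp
    also have "\<dots> \<le> s1 + s1 / 5"
      using svd_bil_le[OF svdf dims(3), of "\<lambda>a. Uf a 0" "\<lambda>b. Vf b 0"] by (simp add: c1 s1_def)
    finally show ?thesis .
  qed
  have lo: "s1 \<le> \<sigma>f 0 + s1 / 5"
  proof -
    have "s1 \<le> cmod (bil n1 n2 (\<lambda>a. U a 0) (hank xn) (\<lambda>b. V b 0))"
      unfolding svd_bil_top[OF svdf dims(3)] by (simp add: s1_def)
    also have "\<dots> \<le> cmod (bil n1 n2 (\<lambda>a. U a 0) ?M0 (\<lambda>b. V b 0)) + s1 / 5"
      using init_form[OF thr s0, of "\<lambda>a. U a 0" "\<lambda>b. V b 0"]
        norm_triangle_sub[of "bil n1 n2 (\<lambda>a. U a 0) (hank xn) (\<lambda>b. V b 0)" "bil n1 n2 (\<lambda>a. U a 0) ?M0 (\<lambda>b. V b 0)"]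
      unfolding c2 by (simp add: norm_minus_commute)
    also have "\<dots> \<le> \<sigma>f 0 + s1 / 5"
      using svd_bil_le[OF F q, of "\<lambda>a. U a 0" "\<lambda>b. V b 0"] by (simp add: c2)
    finally show ?thesis .
  qed
  have \<sigma>00: "\<sigma>0 0 = \<sigma>f 0" using \<sigma>0 dims by simp
  have "(opnorm m r (mmul r W (diagm (\<lambda>i. sqrt (\<sigma>0 i)))))\<^sup>2 = \<sigma>f 0" if "orthcols m r W" for m W
    using opnorm_scaled_orth[OF that dims(3), of \<sigma>0] nn nn[of 0] dims by (simp add: \<sigma>00)
  note oL = this[OF oU0] this[OF oV0]
  have c: "2 * \<mu> * real r * cs_of n1 n2 / real n = 2 * \<nu>" by (simp add: \<nu>_def)
  have 1: "s1 * \<nu> \<le> 2 * \<nu> * \<sigma>f 0"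
    using mult_left_mono[of s1 "2 * \<sigma>f 0" \<nu>] lo sr \<nu> by (simp add: ac_simps)
  have 2: "2 * \<nu> * \<sigma>f 0 \<le> 3 * s1 * \<nu>"
    using mult_left_mono[of "2 * \<sigma>f 0" "3 * s1" \<nu>] up sr \<nu> by (simp add: ac_simps)
  show ?thesis
    unfolding BL_def BR_def c oL using 1 2 by simp
qed

text \<open>The locale of a single step is entered with the rotation that is optimal for the current
  iterate, so that \<open>procr_gauge\<close> supplies its gauge condition.\<close>

lemma contraction:
  assumes rows: "\<And>a. a < n1 \<Longrightarrow> rowsq r L a \<le> 3 * s1 * \<nu>" "\<And>b. b < n2 \<Longrightarrow> rowsq r R b \<le> 3 * s1 * \<nu>"
    and near: "(dist_fac n1 n2 r Lnat Rnat L R)\<^sup>2 \<le> sr / 10000"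
    and thr: "hard_thr n (keep (\<gamma> k * \<alpha> * p) n) (projO \<Omega> (\<lambda>i. f i - Gadj n1 n2 (mmul r L (ctr R)) i)) v"
    and s: "\<And>i. i < n \<Longrightarrow> s i = v i"
    and BL: "s1 * \<nu> \<le> BL" and BR: "s1 * \<nu> \<le> BR"
    and L': "is_row_proj n1 r BL (msub L (mscale (complex_of_real (ct / s1)) (gradL n1 n2 r p (1/16) \<Omega> f s L R))) L'"
    and R': "is_row_proj n2 r BR (msub R (mscale (complex_of_real (ct / s1)) (gradR n1 n2 r p (1/16) \<Omega> f s L R))) R'"
  shows "(dist_fac n1 n2 r Lnat Rnat L' R')\<^sup>2 \<le> (1 - ct / s1 * sr / 64) * (dist_fac n1 n2 r Lnat Rnat L R)\<^sup>2"
proof -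
  obtain Q where Q: "orthcols r r Q" and dQ: "(dist_fac n1 n2 r Lnat Rnat L R)\<^sup>2 = procr n1 n2 r Lnat Rnat L R Q"
    and Qmin: "\<And>P. orthcols r r P \<Longrightarrow> procr n1 n2 r Lnat Rnat L R Q \<le> procr n1 n2 r Lnat Rnat L R P"
    using dist_fac_attained by blast
  define S where "S = mmul r D Q"
  define X where "X = mmul r U S"
  define Y where "Y = mmul r V S"
  have XY: "mmul r Lnat Q = X" "mmul r Rnat Q = Y" by (simp_all only: X_def Y_def S_def Lnat_def Rnat_def mmul_assoc)
  interpret sh: sampled_hankel n1 n2 r l0 p \<nu> s1 sr \<Omega> U V S
    unfolding S_def by (rule sampled_hankel[OF Q])
  define Md where "Md = msub (mmul r L (ctr R)) (mmul r X (ctr Y))"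
  have GX: "Gadj n1 n2 (mmul r X (ctr Y)) i = Dop n1 n2 xn i" for i
    using Gadj_cong[OF truth_Q[OF Q]] by (simp add: X_def Y_def S_def Gadj_hank)
  have fi: "f i = Dop n1 n2 xn i + Dop n1 n2 wn i" for i unfolding f_def by (rule Dop_add)
  have GM: "Gadj n1 n2 Md i = Gadj n1 n2 (mmul r L (ctr R)) i - Dop n1 n2 xn i" for i
    unfolding Md_def Gadj_msub GX ..
  have kb: "card K \<le> keep (\<gamma> k * \<alpha> * p) n" "real (keep (\<gamma> k * \<alpha> * p) n) \<le> 2 * (\<alpha> * p * n)"
    by (rule keep_bounds[OF \<gamma>])+
  obtain J where J: "J \<subseteq> \<Omega>" "card J \<le> keep (\<gamma> k * \<alpha> * p) n + card K"
    and N0: "\<And>i. i \<in> \<Omega> \<Longrightarrow> i \<notin> J \<Longrightarrow> v i - Dop n1 n2 wn i = 0"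
    and N: "(\<Sum>i\<in>J. (cmod (v i - Dop n1 n2 wn i))\<^sup>2) \<le> 3 * (\<Sum>i\<in>J. (cmod (Gadj n1 n2 Md i))\<^sup>2)"
  proof (rule hard_thr_outliers[OF thr \<Omega>(2) K(1) kb(1), of "Dop n1 n2 wn" "Gadj n1 n2 Md"])
    show "Dop n1 n2 wn i = 0" if "i \<in> \<Omega>" "i \<notin> K" for i using that by (simp add: K_def Dop_def)
  qed (auto simp: projO_def fi GM)
  define e where "e i = Gadj n1 n2 Md i + (v i - Dop n1 n2 wn i)" for i
  have procr: "procr n1 n2 r Lnat Rnat A B Q = fro2 n1 r (msub A X) + fro2 n2 r (msub B Y)" for A B
    by (simp add: procr_def XY)
  interpret st: hankel_step n1 n2 r l0 p \<nu> s1 sr \<Omega> U V S L R e "\<lambda>i. v i - Dop n1 n2 wn i" J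
  proof
    show "rowsq r L a \<le> 3 * s1 * \<nu>" if "a < n1" for a by (rule rows(1)[OF that])
    show "rowsq r R b \<le> 3 * s1 * \<nu>" if "b < n2" for b by (rule rows(2)[OF that])
    show "fro2 n1 r (msub L (mmul r U S)) + fro2 n2 r (msub R (mmul r V S)) \<le> sr / 10000"
      using near by (simp add: dQ procr X_def Y_def)
    show "J \<subseteq> \<Omega>" by (rule J(1))
    show "real (card J) * \<nu> * s1 \<le> p * sr / 1000"
    proof -
      have "real (card J) \<le> 3 * (\<alpha> * p * n)" using J(2) kb(2) K(2) by linarith
      then have "real (card J) * \<nu> * s1 \<le> 3 * (\<alpha> * p * n) * \<nu> * s1"
        using \<nu> sr by (intro mult_right_mono) auto
      then show ?thesis using outl_p by linarith
    qed
    show "v i - Dop n1 n2 wn i = 0" if "i \<in> \<Omega>" "i \<notin> J" for i by (rule N0[OF that])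
    show "e i = Gadj n1 n2 (msub (mmul r L (ctr R)) (mmul r (mmul r U S) (ctr (mmul r V S)))) i + (v i - Dop n1 n2 wn i)" for i
      by (simp add: e_def Md_def X_def Y_def)
    show "(\<Sum>i\<in>J. (cmod (v i - Dop n1 n2 wn i))\<^sup>2)
      \<le> 3 * (\<Sum>i\<in>J. (cmod (Gadj n1 n2 (msub (mmul r L (ctr R)) (mmul r (mmul r U S) (ctr (mmul r V S)))) i))\<^sup>2)"
      using N by (simp only: Md_def X_def Y_def)
    fix i j assume ij: "i < r" "j < r"
    let ?C = "\<lambda>k l. (\<Sum>a<n1. cnj (L a l) * X a k) + (\<Sum>b<n2. cnj (R b l) * Y b k)"
    let ?P = "\<lambda>k l. (\<Sum>a<n1. cnj (X a k) * X a l) + (\<Sum>b<n2. cnj (Y b k) * Y b l)"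
    have C: "?C i j = cnj (?C j i)"
      using procr_gauge[OF Q Qmin ij] unfolding XY .
    have G: "mmul n1 (ctr X) (msub L X) k l + mmul n2 (ctr Y) (msub R Y) k l = cnj (?C k l) - ?P k l" for k l
      by (simp add: mmul_def ctr_def msub_def right_diff_distrib sum_subtractf mult.commute)
    have "?P i j = cnj (?P j i)" by (simp add: mult.commute)
    then show "mmul n1 (ctr (mmul r U S)) (msub L (mmul r U S)) i j + mmul n2 (ctr (mmul r V S)) (msub R (mmul r V S)) i j
      = cnj (mmul n1 (ctr (mmul r U S)) (msub L (mmul r U S)) j i + mmul n2 (ctr (mmul r V S)) (msub R (mmul r V S)) j i)"
      unfolding X_def[symmetric] Y_def[symmetric] G complex_cnj_diff complex_cnj_cnj using C by simp
  qed
  have res: "e i = Gadj n1 n2 (mmul r L (ctr R)) i + s i - f i" if "i \<in> \<Omega>" for i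
    using that \<Omega>(1) s[of i] by (simp add: e_def GM fi)
  have X': "sh.Lh = X" "sh.Rh = Y" by (simp_all add: sh.Lh_def sh.Rh_def X_def Y_def)
  have d2: "st.d2 = procr n1 n2 r Lnat Rnat L R Q"
    by (simp add: st.d2_def st.dL_def st.dR_def X' procr)
  have rX: "rowsq r X a \<le> BL" if "a < n1" for a using sh.row_truth(1)[OF that] BL by (simp add: X')
  have rY: "rowsq r Y b \<le> BR" if "b < n2" for b using sh.row_truth(2)[OF that] BR by (simp add: X')
  \<comment> \<open>The old rotation is merely admissible for the new iterate. Projecting onto the
    constraint sets does not increase the distance to the feasible X and Y.\<close>
  have "(dist_fac n1 n2 r Lnat Rnat L' R')\<^sup>2 \<le> fro2 n1 r (msub L' X) + fro2 n2 r (msub R' Y)"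
    using dist_fac_le[OF Q] by (simp only: procr[symmetric])
  also have "\<dots> \<le> fro2 n1 r (msub (msub L (mscale (complex_of_real (ct / s1)) (gradL n1 n2 r p (1/16) \<Omega> f s L R))) X)
      + fro2 n2 r (msub (msub R (mscale (complex_of_real (ct / s1)) (gradR n1 n2 r p (1/16) \<Omega> f s L R))) Y)"
    by (intro add_mono is_row_proj_nonexpansive[OF L' dims(1) rX] is_row_proj_nonexpansive[OF R' dims(2) rY])
  also have "\<dots> \<le> (1 - ct / s1 * sr / 64) * st.d2"
    using st.gradient_step[OF res ct] by (simp only: X')
  finally show ?thesis by (simp only: d2 dQ)
qed

lemma hsgd_converges:
  assumes run: "hsgd n1 n2 r \<mu> \<alpha> p (1/16) (ct / \<sigma> 0) \<gamma> \<Omega> f L R s"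
    and init: "dist_fac n1 n2 r Lnat Rnat (L 0) (R 0) \<le> (1/100) * sqrt (\<sigma> (r - 1) / (\<sigma> 0 / \<sigma> (r - 1)))"
  shows "(dist_fac n1 n2 r Lnat Rnat (L (Suc k)) (R (Suc k)))\<^sup>2
    \<le> (1 - ct / \<sigma> 0 * \<sigma> (r - 1) / 64) ^ k * (dist_fac n1 n2 r Lnat Rnat (L 0) (R 0))\<^sup>2"
proof -
  let ?d = "\<lambda>k. (dist_fac n1 n2 r Lnat Rnat (L k) (R k))\<^sup>2" and ?q = "1 - ct / s1 * sr / 64"
  obtain v U0 \<sigma>0 V0 BL BR where thr0: "hard_thr n (keep (\<alpha> * p) n) (Dinv n1 n2 (projO \<Omega> f)) v"
      "\<And>i. i < n \<Longrightarrow> s 0 i = Dop n1 n2 v i"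
    and svd0: "trunc_svd n1 n2 r (mscale (complex_of_real (1 / p)) (Gop n1 n2 (\<lambda>i. projO \<Omega> f i - s 0 i))) U0 \<sigma>0 V0"
    and BL: "BL = 2 * \<mu> * real r * cs_of n1 n2 / real n * (opnorm n1 r (mmul r U0 (diagm (\<lambda>i. sqrt (\<sigma>0 i)))))\<^sup>2"
    and BR: "BR = 2 * \<mu> * real r * cs_of n1 n2 / real n * (opnorm n2 r (mmul r V0 (diagm (\<lambda>i. sqrt (\<sigma>0 i)))))\<^sup>2"
    and L0: "is_row_proj n1 r BL (mmul r U0 (diagm (\<lambda>i. sqrt (\<sigma>0 i)))) (L 0)"
    and R0: "is_row_proj n2 r BR (mmul r V0 (diagm (\<lambda>i. sqrt (\<sigma>0 i)))) (R 0)"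
    and iter: "\<And>k. (\<exists>v. hard_thr n (keep (\<gamma> k * \<alpha> * p) n) (projO \<Omega> (\<lambda>i. f i - Gadj n1 n2 (mmul r (L k) (ctr (R k))) i)) v
          \<and> (\<forall>i<n. s (Suc k) i = v i))
        \<and> is_row_proj n1 r BL (msub (L k) (mscale (complex_of_real (ct / s1)) (gradL n1 n2 r p (1/16) \<Omega> f (s (Suc k)) (L k) (R k)))) (L (Suc k))
        \<and> is_row_proj n2 r BR (msub (R k) (mscale (complex_of_real (ct / s1)) (gradR n1 n2 r p (1/16) \<Omega> f (s (Suc k)) (L k) (R k)))) (R (Suc k))"
    using run unfolding hsgd_def Let_def n s1_def by blast
  have B: "s1 * \<nu> \<le> BL" "BL \<le> 3 * s1 * \<nu>" "s1 * \<nu> \<le> BR" "BR \<le> 3 * s1 * \<nu>"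
    using init_bounds[OF thr0 svd0] by (simp_all only: BL BR)
  have rows: "rowsq r (L k) a \<le> 3 * s1 * \<nu>" if "a < n1" for k a
  proof -
    have "rowsq r (L k) a \<le> BL" using is_row_proj_rows[OF L0 dims(1) that] is_row_proj_rows[OF _ dims(1) that] iter by (cases k) blast+
    then show ?thesis using B by linarith
  qed
  have rows': "rowsq r (R k) b \<le> 3 * s1 * \<nu>" if "b < n2" for k b
  proof -
    have "rowsq r (R k) b \<le> BR" using is_row_proj_rows[OF R0 dims(2) that] is_row_proj_rows[OF _ dims(2) that] iter by (cases k) blast+
    then show ?thesis using B by linarith
  qed
  have step: "?d (Suc k) \<le> ?q * ?d k" if near: "?d k \<le> sr / 10000" for k
  proof -
    obtain v where v: "hard_thr n (keep (\<gamma> k * \<alpha> * p) n) (projO \<Omega> (\<lambda>i. f i - Gadj n1 n2 (mmul r (L k) (ctr (R k))) i)) v"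
      "\<And>i. i < n \<Longrightarrow> s (Suc k) i = v i" using iter by blast
    show ?thesis
      by (rule contraction[OF rows rows' near v B(1,3)]) (use iter in auto)
  qed
  have q: "0 \<le> ?q" "?q \<le> 1"
  proof -
    have le: "ct * (sr / s1) \<le> ct * 1" using sr ct by (intro mult_left_mono) auto
    have e: "?q = 1 - ct * (sr / s1) / 64" by simp
    show "0 \<le> ?q" unfolding e using le ct by argo
    show "?q \<le> 1" using ct sr by simp
  qed
  \<comment> \<open>The squared initial radius is \<open>sr\<close>^2 / (10000 \<open>s1\<close>),
    and \<open>sr\<close> \<le> \<open>s1\<close>.\<close>
  have init': "?d 0 \<le> sr / 10000"
  proof -
    have "?d 0 \<le> ((1/100) * sqrt (sr / (s1 / sr)))\<^sup>2"
      by (rule power_mono[OF init[folded s1_def sr_def] dist_fac_nonneg])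
    also have "\<dots> = sr * (sr / s1) / 10000" using sr by (simp add: power_mult_distrib power_divide)
    also have "\<dots> \<le> sr * 1 / 10000" using sr by (intro divide_right_mono mult_left_mono) auto
    finally show ?thesis by simp
  qed
  \<comment> \<open>Closeness is carried along with the rate, since each contraction presupposes it
    and, its factor being at most 1, preserves it.\<close>
  have all: "?d k \<le> sr / 10000 \<and> ?d k \<le> ?q ^ k * ?d 0" for k
  proof (induction k)
    case 0
    then show ?case using init' by simp
  next
    case (Suc k)
    have st: "?d (Suc k) \<le> ?q * ?d k" using Suc step by blast
    have "?q * ?d k \<le> 1 * ?d k" by (rule mult_right_mono[OF q(2)]) simp
    moreover have "?q * ?d k \<le> ?q * (?q ^ k * ?d 0)" using Suc q by (intro mult_left_mono) auto
    ultimately show ?case using st Suc by (simp add: mult.assoc)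
  qed
  \<comment> \<open>k + 1 steps give the exponent k + 1; one factor is dropped to match the exponent
    k of the claim.\<close>
  have "?d (Suc k) \<le> ?q * (?q ^ k * ?d 0)" using all[of "Suc k"] by (simp add: mult.assoc)
  also have "\<dots> \<le> 1 * (?q ^ k * ?d 0)" using q by (intro mult_right_mono) auto
  finally show ?thesis by (simp add: s1_def sr_def)
qed

end

section \<open>From good samples to the probability statement\<close>

lemma hsgd_problem_prob:
  assumes "1 \<le> n1" "1 \<le> n2" "1 \<le> r" "compact_svd n1 n2 r (hank xn) U \<sigma> V"
    and "norm2inf n1 r U \<le> sqrt (\<mu> * cs_of n1 n2 * real r / real (n1 + n2 - 1))"
    and "norm2inf n2 r V \<le> sqrt (\<mu> * cs_of n1 n2 * real r / real (n1 + n2 - 1))"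
    and "0 < p" "p \<le> 1"
    and "1000000 * (cs_of n1 n2)\<^sup>2 * \<mu>\<^sup>2 * (real r)\<^sup>2 * ln (real (n1 + n2 - 1)) / real (n1 + n2 - 1) \<le> p"
    and "\<alpha> \<le> (1/3000) / (cs_of n1 n2 * \<mu> * real r * (\<sigma> 0 / \<sigma> (r - 1))\<^sup>2)"
    and "\<And>k. 1 \<le> \<gamma> k" "\<And>k. \<gamma> k \<le> 2" "0 < ct" "ct \<le> 1 / 20000"
  defines "d \<equiv> dist_fac n1 n2 r (mmul r U (diagm (\<lambda>i. sqrt (\<sigma> i)))) (mmul r V (diagm (\<lambda>i. sqrt (\<sigma> i))))"
  shows "1 - 6 / (real (n1 + n2 - 1))\<^sup>2 \<le> measure_pmf.prob (bern_model (n1 + n2 - 1) p)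
    {\<omega>. real (card {i \<in> {i. i < n1 + n2 - 1 \<and> \<omega> i}. wn i \<noteq> 0}) \<le> \<alpha> * p * real (n1 + n2 - 1) \<longrightarrow>
      (\<forall>L R s. hsgd n1 n2 r \<mu> \<alpha> p (1/16) (ct / \<sigma> 0) \<gamma> {i. i < n1 + n2 - 1 \<and> \<omega> i} (Dop n1 n2 (\<lambda>i. xn i + wn i)) L R s \<longrightarrow>
         d (L 0) (R 0)
           \<le> 1/100 * sqrt (\<sigma> (r - 1) / (\<sigma> 0 / \<sigma> (r - 1))) \<longrightarrow>
         (\<forall>k. (d (L (Suc k)) (R (Suc k)))\<^sup>2
            \<le> (1 - ct / \<sigma> 0 * \<sigma> (r - 1) / 64) ^ k
              * (d (L 0) (R 0))\<^sup>2))}"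
    (is "_ \<le> measure_pmf.prob ?M ?A")
proof (cases "n1 + n2 - 1 \<le> 2")
  \<comment> \<open>For n \<le> 2 the claimed probability 1 - 6/n^2 is negative.\<close>
  case True
  then have "n1 + n2 - 1 = 1 \<or> n1 + n2 - 1 = 2" using assms(1,2) by linarith
  then have "real (n1 + n2 - 1) = 1 \<or> real (n1 + n2 - 1) = 2" by (metis of_nat_1 of_nat_numeral)
  then have "1 - 6 / (real (n1 + n2 - 1))\<^sup>2 \<le> 0" by (elim disjE) simp_all
  then show ?thesis by (rule order_trans) (rule measure_nonneg)
next
  case False
  then have n3: "3 \<le> n1 + n2 - 1" by linarith
  interpret hsgd_problem n1 n2 r \<mu> xn wn U V \<sigma> p \<alpha> ct \<gamma>
    by unfold_locales (fact assms | fact n3)+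
  have "{\<omega>. sampling_event n1 n2 r p s1 xn U V \<omega>} \<subseteq> ?A"
  proof (intro subsetI CollectI impI allI)
    fix \<omega> L R s k
    assume ev: "\<omega> \<in> {\<omega>. sampling_event n1 n2 r p s1 xn U V \<omega>}"
      and sp: "real (card {i \<in> {i. i < n1 + n2 - 1 \<and> \<omega> i}. wn i \<noteq> 0}) \<le> \<alpha> * p * real (n1 + n2 - 1)"
      and run: "hsgd n1 n2 r \<mu> \<alpha> p (1/16) (ct / \<sigma> 0) \<gamma> {i. i < n1 + n2 - 1 \<and> \<omega> i} (Dop n1 n2 (\<lambda>i. xn i + wn i)) L R s"
      and init: "d (L 0) (R 0)
           \<le> 1/100 * sqrt (\<sigma> (r - 1) / (\<sigma> 0 / \<sigma> (r - 1)))"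
    interpret hsgd_sample n1 n2 r \<mu> xn wn U V \<sigma> p \<alpha> ct \<gamma> \<omega> "{i. i < n1 + n2 - 1 \<and> \<omega> i}"
      by unfold_locales (use ev sp in \<open>simp_all add: s1_def\<close>)
    show "(d (L (Suc k)) (R (Suc k)))\<^sup>2
            \<le> (1 - ct / \<sigma> 0 * \<sigma> (r - 1) / 64) ^ k
              * (d (L 0) (R 0))\<^sup>2"
      using hsgd_converges[unfolded f_def Lnat_def Rnat_def D_def, folded d_def, OF run init] .
  qed
  then have "measure_pmf.prob ?M {\<omega>. sampling_event n1 n2 r p s1 xn U V \<omega>} \<le> measure_pmf.prob ?M ?A"
    by (rule measure_pmf.finite_measure_mono) simp
  then show ?thesis using sampling_prob by (simp only: n(1))
qed

theorem theorem1:
  shows "\<forall>b0::real. b0 \<ge> 1 \<longrightarrow>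
   (\<exists>C1 C2 C3 c0 :: real. C1 > 0 \<and> C2 > 0 \<and> C3 > 0 \<and> c0 > 0 \<and>
    (\<forall>(n1::nat) (n2::nat) (r::nat) (\<mu>::real) (xn::cvec) (wn::cvec) (U::cmat) (\<sigma>::nat \<Rightarrow> real)
      (V::cmat) (p::real) (\<alpha>::real) (\<gamma>::nat \<Rightarrow> real) (ct::real).
     let n = n1 + n2 - 1; cs = cs_of n1 n2; \<kappa> = \<sigma> 0 / \<sigma> (r - 1);
         \<eta> = ct / \<sigma> 0; lam = 1 / 16;
         f = Dop n1 n2 (\<lambda>i. xn i + wn i);
         Lnat = mmul r U (diagm (\<lambda>i. sqrt (\<sigma> i)));
         Rnat = mmul r V (diagm (\<lambda>i. sqrt (\<sigma> i)))
     in
     1 \<le> n1 \<longrightarrow> 1 \<le> n2 \<longrightarrow> 1 \<le> r \<longrightarrow>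
     compact_svd n1 n2 r (hank xn) U \<sigma> V \<longrightarrow>
     norm2inf n1 r U \<le> sqrt (\<mu> * cs * real r / real n) \<longrightarrow>
     norm2inf n2 r V \<le> sqrt (\<mu> * cs * real r / real n) \<longrightarrow>
     0 < p \<longrightarrow> p \<le> 1 \<longrightarrow>
     p \<ge> C1 * cs\<^sup>2 * \<mu>\<^sup>2 * (real r)\<^sup>2 * ln (real n) / real n \<longrightarrow>
     \<alpha> \<le> C2 / (cs * \<mu> * real r * \<kappa>\<^sup>2) \<longrightarrow>
     (\<forall>k. 1 + 1 / b0 \<le> \<gamma> k \<and> \<gamma> k \<le> 2) \<longrightarrow>
     0 < ct \<longrightarrow> ct \<le> c0 \<longrightarrow>
     measure_pmf.prob (bern_model n p)
       {\<omega>. let \<Omega> = {i. i < n \<and> \<omega> i} in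
          real (card {i \<in> \<Omega>. wn i \<noteq> 0}) \<le> \<alpha> * p * real n \<longrightarrow>
          (\<forall>L R s. hsgd n1 n2 r \<mu> \<alpha> p lam \<eta> \<gamma> \<Omega> f L R s \<longrightarrow>
             dist_fac n1 n2 r Lnat Rnat (L 0) (R 0) \<le> C3 * sqrt (\<sigma> (r - 1) / \<kappa>) \<longrightarrow>
             (\<forall>k. (dist_fac n1 n2 r Lnat Rnat (L (Suc k)) (R (Suc k)))\<^sup>2
                  \<le> (1 - \<eta> * \<sigma> (r - 1) / 64) ^ k * (dist_fac n1 n2 r Lnat Rnat (L 0) (R 0))\<^sup>2))}
       \<ge> 1 - 6 / (real n)\<^sup>2))"
proof (unfold Let_def, intro allI impI, rule exI[of _ 1000000], rule exI[of _ "1/3000"], rule exI[of _ "1/100"],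
    rule exI[of _ "1/20000"], intro conjI allI impI, goal_cases)
  \<comment> \<open>The other four goals are the positivity of the constants 10^6, 1/3000, 1/100 and
    1/20000.\<close>
  case (5 b0 n1 n2 r \<mu> xn wn U \<sigma> V p \<alpha> \<gamma> ct)
  have "0 \<le> 1 / b0" using 5(1) by simp
  then have g: "1 \<le> \<gamma> k" "\<gamma> k \<le> 2" for k using 5(12) by (smt (verit))+
  show ?case by (rule hsgd_problem_prob) (use 5 g in auto)
qed simp_all

end
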